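(* Let $T=T_{\mathcal Q}$ be the map associated to the random walk on $\mathbb Z$ with the transition matrix $\mathcal Q=(q_{jk})$ given in the context. Then $T$ is irreducible, conservative and exact. Moreover: (a) $T$ is mixing of type (GLM1) for any $\mathcal G\subset L^\infty$ and $\mathcal L=L^1$: for all $F\in L^\infty(\mathbb R,m)$ and $g\in L^1(\mathbb R,m)$ with $m(g)=0$, $\lim_{n\to\infty}m((F\circ T^n)g)=0$; (b) $T$ is mixing of type (GGM1) w.r.t. $\mathcal G_2$: for all $F,G\in\mathcal G_2$, $\overline m((F\circ T^n)G)$ exists for all sufficiently large $n$ and $\lim_{n\to\infty}\overline m((F\circ T^n)G)=\overline m(F)\,\overline m(G)$; (c) $T$ is (GLM2) relative to the exhaustive family $\mathscr V'=\{[-k,k] : k\in\mathbb Z^+\}$, the class of global observables $\mathcal G'$ and the class of local observables $L^1$: for all $F\in\mathcal G'$ and $g\in L^1(\mathbb R,m)$, $$\lim_{n\to\infty}m((F\circ T^n)g)=\overline m'(F)\,m(g).$$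
   Context: $m$ is Lebesgue measure on $\mathbb R$, $m(g):=\int_{\mathbb R}g\,dm$; functions are complex-valued; set relations are mod $m$. Transition matrix: for $j\notin\{-1,0,1\}$, $q_{j,j-2}=q_{j,j+2}=\tfrac19$, $q_{j,j-1}=q_{j,j+1}=\tfrac29$, $q_{j,j}=\tfrac39$. For $j=-1$: $q_{-1,-3}=\tfrac19$, $q_{-1,-2}=\tfrac29$, $q_{-1,-1}=\tfrac59$, $q_{-1,0}=\tfrac19$, $q_{-1,1}=0$. For $j=0$: $q_{0,-2}=q_{0,-1}=\tfrac19$, $q_{0,0}=\tfrac59$, $q_{0,1}=q_{0,2}=\tfrac19$. For $j=1$: $q_{1,-1}=0$, $q_{1,0}=\tfrac19$, $q_{1,1}=\tfrac59$, $q_{1,2}=\tfrac29$, $q_{1,3}=\tfrac19$. All other entries are $0$. Associated map: for $j\in\mathbb Z$ and $j-2\le k\le j+2$ with $q_{jk}>0$, let $I_{jk}:=\left[j+\sum_{i=j-2}^{k-1}q_{ji},\ j+\sum_{i=j-2}^{k}q_{ji}\right]$ (an empty sum is $0$), and for $x$ in the interior of $I_{jk}$ let $T(x):=\frac1{q_{jk}}\left(x-j-\sum_{i=j-2}^{k-1}q_{ji}\right)+k$; so $T$ maps $I_{jk}$ affinely onto $[k,k+1]$. Values of $T$ at other points are irrelevant. $T$ preserves $m$ and $\{I_{jk}\}$ is its Markov partition. Irreducible: for any two intervals $I,I'$ of the Markov partition there is $n\ge1$ with $T^nI\supseteq I'$. Conservative: no set $W$ with $m(W)>0$ has pairwise disjoint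 preimages $T^{-n}W$, $n\ge0$. Exact: every set in $\bigcap_{n\ge0}T^{-n}\mathscr B$ ($\mathscr B$ the Borel $\sigma$-algebra) is null or has null complement. $\overline m(F):=\lim_{r\to\infty}\frac1{2r}\int_{x_0-r}^{x_0+r}F\,dm$, provided the limit exists uniformly in $x_0\in\mathbb R$ and is independent of it. $\mathcal G_2$ is the $L^\infty$-closure of $\mathrm{span}_{\mathbb C}\{F\in L^\infty:\exists\beta\in\mathbb R,\ F(x+1)=e^{i\beta}F(x)\text{ for a.e. }x\}$. $\mathcal G':=\left\{F\in L^\infty(\mathbb R,m):\ \overline m'(F):=\lim_{k\to\infty}\frac1{2k+1}\int_{-k}^{k}F\,dm\ \text{exists}\right\}$. *)

theory Defs
  imports "HOL-Analysis.Analysis"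
begin

definition walkQ :: "int \<Rightarrow> int \<Rightarrow> real" where
  "walkQ j k =
     (if j = -1 then
        (if k = -3 then 1/9 else if k = -2 then 2/9 else if k = -1 then 5/9
         else if k = 0 then 1/9 else 0)
      else if j = 0 then
        (if k = -2 \<or> k = -1 then 1/9 else if k = 0 then 5/9
         else if k = 1 \<or> k = 2 then 1/9 else 0)
      else if j = 1 then
        (if k = 0 then 1/9 else if k = 1 then 5/9 else if k = 2 then 2/9
         else if k = 3 then 1/9 else 0)
      else
        (if k = j - 2 \<or> k = j + 2 then 1/9 else if k = j - 1 \<or> k = j + 1 then 2/9
         else if k = j then 3/9 else 0))"

definition branch_interval :: "(int \<Rightarrow> int \<Rightarrow> real) \<Rightarrow> int \<Rightarrow> int \<Rightarrow> real set" where
  "branch_interval Q j k =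
     {of_int j + (\<Sum>i\<in>{j-2..k-1}. Q j i) .. of_int j + (\<Sum>i\<in>{j-2..k}. Q j i)}"

definition markov_partition :: "(int \<Rightarrow> int \<Rightarrow> real) \<Rightarrow> real set set" where
  "markov_partition Q =
     {branch_interval Q j k | j k. j - 2 \<le> k \<and> k \<le> j + 2 \<and> Q j k > 0}"

text \<open>The map is prescribed only on the interiors of the branch intervals.  Its values on the
  remaining countable set are left arbitrary, so results about all \<open>T\<close> with
  \<open>associated_map Q T\<close> hold for every choice of these values.  Measurability of \<open>T\<close> is automatic.\<close>

definition associated_map :: "(int \<Rightarrow> int \<Rightarrow> real) \<Rightarrow> (real \<Rightarrow> real) \<Rightarrow> bool" where
  "associated_map Q T \<longleftrightarrow>
     (\<forall>j k. j - 2 \<le> k \<and> k \<le> j + 2 \<and> Q j k > 0 \<longrightarrow>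
       (\<forall>x\<in>interior (branch_interval Q j k).
          T x = 1 / Q j k * (x - of_int j - (\<Sum>i\<in>{j-2..k-1}. Q j i)) + of_int k))"

lemma walkQ_nonneg: "walkQ j k \<ge> 0"
proof -
  have if_nonneg: "0 \<le> (if c then a else b)" if "0 \<le> a" "0 \<le> b" for c and a b :: real
    using that by simp
  show ?thesis unfolding walkQ_def by (intro if_nonneg) simp_all
qed

lemma walkQ_row_sum: "(\<Sum>i\<in>{j-2..j+2}. walkQ j i) = 1"
proof -
  have "{j-2..j+2} = {j-2, j-1, j, j+1, j+2}" by auto
  then have eq: "(\<Sum>i\<in>{j-2..j+2}. walkQ j i) =
      walkQ j (j-2) + walkQ j (j-1) + walkQ j j + walkQ j (j+1) + walkQ j (j+2)"
    by simp
  consider "j = -1" | "j = 0" | "j = 1" | "j \<noteq> -1" "j \<noteq> 0" "j \<noteq> 1" by blast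
  then show ?thesis unfolding eq by cases (simp_all add: walkQ_def)
qed

lemma ex_associated_map: "\<exists>T. associated_map walkQ T"
proof -
  define S where "S j k = (\<Sum>i\<in>{j-2..k}. walkQ j i)" for j k :: int
  have mono: "S j k \<le> S j k'" if "k \<le> k'" for j k k'
    unfolding S_def using that by (intro sum_mono2) (auto simp: walkQ_nonneg)
  have S1: "S j (j+2) = 1" for j unfolding S_def by (rule walkQ_row_sum)
  have S0: "S j k \<ge> 0" for j k unfolding S_def by (intro sum_nonneg walkQ_nonneg)
  define P where "P x j k \<longleftrightarrow> j - 2 \<le> k \<and> k \<le> j + 2 \<and> x \<in> interior (branch_interval walkQ j k)"
    for x j k
  have P: "k \<le> j + 2 \<and> of_int j + S j (k - 1) < x \<and> x < of_int j + S j k" if "P x j k" for x j k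
    using that by (auto simp: P_def branch_interval_def S_def)
  have fl: "j = \<lfloor>x\<rfloor>" if "P x j k" for x j k
    using P[OF that] S0[of j "k-1"] mono[of k "j+2" j] S1[of j] by linarith
  have nlt: "\<not> k < k'" if "P x j k" "P x j k'" for x j k k'
    using P[OF that(1)] P[OF that(2)] mono[of k "k'-1" j] by linarith
  have uniq: "j = j' \<and> k = k'" if "P x j k" "P x j' k'" for x j k j' k'
  proof -
    have "j = j'" using fl[OF that(1)] fl[OF that(2)] by simp
    with that nlt[of x j k k'] nlt[of x j k' k] show ?thesis by auto
  qed
  define T where "T x = (let (j, k) = (THE (j, k). P x j k) in
     1 / walkQ j k * (x - of_int j - (\<Sum>i\<in>{j-2..k-1}. walkQ j i)) + of_int k)" for x :: real
  have "(THE (j, k). P x j k) = (j, k)" if "P x j k" for x j k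
    using that uniq by (intro the_equality) auto
  then have "T x = 1 / walkQ j k * (x - of_int j - (\<Sum>i\<in>{j-2..k-1}. walkQ j i)) + of_int k"
    if "P x j k" for x j k
    unfolding T_def using that by (simp only: Let_def prod.case)
  then have "associated_map walkQ T"
    unfolding associated_map_def P_def by blast
  then show ?thesis by blast
qed

text \<open>As usual in measure theory, relations between sets are understood modulo Lebesgue-null
  sets; this is the role of \<open>AE\<close> and \<open>null_sets\<close> below.\<close>

definition irreducible_map :: "real set set \<Rightarrow> (real \<Rightarrow> real) \<Rightarrow> bool" where
  "irreducible_map \<P> T \<longleftrightarrow>
     (\<forall>I\<in>\<P>. \<forall>I'\<in>\<P>. \<exists>n\<ge>1. AE x in lborel. x \<in> I' \<longrightarrow> x \<in> (T ^^ n) ` I)"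

definition conservative_map :: "(real \<Rightarrow> real) \<Rightarrow> bool" where
  "conservative_map T \<longleftrightarrow>
     \<not> (\<exists>W\<in>sets borel. emeasure lborel W > 0 \<and>
          (\<forall>m n. m \<noteq> n \<longrightarrow> ((T ^^ m) -` W) \<inter> ((T ^^ n) -` W) \<in> null_sets lborel))"

definition exact_map :: "(real \<Rightarrow> real) \<Rightarrow> bool" where
  "exact_map T \<longleftrightarrow>
     (\<forall>A \<in> (\<Inter>n. {(T ^^ n) -` B | B. B \<in> sets borel}).
        A \<in> null_sets lborel \<or> - A \<in> null_sets lborel)"

text \<open>Elements of the Lebesgue spaces are represented by Borel functions.\<close>

definition L_infty :: "(real \<Rightarrow> complex) set" where
  "L_infty = {F \<in> borel_measurable lborel. \<exists>C. AE x in lborel. norm (F x) \<le> C}"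

definition L_one :: "(real \<Rightarrow> complex) set" where
  "L_one = {g. integrable lborel g}"

definition has_mean :: "(real \<Rightarrow> complex) \<Rightarrow> complex \<Rightarrow> bool" where
  "has_mean F l \<longleftrightarrow>
     uniform_limit UNIV
       (\<lambda>r x0. complex_of_real (1 / (2 * r)) * (LINT x:{x0 - r..x0 + r}|lborel. F x))
       (\<lambda>x0. l) at_top"

definition mean_exists :: "(real \<Rightarrow> complex) \<Rightarrow> bool" where
  "mean_exists F \<longleftrightarrow> (\<exists>l. has_mean F l)"

definition mean :: "(real \<Rightarrow> complex) \<Rightarrow> complex" where
  "mean F = (THE l. has_mean F l)"

definition quasi_periodic :: "(real \<Rightarrow> complex) set" where
  "quasi_periodic =
     {F \<in> L_infty. \<exists>\<beta>::real. AE x in lborel. F (x + 1) = exp (\<i> * of_real \<beta>) * F x}"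

definition quasi_periodic_span :: "(real \<Rightarrow> complex) set" where
  "quasi_periodic_span =
     {\<lambda>x. \<Sum>i<n. c i * H i x | (n::nat) (c :: nat \<Rightarrow> complex) H. \<forall>i<n. H i \<in> quasi_periodic}"

definition G2 :: "(real \<Rightarrow> complex) set" where
  "G2 = {F \<in> L_infty. \<forall>\<epsilon>>0. \<exists>H\<in>quasi_periodic_span. AE x in lborel. norm (F x - H x) \<le> \<epsilon>}"

definition sym_average :: "(real \<Rightarrow> complex) \<Rightarrow> nat \<Rightarrow> complex" where
  "sym_average F k = complex_of_real (1 / (2 * real k + 1)) * (LINT x:{- real k..real k}|lborel. F x)"

definition G_sym :: "(real \<Rightarrow> complex) set" where
  "G_sym = {F \<in> L_infty. convergent (sym_average F)}"

definition sym_mean :: "(real \<Rightarrow> complex) \<Rightarrow> complex" where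
  "sym_mean F = lim (sym_average F)"

end

theory Submission
  imports Defs
begin

text \<open>
  The integral of \<open>F \<circ> T^n\<close> over \<open>[j, j + 1]\<close> is the \<open>n\<close>-th iterate of \<open>walkQ\<close> applied to the sequence of cell
  integrals of \<open>F\<close>; and since \<open>T\<close> expands by at least \<open>9/5\<close>, a Lipschitz density becomes constant on
  cells exponentially fast.  So everything reduces to \<open>walkQ\<close>, which is symmetric and preserves
  even unimodal distributions.  The distributions \<open>\<delta>\<^sub>0 walkQ^n\<close> are therefore mixtures of uniform
  distributions on symmetric intervals, which gives (c); their total variation distance to their
  successors is at most a multiple of their maximum, which tends to \<open>0\<close> but is at least \<open>1/(4n + 1)\<close>, whence
  recurrence.  Bounded subharmonic functions of a recurrent walk are constant; applied to the limit
  total variation distance between the walks started at \<open>i\<close> and at \<open>0\<close>, this gives (a) uniformly in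
  \<open>F\<close>, hence exactness.  For (b), far from the origin \<open>walkQ\<close> multiplies \<open>exp (\<i> \<beta> k)\<close> by
  \<open>((1 + 2 cos \<beta>)/3)^2\<close>, which is less than \<open>1\<close> unless \<open>\<beta>\<close> is a multiple of \<open>2\<pi>\<close>.
\<close>

section \<open>The random walk\<close>

text \<open>Rows with \<open>\<bar>j\<bar> \<ge> 2\<close> are the convolution square of the uniform
  law on {-1, 0, 1}; only the three middle rows break translation invariance. This perturbation is
  the obstacle: no Fourier formula is available for the walk started near 0, so everything about it
  comes from the peak p_n = \<open>walk_dist n 0\<close>. Non-summability of p_n gives recurrence;
  its convergence to 0 says that one extra step is asymptotically invisible at 0, with error 12 p_n.
  The latter makes the limit distance between starting at i and at 0 subharmonic in i, because the
  reference state may be held fixed while i takes a step. For an integrable density, time splits as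
  n = a + b: the first a steps of the map flatten the density on cells, the last b act on cell
  integrals alone; a is fixed first, then b tends to infinity. For global observables the middle
  rows are harmless for another reason: n steps move a cell by at most 2n, so beyond distance 2n + 2
  the dynamics commutes with integer translations, and finitely many cells do not influence a mean
  over long windows.\<close>

lemma walkQ_far:
  assumes "\<bar>j\<bar> \<ge> 2"
  shows "walkQ j k = (if \<bar>k - j\<bar> = 2 then 1/9 else if \<bar>k - j\<bar> = 1 then 2/9
    else if k = j then 3/9 else 0)"
proof -
  have "j \<noteq> -1" "j \<noteq> 0" "j \<noteq> 1" using assms by auto
  moreover have "k = j - 2 \<or> k = j + 2 \<longleftrightarrow> \<bar>k - j\<bar> = 2"
    "k = j - 1 \<or> k = j + 1 \<longleftrightarrow> \<bar>k - j\<bar> = 1" by linarith+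
  ultimately show ?thesis by (simp add: walkQ_def)
qed

lemma walkQ_eq_0: "\<bar>k - j\<bar> > 2 \<Longrightarrow> walkQ j k = 0"
proof -
  assume *: "\<bar>k - j\<bar> > 2"
  consider "j = -1" | "j = 0" | "j = 1" | "\<bar>j\<bar> \<ge> 2" by linarith
  then show ?thesis
  proof cases
    case 4
    with * show ?thesis by (subst walkQ_far) auto
  qed (use * in \<open>auto simp: walkQ_def\<close>)
qed

lemma int_abs_le_3_cases:
  fixes k :: int
  obtains "k = -3" | "k = -2" | "k = -1" | "k = 0" | "k = 1" | "k = 2" | "k = 3" | "\<bar>k\<bar> > 3"
  by linarith

text \<open>The middle rows are perturbed reciprocally, so columns also sum to 1 and counting
  measure is stationary. This is why \<open>avg\<close> can serve both as the operator on functions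
  and as the evolution of distributions, and why iterating it on the indicator of 0 gives the law of
  the walk started at 0.\<close>

lemma walkQ_sym: "walkQ j k = walkQ k j"
proof -
  have near: "walkQ j k = walkQ k j" if "\<bar>j\<bar> < 2" for j k
  proof -
    have "j = -1 \<or> j = 0 \<or> j = 1" using that by arith
    then consider "j = -1" | "j = 0" | "j = 1" by blast
    then show ?thesis
    proof cases
      case 1 show ?thesis
        by (cases k rule: int_abs_le_3_cases) (simp_all add: 1 walkQ_def walkQ_eq_0)
    next
      case 2 show ?thesis
        by (cases k rule: int_abs_le_3_cases) (simp_all add: 2 walkQ_def walkQ_eq_0)
    next
      case 3 show ?thesis
        by (cases k rule: int_abs_le_3_cases) (simp_all add: 3 walkQ_def walkQ_eq_0)
    qed
  qed
  have "walkQ j k = walkQ k j" if "\<bar>j\<bar> \<ge> 2" "\<bar>k\<bar> \<ge> 2"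
    by (simp add: walkQ_far[OF that(1)] walkQ_far[OF that(2)] abs_minus_commute)
  with near[of j k] near[of k j] show ?thesis by linarith
qed

lemma walkQ_even: "walkQ (- j) (- k) = walkQ j k"
proof (cases "\<bar>j\<bar> \<ge> 2")
  case True
  then have *: "\<bar>- j\<bar> \<ge> 2" by simp
  have "\<bar>- k - - j\<bar> = \<bar>k - j\<bar>" by linarith
  then show ?thesis by (simp add: walkQ_far[OF True] walkQ_far[OF *])
next
  case False
  then have "j = -1 \<or> j = 0 \<or> j = 1" by arith
  then consider "j = -1" | "j = 0" | "j = 1" by blast
  then show ?thesis
  proof cases
    case 1 show ?thesis
      by (cases k rule: int_abs_le_3_cases) (simp_all add: 1 walkQ_def walkQ_eq_0)
  next
    case 2 show ?thesis
      by (cases k rule: int_abs_le_3_cases) (simp_all add: 2 walkQ_def walkQ_eq_0)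
  next
    case 3 show ?thesis
      by (cases k rule: int_abs_le_3_cases) (simp_all add: 3 walkQ_def walkQ_eq_0)
  qed
qed

text \<open>The bound 5/9 is attained on the diagonal of the three middle rows. It bounds the slopes
  of the inverse branches, hence their contraction rate.\<close>

lemma walkQ_le: "walkQ j k \<le> 5/9"
proof -
  have if_le: "(if c then a else b) \<le> 5/9" if "a \<le> 5/9" "b \<le> 5/9" for c and a b :: real
    using that by simp
  show ?thesis unfolding walkQ_def by (intro if_le) simp_all
qed

text \<open>Nearest neighbour moves keep positive weight everywhere, although the moves between -1
  and 1 are removed. This connects all states, which the recurrence arguments and irreducibility
  both use.\<close>

lemma walkQ_succ: "walkQ j (j + 1) \<ge> 1/9"
proof -
  consider "j = -1" | "j = 0" | "j = 1" | "\<bar>j\<bar> \<ge> 2" by linarith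
  then show ?thesis
  proof cases
    case 4
    then show ?thesis by (subst walkQ_far) auto
  qed (simp_all add: walkQ_def)
qed

lemma walkQ_pred: "walkQ j (j - 1) \<ge> 1/9"
  using walkQ_succ[of "j - 1"] by (simp add: walkQ_sym)

lemma walkQ_shift:
  assumes "\<bar>j\<bar> \<ge> 2" "\<bar>j + d\<bar> \<ge> 2"
  shows "walkQ (j + d) (k + d) = walkQ j k"
proof -
  have "k + d - (j + d) = k - j" by simp
  then show ?thesis by (simp add: walkQ_far[OF assms(1)] walkQ_far[OF assms(2)])
qed


section \<open>The Markov operator on sequences\<close>

definition avg :: "(int \<Rightarrow> 'a) \<Rightarrow> int \<Rightarrow> 'a::real_vector" where
  "avg f k = (\<Sum>l\<in>{k-2..k+2}. walkQ k l *\<^sub>R f l)"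

lemma sum_window:
  fixes h :: "int \<Rightarrow> 'a::comm_monoid_add"
  shows "(\<Sum>l\<in>{k-2..k+2}. h l) = h (k-2) + h (k-1) + h k + h (k+1) + h (k+2)"
proof -
  have "{k-2..k+2} = {k-2, k-1, k, k+1, k+2}" by auto
  then show ?thesis by (simp add: add.assoc)
qed

lemma avg_diff: "avg (\<lambda>k. f k - g k) = (\<lambda>k. avg f k - avg g k)"
  by (simp add: avg_def fun_eq_iff scaleR_diff_right sum_subtractf)

lemma avg_mono:
  fixes f g :: "int \<Rightarrow> real"
  shows "(\<And>k. f k \<le> g k) \<Longrightarrow> avg f k \<le> avg g k"
  unfolding avg_def by (auto intro!: sum_mono mult_left_mono walkQ_nonneg)

lemma avg_const: "avg (\<lambda>k. c) k = c"
  by (simp add: avg_def scaleR_sum_left[symmetric] walkQ_row_sum)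

lemma norm_avg_le:
  fixes f :: "int \<Rightarrow> 'a::real_normed_vector"
  assumes "\<And>k. norm (f k) \<le> C"
  shows "norm (avg f k) \<le> C"
proof -
  have "norm (avg f k) \<le> (\<Sum>l\<in>{k-2..k+2}. walkQ k l * C)"
    unfolding avg_def using assms
    by (intro sum_norm_le) (auto simp: walkQ_nonneg intro!: mult_left_mono)
  also have "\<dots> = C" by (simp add: sum_distrib_right[symmetric] walkQ_row_sum)
  finally show ?thesis .
qed

lemma norm_avg_funpow_le:
  fixes f :: "int \<Rightarrow> 'a::real_normed_vector"
  assumes "\<And>k. norm (f k) \<le> C"
  shows "norm ((avg ^^ n) f k) \<le> C"
  by (induction n arbitrary: k) (auto intro: assms norm_avg_le)

lemma avg_funpow_mono:
  fixes f g :: "int \<Rightarrow> real"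
  assumes "\<And>k. f k \<le> g k"
  shows "(avg ^^ n) f k \<le> (avg ^^ n) g k"
  by (induction n arbitrary: k) (auto intro: assms avg_mono)

lemma avg_funpow_diff:
  "(avg ^^ n) (\<lambda>k. f k - g k) = (\<lambda>k. (avg ^^ n) f k - (avg ^^ n) g k)"
  by (induction n) (auto simp: avg_diff)

lemma avg_funpow_const: "(avg ^^ n) (\<lambda>k. c) = (\<lambda>k. c)"
  by (induction n) (auto simp: avg_const)

lemma avg_cong_window:
  assumes "\<And>l. \<bar>l - k\<bar> \<le> 2 \<Longrightarrow> f l = g l"
  shows "avg f k = avg g k"
  unfolding avg_def by (intro sum.cong) (auto simp: assms)

text \<open>Self-adjointness of the Markov operator for counting measure. The margin 2 in
  \<open>M\<close> is the range of one step, so no mass of \<open>avg v\<close> leaves the summation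
  window.\<close>

lemma avg_scaleR_pairing:
  assumes "\<And>k. \<bar>k\<bar> > m \<Longrightarrow> v k = 0" "M \<ge> m + 2"
  shows "(\<Sum>k\<in>{-M..M}. v k *\<^sub>R avg f k) = (\<Sum>k\<in>{-M..M}. avg v k *\<^sub>R f k)"
proof -
  have "v k *\<^sub>R avg f k = (\<Sum>l\<in>{-M..M}. (v k * walkQ k l) *\<^sub>R f l)" for k
  proof (cases "\<bar>k\<bar> > m")
    case False
    have "avg f k = (\<Sum>l\<in>{-M..M}. walkQ k l *\<^sub>R f l)"
      unfolding avg_def using False assms(2)
      by (intro sum.mono_neutral_left) (auto simp: walkQ_eq_0)
    then show ?thesis by (simp add: scaleR_sum_right)
  qed (simp add: assms)
  then have "(\<Sum>k\<in>{-M..M}. v k *\<^sub>R avg f k)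
      = (\<Sum>k\<in>{-M..M}. \<Sum>l\<in>{-M..M}. (v k * walkQ k l) *\<^sub>R f l)" by simp
  also have "\<dots> = (\<Sum>l\<in>{-M..M}. \<Sum>k\<in>{-M..M}. (v k * walkQ k l) *\<^sub>R f l)"
    by (rule sum.swap)
  also have "\<dots> = (\<Sum>l\<in>{-M..M}. avg v l *\<^sub>R f l)"
  proof (intro sum.cong refl)
    fix l assume l: "l \<in> {-M..M}"
    have "avg v l = (\<Sum>k\<in>{-M..M} \<inter> {l-2..l+2}. walkQ l k * v k)"
      unfolding avg_def using assms by (intro sum.mono_neutral_cong_right) auto
    also have "\<dots> = (\<Sum>k\<in>{-M..M}. walkQ l k * v k)"
      by (intro sum.mono_neutral_left) (auto simp: walkQ_eq_0)
    finally show "(\<Sum>k\<in>{-M..M}. (v k * walkQ k l) *\<^sub>R f l) = avg v l *\<^sub>R f l"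
      by (simp add: scaleR_sum_left[symmetric] walkQ_sym mult.commute)
  qed
  finally show ?thesis .
qed

section \<open>The walk started at 0: unimodality, recurrence, flattening\<close>

definition walk_dist :: "nat \<Rightarrow> int \<Rightarrow> real" where
  "walk_dist n = (avg ^^ n) (\<lambda>k. if k = 0 then 1 else 0)"

lemma walk_dist_Suc: "walk_dist (Suc n) = avg (walk_dist n)"
  by (simp add: walk_dist_def)

lemma walk_dist_nonneg: "walk_dist n k \<ge> 0"
  using avg_funpow_mono[of "\<lambda>_. 0" "\<lambda>k. if k = 0 then 1 else 0" n k]
  by (simp add: walk_dist_def avg_funpow_const)

lemma walk_dist_support: "\<bar>k\<bar> > 2 * int n \<Longrightarrow> walk_dist n k = 0"
proof (induction n arbitrary: k)
  case (Suc n)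
  have "avg (walk_dist n) k = avg (\<lambda>_. 0) k"
    using Suc by (intro avg_cong_window) auto
  then show ?case by (simp add: walk_dist_Suc avg_const)
qed (auto simp: walk_dist_def)

lemma walk_dist_even: "walk_dist n (- k) = walk_dist n k"
proof (induction n arbitrary: k)
  case (Suc n)
  have "walkQ (- k) l = walkQ k (- l)" for l
    using walkQ_even[of k "- l"] by simp
  then show ?case unfolding walk_dist_Suc avg_def
    by (intro sum.reindex_bij_witness[of _ uminus uminus]) (auto simp: Suc)
qed (auto simp: walk_dist_def)

lemma avg_at_0: "avg f 0 = (1/9) *\<^sub>R f (-2) + (1/9) *\<^sub>R f (-1) + (5/9) *\<^sub>R f 0
    + (1/9) *\<^sub>R f 1 + (1/9) *\<^sub>R f 2"
  and avg_at_1: "avg f 1 = (1/9) *\<^sub>R f 0 + (5/9) *\<^sub>R f 1 + (2/9) *\<^sub>R f 2 + (1/9) *\<^sub>R f 3"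
  and avg_ge_2: "\<bar>k\<bar> \<ge> 2 \<Longrightarrow> avg f k = (1/9) *\<^sub>R f (k-2) + (2/9) *\<^sub>R f (k-1) + (3/9) *\<^sub>R f k
    + (2/9) *\<^sub>R f (k+1) + (1/9) *\<^sub>R f (k+2)"
proof -
  show "avg f 0 = (1/9) *\<^sub>R f (-2) + (1/9) *\<^sub>R f (-1) + (5/9) *\<^sub>R f 0
    + (1/9) *\<^sub>R f 1 + (1/9) *\<^sub>R f 2"
    unfolding avg_def sum_window by (simp add: walkQ_def)
  show "avg f 1 = (1/9) *\<^sub>R f 0 + (5/9) *\<^sub>R f 1 + (2/9) *\<^sub>R f 2 + (1/9) *\<^sub>R f 3"
    unfolding avg_def sum_window by (simp add: walkQ_def)
  show "avg f k = (1/9) *\<^sub>R f (k-2) + (2/9) *\<^sub>R f (k-1) + (3/9) *\<^sub>R f k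
    + (2/9) *\<^sub>R f (k+1) + (1/9) *\<^sub>R f (k+2)" if "\<bar>k\<bar> \<ge> 2"
    unfolding avg_def sum_window by (simp add: walkQ_far[OF that])
qed

text \<open>Unimodality survives a step because 9 times each drop of \<open>avg v\<close> is a
  combination of drops of \<open>v\<close> with nonnegative weights. The middle rows force separate
  checks at the first two drops; for k \<ge> 2 the expression is v(k-2) + v(k-1) + v(k) - v(k+1) -
  v(k+2) - v(k+3).\<close>

lemma walk_dist_decreasing: "k \<ge> 0 \<Longrightarrow> walk_dist n (k + 1) \<le> walk_dist n k"
proof (induction n arbitrary: k)
  case (Suc n)
  define v where "v = walk_dist n"
  have dec: "v (l + 1) \<le> v l" if "l \<ge> 0" for l
    using Suc.IH that by (simp add: v_def)
  have even: "v (-1) = v 1" "v (-2) = v 2"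
    using walk_dist_even[of n 1] walk_dist_even[of n 2] by (simp_all add: v_def)
  consider "k = 0" | "k = 1" | "k \<ge> 2" using Suc.prems by linarith
  then show ?case
  proof cases
    case 1
    show ?thesis using dec[of 0] dec[of 1] dec[of 2]
      by (simp add: 1 walk_dist_Suc v_def[symmetric] avg_at_0 avg_at_1 even)
  next
    case 2
    show ?thesis using dec[of 0] dec[of 1] dec[of 2] dec[of 3]
      by (simp add: 2 walk_dist_Suc v_def[symmetric] avg_ge_2 avg_at_1)
  next
    case 3
    have "v (k + 1) \<le> v k" "v k \<le> v (k - 1)" "v (k - 1) \<le> v (k - 2)"
      "v (k + 2) \<le> v (k + 1)" "v (k + 3) \<le> v (k + 2)"
      using dec[of k] dec[of "k-1"] dec[of "k-2"] dec[of "k+1"] dec[of "k+2"] 3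
      by (simp_all add: algebra_simps)
    then show ?thesis using 3
      by (simp add: walk_dist_Suc v_def[symmetric] avg_ge_2 algebra_simps)
  qed
qed (auto simp: walk_dist_def)

lemma walk_dist_antimono:
  assumes "k \<le> l" "0 \<le> k"
  shows "walk_dist n l \<le> walk_dist n k"
  using assms
proof (induction l rule: int_ge_induct)
  case (step l)
  then show ?case using walk_dist_decreasing[of l n] by simp
qed simp

lemma walk_dist_le_0: "walk_dist n k \<le> walk_dist n 0"
  using walk_dist_antimono[of 0 "\<bar>k\<bar>" n] walk_dist_even[of n k] by (cases "k \<ge> 0") auto

text \<open>The n operators are moved one at a time from \<open>f\<close> to the indicator of 0 by
  self-adjointness, so the value at 0 is the expectation of \<open>f\<close> under the n-step
  law.\<close>

lemma avg_funpow_at_0: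
  assumes "M \<ge> 2 * int n"
  shows "(avg ^^ n) f 0 = (\<Sum>k\<in>{-M..M}. walk_dist n k *\<^sub>R f k)"
proof -
  have "(\<Sum>k\<in>{-M..M}. walk_dist n k *\<^sub>R f k) = (avg ^^ n) f 0" using assms
  proof (induction n arbitrary: f)
    case 0
    then have "{-M..M} \<inter> {k. k = 0} = {0}" by auto
    then show ?case by (simp add: walk_dist_def if_distrib[of "\<lambda>c. c *\<^sub>R _"] sum.If_cases)
  next
    case (Suc n)
    have "(\<Sum>k\<in>{-M..M}. walk_dist (Suc n) k *\<^sub>R f k) = (\<Sum>k\<in>{-M..M}. walk_dist n k *\<^sub>R avg f k)"
      unfolding walk_dist_Suc
      by (rule avg_scaleR_pairing[symmetric, of "2 * int n"])
         (use Suc.prems walk_dist_support in auto)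
    also have "\<dots> = (avg ^^ n) (avg f) 0" using Suc by simp
    finally show ?case by (simp add: funpow_swap1)
  qed
  then show ?thesis by simp
qed

lemma walk_dist_sum: "M \<ge> 2 * int n \<Longrightarrow> (\<Sum>k\<in>{-M..M}. walk_dist n k) = 1"
  using avg_funpow_at_0[of n M "\<lambda>_. 1::real"] by (simp add: avg_funpow_const)

text \<open>After n steps at most 4n + 1 states carry mass, and a maximum is at least the
  average.\<close>

lemma walk_dist_0_ge: "walk_dist n 0 \<ge> 1 / (4 * real n + 1)"
proof -
  have "1 = (\<Sum>k\<in>{-(2 * int n)..2 * int n}. walk_dist n k)" by (simp add: walk_dist_sum)
  also have "\<dots> \<le> (\<Sum>k\<in>{-(2 * int n)..2 * int n}. walk_dist n 0)"
    by (intro sum_mono walk_dist_le_0)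
  also have "\<dots> = (4 * real n + 1) * walk_dist n 0" by (simp add: nat_add_distrib)
  finally show ?thesis by (simp add: field_simps)
qed

text \<open>Divergence of the expected number of visits. At 0 it is comparison with the harmonic
  series; passing from m to m + 1 costs one time unit and a factor 1/9, and negative states follow
  by evenness.\<close>

lemma walk_dist_not_summable: "\<not> summable (\<lambda>n. walk_dist n k)"
proof -
  have base: "\<not> summable (\<lambda>n. walk_dist n 0)"
  proof
    assume "summable (\<lambda>n. walk_dist n 0)"
    then have "summable (\<lambda>n. 1 / (4 * real n + 1))"
      by (rule summable_comparison_test'[where N = 0]) (auto intro: walk_dist_0_ge)
    then have s: "summable (\<lambda>n. 4 * (1 / (4 * real n + 1)))" by (rule summable_mult)
    have "norm (1 / real (Suc n)) \<le> 4 * (1 / (4 * real n + 1))" for n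
      by (simp add: field_simps)
    then have "summable (\<lambda>n. 1 / real (Suc n))"
      by (intro summable_comparison_test'[where N = 0, OF s]) auto
    then have "summable (\<lambda>n. 1 / real n)"
      by (subst summable_Suc_iff[symmetric])
    then show False using not_summable_harmonic[where 'a = real]
      by (simp add: inverse_eq_divide)
  qed
  have step: "\<not> summable (\<lambda>n. walk_dist n (int m))" for m
  proof (induction m)
    case (Suc m)
    show ?case
    proof
      assume "summable (\<lambda>n. walk_dist n (int (Suc m)))"
      then have "summable (\<lambda>n. walk_dist (Suc n) (int (Suc m)))"
        by (subst summable_Suc_iff)
      then have s: "summable (\<lambda>n. 9 * walk_dist (Suc n) (int (Suc m)))" by (rule summable_mult)
      have "walk_dist n (int m) \<le> 9 * walk_dist (Suc n) (int (Suc m))" for n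
      proof -
        have "walkQ (int (Suc m)) (int m) * walk_dist n (int m)
            \<le> (\<Sum>l\<in>{int (Suc m)-2..int (Suc m)+2}. walkQ (int (Suc m)) l * walk_dist n l)"
          by (rule member_le_sum) (auto intro: mult_nonneg_nonneg walkQ_nonneg walk_dist_nonneg)
        moreover have "1/9 * walk_dist n (int m) \<le> walkQ (int (Suc m)) (int m) * walk_dist n (int m)"
          using walkQ_pred[of "int (Suc m)"]
          by (intro mult_right_mono walk_dist_nonneg) simp
        ultimately show ?thesis by (simp add: walk_dist_Suc avg_def)
      qed
      then have "summable (\<lambda>n. walk_dist n (int m))"
        by (intro summable_comparison_test'[where N = 0, OF s]) (auto simp: walk_dist_nonneg)
      with Suc show False by simp
    qed
  qed (use base in simp)
  show ?thesis
    using step[of "nat k"] step[of "nat (-k)"] walk_dist_even[of _ k] by (cases "k \<ge> 0") auto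
qed

lemma walk_dist_0_decseq: "decseq (\<lambda>n. walk_dist n 0)"
proof (rule decseq_SucI)
  fix n
  have "walk_dist (Suc n) 0 \<le> avg (\<lambda>_. walk_dist n 0) 0"
    unfolding walk_dist_Suc by (intro avg_mono walk_dist_le_0)
  then show "walk_dist (Suc n) 0 \<le> walk_dist n 0" by (simp add: avg_const)
qed

text \<open>The peak decreases to some p. If an average of values below the peak stays close to the
  peak, every value that carries a fixed weight in it must be close too; so p is also the limit at
  2, 4, 6, and so on. Since the total mass is 1, p must vanish.\<close>

lemma walk_dist_0_tendsto: "(\<lambda>n. walk_dist n 0) \<longlonglongrightarrow> 0"
proof -
  obtain p where p: "(\<lambda>n. walk_dist n 0) \<longlonglongrightarrow> p"
    using decseq_convergent[OF walk_dist_0_decseq, of 0] walk_dist_nonneg by blast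
  have lim: "(\<lambda>n. walk_dist n (int (2 * m))) \<longlonglongrightarrow> p" for m
  proof (induction m)
    case (Suc m)
    define k where "k = int (2 * m)"
    \<comment> \<open>In row \<open>k\<close> the entry at \<open>k + 2\<close> is 1/9; bounding the
      other values by the peak leaves 8/9 of it.\<close>
    have lower: "9 * walk_dist (Suc n) k - 8 * walk_dist n 0 \<le> walk_dist n (k + 2)" for n
    proof -
      have q: "walkQ k (k + 2) = 1/9"
      proof (cases "m = 0")
        case False
        then show ?thesis by (subst walkQ_far) (auto simp: k_def)
      qed (simp add: walkQ_def k_def)
      have "walk_dist (Suc n) k = (\<Sum>l\<in>{k-2..k+2}. walkQ k l * walk_dist n l)"
        by (simp add: walk_dist_Suc avg_def)
      also have "\<dots> \<le> (\<Sum>l\<in>{k-2..k+2}. walkQ k l * walk_dist n 0)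
          + walkQ k (k + 2) * (walk_dist n (k + 2) - walk_dist n 0)"
      proof -
        have "(\<Sum>l\<in>{k-2..k+2}-{k+2}. walkQ k l * walk_dist n l)
            \<le> (\<Sum>l\<in>{k-2..k+2}-{k+2}. walkQ k l * walk_dist n 0)"
          by (intro sum_mono mult_left_mono walk_dist_le_0 walkQ_nonneg)
        then show ?thesis
          by (simp add: sum.remove[of "{k-2..k+2}" "k+2"] algebra_simps)
      qed
      also have "\<dots> = walk_dist n 0 + 1/9 * (walk_dist n (k + 2) - walk_dist n 0)"
        by (simp add: sum_distrib_right[symmetric] walkQ_row_sum q)
      finally show ?thesis by (simp add: algebra_simps)
    qed
    have "(\<lambda>n. 9 * walk_dist (Suc n) k - 8 * walk_dist n 0) \<longlonglongrightarrow> 9 * p - 8 * p"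
      using LIMSEQ_Suc[OF Suc] by (intro tendsto_diff tendsto_mult_left p) (simp add: k_def)
    then have low: "(\<lambda>n. 9 * walk_dist (Suc n) k - 8 * walk_dist n 0) \<longlonglongrightarrow> p" by simp
    have "(\<lambda>n. walk_dist n (k + 2)) \<longlonglongrightarrow> p"
      by (rule tendsto_sandwich[OF _ _ low p]) (intro always_eventually allI lower walk_dist_le_0)+
    moreover have "int (2 * Suc m) = k + 2" by (simp add: k_def)
    ultimately show ?case by (simp only:)
  qed (use p in simp)
  have "real m * p \<le> 1" for m
  proof -
    have "(\<Sum>i<m. walk_dist n (int (2 * i))) \<le> 1" for n
    proof -
      have "(\<Sum>i<m. walk_dist n (int (2 * i))) = (\<Sum>k\<in>(\<lambda>i. int (2 * i)) ` {..<m}. walk_dist n k)"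
        by (subst sum.reindex) (auto simp: inj_on_def)
      also have "\<dots> \<le> (\<Sum>k\<in>{-(2 * int (n + m))..2 * int (n + m)}. walk_dist n k)"
        by (intro sum_mono2) (auto simp: walk_dist_nonneg)
      also have "\<dots> = 1" by (rule walk_dist_sum) simp
      finally show ?thesis .
    qed
    moreover have "(\<lambda>n. \<Sum>i<m. walk_dist n (int (2 * i))) \<longlonglongrightarrow> (\<Sum>i<m. p)"
      by (intro tendsto_sum lim)
    ultimately have "(\<Sum>i<m. p) \<le> 1" by (intro LIMSEQ_le_const2) auto
    then show ?thesis by simp
  qed
  moreover have "p \<ge> 0" using p walk_dist_nonneg by (intro LIMSEQ_le_const) auto
  ultimately have "p = 0"
    by (metis leD less_eq_real_def reals_Archimedean3)
  with p show ?thesis by simp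
qed

text \<open>A unimodal profile rises and falls once, so its total variation is at most twice its
  peak; a shift by d is d shifts by 1.\<close>

lemma walk_dist_variation:
  "(\<Sum>k\<in>{-M..M}. \<bar>walk_dist n k - walk_dist n (k + int d)\<bar>) \<le> 2 * real d * walk_dist n 0"
proof -
  have one: "(\<Sum>k\<in>{-m..m}. \<bar>walk_dist n k - walk_dist n (k + 1)\<bar>) \<le> 2 * walk_dist n 0"
    if "m \<ge> 0" for m :: int
  proof -
    have right: "(\<Sum>k\<in>{0..m}. \<bar>walk_dist n k - walk_dist n (k + 1)\<bar>) = walk_dist n 0 - walk_dist n (m + 1)"
      using that
    proof (induction m rule: int_ge_induct)
      case (step i)
      have "{0..i + 1} = insert (i + 1) {0..i}" using step.hyps by auto
      then show ?case using step walk_dist_decreasing[of "i + 1" n] by (simp add: add.commute)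
    qed (use walk_dist_decreasing[of 0 n] in simp)
    have left: "(\<Sum>k\<in>{-m..-1}. \<bar>walk_dist n k - walk_dist n (k + 1)\<bar>) = walk_dist n 0 - walk_dist n m"
      using that
    proof (induction m rule: int_ge_induct)
      case (step i)
      have "{-(i + 1)..-1} = insert (-(i + 1)) {-i..-1}" using step.hyps by auto
      moreover have "walk_dist n (- i - 1) = walk_dist n (i + 1)"
        using walk_dist_even[of n "i + 1"] by (simp only: minus_add_distrib diff_conv_add_uminus)
      ultimately show ?case
        using step walk_dist_decreasing[of i n] by (simp add: walk_dist_even)
    qed simp
    have "{-m..m} = {-m..-1} \<union> {0..m}" using that by auto
    then have "(\<Sum>k\<in>{-m..m}. \<bar>walk_dist n k - walk_dist n (k + 1)\<bar>)
        = (walk_dist n 0 - walk_dist n m) + (walk_dist n 0 - walk_dist n (m + 1))"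
      by (simp add: sum.union_disjoint left right)
    then show ?thesis using walk_dist_nonneg[of n m] walk_dist_nonneg[of n "m + 1"] by simp
  qed
  show ?thesis
  proof (induction d)
    case (Suc d)
    \<comment> \<open>The window is enlarged so that it contains its translate by
      \<open>d\<close>.\<close>
    define m where "m = \<bar>M\<bar> + int d"
    have "(\<Sum>k\<in>{-M..M}. \<bar>walk_dist n (k + int d) - walk_dist n (k + int d + 1)\<bar>)
        = (\<Sum>k\<in>(\<lambda>k. k + int d) ` {-M..M}. \<bar>walk_dist n k - walk_dist n (k + 1)\<bar>)"
      by (subst sum.reindex) auto
    also have "\<dots> \<le> (\<Sum>k\<in>{-m..m}. \<bar>walk_dist n k - walk_dist n (k + 1)\<bar>)"
      by (intro sum_mono2) (auto simp: m_def)
    also have "\<dots> \<le> 2 * walk_dist n 0" by (rule one) (simp add: m_def)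
    finally have *: "(\<Sum>k\<in>{-M..M}. \<bar>walk_dist n (k + int d) - walk_dist n (k + int d + 1)\<bar>)
        \<le> 2 * walk_dist n 0" .
    have "(\<Sum>k\<in>{-M..M}. \<bar>walk_dist n k - walk_dist n (k + int (Suc d))\<bar>)
        \<le> (\<Sum>k\<in>{-M..M}. \<bar>walk_dist n k - walk_dist n (k + int d)\<bar>
            + \<bar>walk_dist n (k + int d) - walk_dist n (k + int d + 1)\<bar>)"
      by (intro sum_mono) (simp add: algebra_simps)
    also have "\<dots> \<le> 2 * real d * walk_dist n 0 + 2 * walk_dist n 0"
      unfolding sum.distrib by (intro add_mono Suc *)
    finally show ?case by (simp add: algebra_simps)
  qed simp
qed

text \<open>The change in one step is a combination, with weights at most 1, of differences under
  shifts by d with \<bar>d\<bar> \<le> 2. The constant is 2 (2 + 1 + 0 + 1 + 2) = 12.\<close>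

lemma walk_dist_increment:
  "(\<Sum>k\<in>{-M..M}. \<bar>walk_dist n k - walk_dist (Suc n) k\<bar>) \<le> 12 * walk_dist n 0"
proof -
  define u where "u = walk_dist n"
  have var: "(\<Sum>k\<in>{-M..M}. \<bar>u k - u (k + d)\<bar>) \<le> 2 * real_of_int \<bar>d\<bar> * u 0" for d
  proof (cases "d \<ge> 0")
    case True
    then show ?thesis using walk_dist_variation[of n "nat d" M] by (simp add: u_def)
  next
    case False
    have "u (- k - d) = u (k + d)" for k
      using walk_dist_even[of n "k + d"] by (simp add: u_def)
    then have "(\<Sum>k\<in>{-M..M}. \<bar>u k - u (k + d)\<bar>) = (\<Sum>k\<in>{-M..M}. \<bar>u k - u (k - d)\<bar>)"
      by (intro sum.reindex_bij_witness[of _ uminus uminus]) (auto simp: u_def walk_dist_even)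
    then show ?thesis using False walk_dist_variation[of n "nat (-d)" M] by (simp add: u_def)
  qed
  have "\<bar>u k - walk_dist (Suc n) k\<bar> \<le> (\<Sum>d\<in>{-2..2}. \<bar>u k - u (k + d)\<bar>)" for k
  proof -
    have "u k - walk_dist (Suc n) k = (\<Sum>l\<in>{k-2..k+2}. walkQ k l * (u k - u l))"
      by (simp add: walk_dist_Suc avg_def u_def right_diff_distrib sum_subtractf
          sum_distrib_right[symmetric] walkQ_row_sum)
    also have "\<bar>\<dots>\<bar> \<le> (\<Sum>l\<in>{k-2..k+2}. \<bar>u k - u l\<bar>)"
    proof (rule order_trans[OF sum_abs], intro sum_mono)
      fix l
      have "\<bar>walkQ k l\<bar> \<le> 1" using walkQ_le[of k l] walkQ_nonneg[of k l] by simp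
      then show "\<bar>walkQ k l * (u k - u l)\<bar> \<le> \<bar>u k - u l\<bar>"
        by (simp add: abs_mult mult_left_le_one_le)
    qed
    also have "\<dots> = (\<Sum>d\<in>{-2..2}. \<bar>u k - u (k + d)\<bar>)"
      by (rule sum.reindex_bij_witness[of _ "\<lambda>d. k + d" "\<lambda>l. l - k"]) auto
    finally show ?thesis .
  qed
  then have "(\<Sum>k\<in>{-M..M}. \<bar>u k - walk_dist (Suc n) k\<bar>)
      \<le> (\<Sum>k\<in>{-M..M}. \<Sum>d\<in>{-2..2}. \<bar>u k - u (k + d)\<bar>)" by (intro sum_mono)
  also have "\<dots> = (\<Sum>d\<in>{-2..2}. \<Sum>k\<in>{-M..M}. \<bar>u k - u (k + d)\<bar>)" by (rule sum.swap)
  also have "\<dots> \<le> (\<Sum>d\<in>{-2..2::int}. 2 * real_of_int \<bar>d\<bar> * u 0)" by (intro sum_mono var)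
  also have "\<dots> = 12 * u 0"
    using sum_window[of "\<lambda>d. 2 * real_of_int \<bar>d\<bar> * u 0" 0] by simp
  finally show ?thesis by (simp add: u_def)
qed

text \<open>Dual form of the increment estimate, uniform over all test functions bounded by
  \<open>C\<close>; it is what allows the reference state 0 to take an extra step.\<close>

lemma norm_avg_increment_le:
  fixes f :: "int \<Rightarrow> 'a::real_normed_vector"
  assumes "\<And>k. norm (f k) \<le> C"
  shows "norm ((avg ^^ Suc n) f 0 - (avg ^^ n) f 0) \<le> 12 * C * walk_dist n 0"
proof -
  define M where "M = 2 * int (Suc n)"
  have "(avg ^^ Suc n) f 0 - (avg ^^ n) f 0
      = (\<Sum>k\<in>{-M..M}. (walk_dist (Suc n) k - walk_dist n k) *\<^sub>R f k)"
    by (subst avg_funpow_at_0[of n M], simp add: M_def, subst avg_funpow_at_0[of "Suc n" M])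
       (simp_all add: M_def scaleR_diff_left sum_subtractf)
  also have "norm \<dots> \<le> (\<Sum>k\<in>{-M..M}. \<bar>walk_dist n k - walk_dist (Suc n) k\<bar> * C)"
    using assms by (intro sum_norm_le) (auto simp: abs_minus_commute intro!: mult_left_mono)
  also have "\<dots> \<le> 12 * walk_dist n 0 * C"
    unfolding sum_distrib_right[symmetric] using order_trans[OF norm_ge_zero assms]
    by (intro mult_right_mono walk_dist_increment)
  finally show ?thesis by (simp add: mult_ac)
qed

text \<open>Bounded subharmonic functions are constant by recurrence: the expected number of visits to
  each state is infinite, while the expected total increase of the function along the walk is
  finite.\<close>

lemma bounded_subharmonic_zero:
  fixes D :: "int \<Rightarrow> real"
  assumes sub: "\<And>k. D k \<le> avg D k" and D: "\<And>k. 0 \<le> D k" "\<And>k. D k \<le> C" and "D 0 = 0"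
  shows "D k = 0"
proof -
  define g where "g k = avg D k - D k" for k
  have g_nonneg: "g k \<ge> 0" for k using sub by (simp add: g_def)
  have g_0: "g k = 0" for k
  proof (rule ccontr)
    assume "g k \<noteq> 0"
    with g_nonneg[of k] have pos: "g k > 0" by linarith
    \<comment> \<open>\<open>g\<close> is the expected gain of \<open>D\<close> in one step, so its
      expectation at time n is the increase of the expectation of \<open>D\<close>; a single term of
      that nonnegative sum is a lower bound.\<close>
    have incr: "g k * walk_dist n k \<le> (avg ^^ Suc n) D 0 - (avg ^^ n) D 0" for n
    proof -
      define M where "M = max (2 * int n) \<bar>k\<bar>"
      have "walk_dist n k * g k \<le> (\<Sum>k\<in>{-M..M}. walk_dist n k * g k)"
        by (rule member_le_sum) (auto simp: M_def g_nonneg walk_dist_nonneg)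
      also have "\<dots> = (avg ^^ n) g 0"
        using avg_funpow_at_0[of n M g] by (simp add: M_def)
      also have "\<dots> = (avg ^^ Suc n) D 0 - (avg ^^ n) D 0"
        unfolding g_def[abs_def] avg_funpow_diff by (simp add: funpow_swap1)
      finally show ?thesis by (simp add: mult.commute)
    qed
    have bound: "(\<Sum>n<N. g k * walk_dist n k) \<le> C" for N
    proof -
      have "(\<Sum>n<N. g k * walk_dist n k) \<le> (\<Sum>n<N. (avg ^^ Suc n) D 0 - (avg ^^ n) D 0)"
        by (intro sum_mono incr)
      also have "\<dots> = (avg ^^ N) D 0 - D 0"
        by (subst sum_lessThan_telescope) simp
      also have "\<dots> \<le> C"
        using norm_avg_funpow_le[of D C N 0] D \<open>D 0 = 0\<close> by auto
      finally show ?thesis .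
    qed
    have "summable (\<lambda>n. g k * walk_dist n k)"
    proof (rule bounded_imp_summable)
      show "0 \<le> g k * walk_dist n k" for n by (simp add: g_nonneg walk_dist_nonneg)
      show "(\<Sum>n\<le>N. g k * walk_dist n k) \<le> C" for N
        using bound[of "Suc N"] by (simp only: lessThan_Suc_atMost)
    qed
    then have "summable (\<lambda>n. walk_dist n k)" using pos by (simp add: summable_cmult_iff)
    then show False using walk_dist_not_summable by blast
  qed
  \<comment> \<open>Minimum principle: at a zero of the nonnegative harmonic \<open>D\<close> the
    average vanishes, so every state entering it with positive weight is a zero too.\<close>
  have neighbour: "D l = 0" if "D k = 0" "walkQ k l \<ge> 1/9" for k l
  proof -
    have "avg D k = 0" using g_0[of k] that by (simp add: g_def)
    moreover have "l \<in> {k-2..k+2}" using that(2) walkQ_eq_0[of l k] by force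
    then have "walkQ k l * D l \<le> avg D k"
      unfolding avg_def real_scaleR_def
      by (intro member_le_sum) (auto simp: D walkQ_nonneg)
    ultimately have "walkQ k l * D l \<le> 0" by simp
    then show ?thesis using D(1)[of l] that(2)
      by (auto simp: mult_le_0_iff)
  qed
  show ?thesis
  proof (induction k rule: int_induct[where k = 0])
    case base
    show ?case by (fact \<open>D 0 = 0\<close>)
  next
    case (step1 i)
    then show ?case using neighbour[OF _ walkQ_succ] by blast
  next
    case (step2 i)
    then show ?case using neighbour[OF _ walkQ_pred] by blast
  qed
qed

section \<open>Loss of memory of the initial state\<close>

text \<open>The l^1 distance between the n-step laws from \<open>i\<close> and from 0, written
  dually as a supremum over test functions. One bound then serves all observables at once, which
  exactness needs.\<close>

definition walk_gap :: "nat \<Rightarrow> int \<Rightarrow> real" where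
  "walk_gap n i = (SUP f\<in>{f :: int \<Rightarrow> complex. \<forall>k. norm (f k) \<le> 1}.
     norm ((avg ^^ n) f i - (avg ^^ n) f 0))"

lemma walk_gap_le_2: "norm ((avg ^^ n) f i - (avg ^^ n) f 0) \<le> 2"
  if "\<forall>k. norm (f k) \<le> 1" for f :: "int \<Rightarrow> complex"
proof -
  have "norm ((avg ^^ n) f i - (avg ^^ n) f 0) \<le> norm ((avg ^^ n) f i) + norm ((avg ^^ n) f 0)"
    by (rule norm_triangle_ineq4)
  also have "\<dots> \<le> 1 + 1" using that by (intro add_mono norm_avg_funpow_le) auto
  finally show ?thesis by simp
qed

lemma walk_gap_upper:
  fixes f :: "int \<Rightarrow> complex"
  assumes "\<And>k. norm (f k) \<le> 1"
  shows "norm ((avg ^^ n) f i - (avg ^^ n) f 0) \<le> walk_gap n i"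
  unfolding walk_gap_def
proof (rule cSUP_upper)
  show "bdd_above ((\<lambda>f. norm ((avg ^^ n) f i - (avg ^^ n) f 0)) ` {f :: int \<Rightarrow> complex. \<forall>k. norm (f k) \<le> 1})"
    using walk_gap_le_2 by (intro bdd_aboveI2[where M = 2]) blast
qed (use assms in simp)

lemma walk_gap_least:
  assumes "\<And>f :: int \<Rightarrow> complex. (\<And>k. norm (f k) \<le> 1) \<Longrightarrow> norm ((avg ^^ n) f i - (avg ^^ n) f 0) \<le> B"
  shows "walk_gap n i \<le> B"
  unfolding walk_gap_def
proof (rule cSUP_least)
  have *: "(\<lambda>_. 0) \<in> {f :: int \<Rightarrow> complex. \<forall>k. norm (f k) \<le> 1}" by simp
  show "{f :: int \<Rightarrow> complex. \<forall>k. norm (f k) \<le> 1} \<noteq> {}"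
  proof
    assume "{f :: int \<Rightarrow> complex. \<forall>k. norm (f k) \<le> 1} = {}"
    with * show False by (simp only: empty_iff)
  qed
qed (use assms in blast)

lemma walk_gap_nonneg: "walk_gap n i \<ge> 0"
  using walk_gap_upper[of "\<lambda>_. 0" n i] by (simp add: avg_funpow_const)

text \<open>The gap decreases in n since \<open>avg\<close> contracts the sup norm. After one step
  the laws from \<open>i\<close> and from 0 have both moved; replacing the moved reference by 0
  costs 12 \<open>walk_dist n 0\<close>, which disappears in the limit. So the limit is a bounded
  subharmonic function vanishing at 0.\<close>

lemma walk_gap_tendsto: "(\<lambda>n. walk_gap n i) \<longlonglongrightarrow> 0"
proof -
  have dec: "decseq (\<lambda>n. walk_gap n i)" for i
  proof (rule decseq_SucI, rule walk_gap_least)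
    fix n and f :: "int \<Rightarrow> complex" assume "\<And>k. norm (f k) \<le> 1"
    then show "norm ((avg ^^ Suc n) f i - (avg ^^ Suc n) f 0) \<le> walk_gap n i"
      by (simp only: funpow_Suc_right o_apply) (intro walk_gap_upper norm_avg_le)
  qed
  define D where "D i = lim (\<lambda>n. walk_gap n i)" for i
  have lim: "(\<lambda>n. walk_gap n i) \<longlonglongrightarrow> D i" for i
  proof -
    obtain L where "(\<lambda>n. walk_gap n i) \<longlonglongrightarrow> L"
      by (rule decseq_convergent[OF dec[of i] allI[OF walk_gap_nonneg]])
    then show ?thesis by (simp add: D_def limI)
  qed
  have sub: "D i \<le> avg D i" for i
  proof (rule LIMSEQ_le)
    show "(\<lambda>n. walk_gap (Suc n) i) \<longlonglongrightarrow> D i" by (rule LIMSEQ_Suc[OF lim])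
    have "(\<lambda>n. avg (walk_gap n) i) \<longlonglongrightarrow> avg D i"
      unfolding avg_def by (intro tendsto_sum tendsto_scaleR tendsto_const lim)
    then have "(\<lambda>n. avg (walk_gap n) i + 12 * walk_dist n 0) \<longlonglongrightarrow> avg D i + 12 * 0"
      by (intro tendsto_add tendsto_mult_left walk_dist_0_tendsto)
    then show "(\<lambda>n. avg (walk_gap n) i + 12 * walk_dist n 0) \<longlonglongrightarrow> avg D i" by simp
    have "walk_gap (Suc n) i \<le> avg (walk_gap n) i + 12 * walk_dist n 0" for n
    proof (rule walk_gap_least)
      fix f :: "int \<Rightarrow> complex" assume f: "\<And>k. norm (f k) \<le> 1"
      define h where "h = (avg ^^ n) f"
      have "avg h i - avg h 0 = (\<Sum>l\<in>{i-2..i+2}. walkQ i l *\<^sub>R (h l - h 0)) + (h 0 - avg h 0)"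
        by (simp add: avg_def[of h i] scaleR_diff_right sum_subtractf scaleR_sum_left[symmetric]
            walkQ_row_sum)
      also have "norm \<dots> \<le> (\<Sum>l\<in>{i-2..i+2}. walkQ i l * walk_gap n l) + 12 * 1 * walk_dist n 0"
      proof (rule norm_triangle_mono)
        show "norm (\<Sum>l\<in>{i-2..i+2}. walkQ i l *\<^sub>R (h l - h 0))
            \<le> (\<Sum>l\<in>{i-2..i+2}. walkQ i l * walk_gap n l)"
          unfolding h_def
          by (intro sum_norm_le) (auto simp: walkQ_nonneg intro!: mult_left_mono walk_gap_upper f)
        show "norm (h 0 - avg h 0) \<le> 12 * 1 * walk_dist n 0"
          using norm_avg_increment_le[OF f, of n] by (simp add: h_def norm_minus_commute)
      qed
      finally show "norm ((avg ^^ Suc n) f i - (avg ^^ Suc n) f 0)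
          \<le> avg (walk_gap n) i + 12 * walk_dist n 0"
        by (simp add: h_def avg_def)
    qed
    then show "\<exists>N. \<forall>n\<ge>N. walk_gap (Suc n) i \<le> avg (walk_gap n) i + 12 * walk_dist n 0"
      by (intro exI[of _ 0] allI impI)
  qed
  have "D i = 0"
  proof (rule bounded_subharmonic_zero[OF sub])
    show "0 \<le> D k" for k
      by (rule LIMSEQ_le_const[OF lim[of k]]) (simp add: walk_gap_nonneg)
    have "walk_gap n k \<le> 2" for n k
      by (rule walk_gap_least) (simp add: walk_gap_le_2)
    then show "D k \<le> 2" for k
      by (intro LIMSEQ_le_const2[OF lim[of k]]) simp
    have "walk_gap n 0 = 0" for n
      using walk_gap_nonneg[of n 0] walk_gap_least[of n 0 0] by simp
    then show "D 0 = 0" by (simp add: D_def)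
  qed
  with lim[of i] show ?thesis by simp
qed

lemma avg_funpow_gap:
  fixes f :: "int \<Rightarrow> complex"
  assumes "\<And>k. norm (f k) \<le> C"
  shows "norm ((avg ^^ n) f i - (avg ^^ n) f 0) \<le> C * walk_gap n i"
proof (cases "C = 0")
  case True
  then have "f = (\<lambda>_. 0)" using assms by (auto simp: fun_eq_iff)
  then show ?thesis using True by (simp add: avg_funpow_const)
next
  case False
  then have C: "C > 0" using order_trans[OF norm_ge_zero assms] by (simp add: less_le)
  have scale: "(avg ^^ n) (\<lambda>k. r *\<^sub>R f k) = (\<lambda>k. r *\<^sub>R (avg ^^ n) f k)" for r
    by (induction n) (auto simp: avg_def scaleR_sum_right mult.commute)
  have "norm ((avg ^^ n) (\<lambda>k. (1/C) *\<^sub>R f k) i - (avg ^^ n) (\<lambda>k. (1/C) *\<^sub>R f k) 0) \<le> walk_gap n i"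
    using assms C by (intro walk_gap_upper) (simp add: field_simps)
  then have "\<bar>1 / C\<bar> * norm ((avg ^^ n) f i - (avg ^^ n) f 0) \<le> walk_gap n i"
    by (simp only: scale scaleR_diff_right[symmetric] norm_scaleR)
  then show ?thesis using C by (simp add: field_simps)
qed

section \<open>Convergence of symmetric averages along the walk\<close>

text \<open>Passing from M to M + 1 adds two end points, which carry equal weight by evenness; sums
  over nested symmetric blocks play the part of Abel's partial sums.\<close>

lemma sum_by_parts_symmetric:
  fixes f :: "int \<Rightarrow> 'a::real_vector"
  assumes even: "\<And>k. u (- k) = u k"
  shows "(\<Sum>k\<in>{-int M..int M}. u k *\<^sub>R f k)
    = (\<Sum>a<M. (u (int a) - u (int a + 1)) *\<^sub>R (\<Sum>k\<in>{-int a..int a}. f k))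
      + u (int M) *\<^sub>R (\<Sum>k\<in>{-int M..int M}. f k)"
proof (induction M)
  case (Suc M)
  have "{-int (Suc M)..int (Suc M)} = insert (-int (Suc M)) (insert (int (Suc M)) {-int M..int M})"
    by auto
  then have split: "(\<Sum>k\<in>{-int (Suc M)..int (Suc M)}. h k)
      = h (-int (Suc M)) + (h (int (Suc M)) + (\<Sum>k\<in>{-int M..int M}. h k))" for h :: "int \<Rightarrow> 'a"
    by simp
  show ?case unfolding split Suc.IH
    using even[of "int (Suc M)"] by (simp add: algebra_simps)
qed simp

text \<open>Summation by parts writes the even, unimodal distribution of the walk as a mixture of
  uniform distributions on symmetric intervals.\<close>

lemma avg_funpow_tendsto:
  fixes f :: "int \<Rightarrow> complex"
  assumes bound: "\<And>k. norm (f k) \<le> C"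
    and lim: "(\<lambda>a. (\<Sum>k\<in>{-int a..int a}. f k) /\<^sub>R (2 * real a + 1)) \<longlonglongrightarrow> l"
  shows "(\<lambda>n. (avg ^^ n) f 0) \<longlonglongrightarrow> l"
proof -
  \<comment> \<open>The block {-a..a} has 2a + 1 points, so the drop of the profile after a
    corresponds to this weight on its uniform law.\<close>
  define w where "w n a = (walk_dist n (int a) - walk_dist n (int a + 1)) * (2 * real a + 1)" for n a
  define s where "s a = (\<Sum>k\<in>{-int a..int a}. f k) /\<^sub>R (2 * real a + 1)" for a
  have w_nonneg: "w n a \<ge> 0" for n a
    using walk_dist_decreasing[of "int a" n] by (simp add: w_def)
  have mixture: "(avg ^^ n) h 0 = (\<Sum>a<2 * n + 1. w n a *\<^sub>R ((\<Sum>k\<in>{-int a..int a}. h k) /\<^sub>R (2 * real a + 1)))"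
    for n and h :: "int \<Rightarrow> complex"
  proof -
    \<comment> \<open>The radius 2n + 1 is one beyond the reach of the walk, which kills the
      boundary term of the summation by parts.\<close>
    have "(avg ^^ n) h 0 = (\<Sum>k\<in>{-int (2 * n + 1)..int (2 * n + 1)}. walk_dist n k *\<^sub>R h k)"
      by (rule avg_funpow_at_0) simp
    also have "\<dots> = (\<Sum>a<2 * n + 1. (walk_dist n (int a) - walk_dist n (int a + 1)) *\<^sub>R (\<Sum>k\<in>{-int a..int a}. h k))"
      using walk_dist_support[of n "int (2 * n + 1)"]
      by (subst sum_by_parts_symmetric) (auto simp: walk_dist_even)
    also have "(\<lambda>a. (walk_dist n (int a) - walk_dist n (int a + 1)) *\<^sub>R (\<Sum>k\<in>{-int a..int a}. h k))
        = (\<lambda>a. w n a *\<^sub>R ((\<Sum>k\<in>{-int a..int a}. h k) /\<^sub>R (2 * real a + 1)))"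
    proof
      fix a
      show "(walk_dist n (int a) - walk_dist n (int a + 1)) *\<^sub>R (\<Sum>k\<in>{-int a..int a}. h k)
        = w n a *\<^sub>R ((\<Sum>k\<in>{-int a..int a}. h k) /\<^sub>R (2 * real a + 1))"
        by (simp add: w_def add_eq_0_iff)
    qed
    finally show ?thesis .
  qed
  \<comment> \<open>Testing the mixture on the constant 1 gives the total weight.\<close>
  have w_sum: "(\<Sum>a<2 * n + 1. w n a) = 1" for n
  proof -
    have "(\<Sum>k\<in>{-int a..int a}. 1::complex) /\<^sub>R (2 * real a + 1) = 1" for a
    proof -
      have "(\<Sum>k\<in>{-int a..int a}. 1::complex) = complex_of_real (2 * real a + 1)"
        by (simp add: nat_add_distrib)
      moreover have "inverse (2 * real a + 1) * (2 * real a + 1) = 1"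
        by (rule left_inverse) linarith
      ultimately show ?thesis
        by (simp only: scaleR_conv_of_real of_real_mult[symmetric] of_real_1)
    qed
    then have "(\<Sum>a<2 * n + 1. complex_of_real (w n a)) = 1"
      using mixture[of n "\<lambda>_. 1"] by (simp add: avg_funpow_const scaleR_conv_of_real)
    then show ?thesis unfolding of_real_sum[symmetric] by (simp only: of_real_eq_1_iff)
  qed
  have s_bound: "norm (s a - l) \<le> C + norm l" for a
  proof -
    have "norm (\<Sum>k\<in>{-int a..int a}. f k) \<le> (\<Sum>k\<in>{-int a..int a}. C)"
      by (intro sum_norm_le bound)
    then have "norm (s a) \<le> C" by (simp add: s_def field_simps)
    then show ?thesis using norm_triangle_ineq4[of "s a" l] by linarith
  qed
  show ?thesis
  proof (rule LIMSEQ_I)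
    fix e :: real assume "e > 0"
    obtain a0 where a0: "\<And>a. a \<ge> a0 \<Longrightarrow> norm (s a - l) < e / 2"
      using LIMSEQ_D[OF lim, of "e/2"] \<open>e > 0\<close> by (auto simp: s_def)
    \<comment> \<open>\<open>w n a\<close> is at most (2a + 1) \<open>walk_dist n 0\<close>, so the
      blocks with a < a0, whose averages are only known to be bounded, have total weight tending to
      0.\<close>
    define K where "K = (\<Sum>a<a0. (2 * real a + 1) * (C + norm l))"
    have "(\<lambda>n. K * walk_dist n 0) \<longlonglongrightarrow> K * 0"
      by (intro tendsto_mult_left walk_dist_0_tendsto)
    then obtain n0 where n0: "\<And>n. n \<ge> n0 \<Longrightarrow> K * walk_dist n 0 < e / 2"
      using order_tendstoD(2)[of _ "K * 0" sequentially "e/2"] \<open>e > 0\<close>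
      by (auto simp: eventually_sequentially)
    have "norm ((avg ^^ n) f 0 - l) < e" if "n \<ge> n0" for n
    proof -
      have "(avg ^^ n) f 0 - l = (\<Sum>a<2 * n + 1. w n a *\<^sub>R (s a - l))"
        using w_sum[of n] mixture[of n f]
        by (simp add: s_def scaleR_diff_right sum_subtractf scaleR_sum_left[symmetric])
      also have "norm \<dots> \<le> (\<Sum>a<2 * n + 1. w n a * norm (s a - l))"
        by (intro sum_norm_le) (simp add: w_nonneg)
      also have "\<dots> \<le> (\<Sum>a<2 * n + 1. w n a * (e / 2) + (if a < a0 then w n a * (C + norm l) else 0))"
      proof (rule sum_mono)
        fix a
        show "w n a * norm (s a - l) \<le> w n a * (e / 2) + (if a < a0 then w n a * (C + norm l) else 0)"
          using mult_left_mono[OF s_bound[of a] w_nonneg[of n a]] a0[of a] \<open>e > 0\<close> w_nonneg[of n a]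
            mult_left_mono[of "norm (s a - l)" "e/2" "w n a"]
          by (cases "a < a0") (auto intro: add_increasing)
      qed
      also have "\<dots> = e / 2 + (\<Sum>a\<in>{..<2 * n + 1} \<inter> {a. a < a0}. w n a * (C + norm l))"
      proof -
        have "(\<Sum>a\<in>{..<2 * n + 1} \<inter> {a. a < a0}. w n a * (C + norm l))
            = (\<Sum>a<2 * n + 1. if a < a0 then w n a * (C + norm l) else 0)"
          by (subst sum.inter_restrict) (simp_all only: finite_lessThan mem_Collect_eq)
        then show ?thesis
          unfolding sum.distrib by (simp only: sum_distrib_right[symmetric] w_sum)
      qed
      also have "\<dots> \<le> e / 2 + (\<Sum>a<a0. w n a * (C + norm l))"
        using order_trans[OF norm_ge_zero s_bound]
        by (intro add_left_mono sum_mono2) (auto intro: mult_nonneg_nonneg w_nonneg)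
      also have "\<dots> \<le> e / 2 + K * walk_dist n 0"
        unfolding K_def sum_distrib_right
      proof (intro add_left_mono sum_mono)
        fix a
        have "w n a \<le> walk_dist n 0 * (2 * real a + 1)"
          unfolding w_def using walk_dist_le_0[of n "int a"] walk_dist_nonneg[of n "int a + 1"]
          by (intro mult_right_mono) auto
        then have "w n a * (C + norm l) \<le> walk_dist n 0 * (2 * real a + 1) * (C + norm l)"
          using order_trans[OF norm_ge_zero s_bound] by (intro mult_right_mono)
        then show "w n a * (C + norm l) \<le> (2 * real a + 1) * (C + norm l) * walk_dist n 0"
          by (simp add: mult_ac)
      qed
      also have "\<dots> < e" using n0[OF that] by simp
      finally show ?thesis .
    qed
    then show "\<exists>n0. \<forall>n\<ge>n0. norm ((avg ^^ n) f 0 - l) < e" by blast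
  qed
qed

section \<open>Transfer of cell integrals\<close>

definition cell_integral :: "(real \<Rightarrow> 'a) \<Rightarrow> int \<Rightarrow> 'a::{banach, second_countable_topology}" where
  "cell_integral F k = (LINT x:{of_int k..of_int k + 1}|lborel. F x)"

lemma set_integral_Icc_split:
  fixes h :: "real \<Rightarrow> 'a::{banach, second_countable_topology}"
  assumes "a \<le> b" "b \<le> c" "set_integrable lborel {a..c} h"
  shows "(LINT x:{a..c}|lborel. h x) = (LINT x:{a..b}|lborel. h x) + (LINT x:{b..c}|lborel. h x)"
proof -
  have ab: "set_integrable lborel {a..b} h" and bc: "set_integrable lborel {b..c} h"
    using assms by (auto intro: set_integrable_subset)
  have "{a..c} = {a..b} \<union> {b..c}" using assms by auto
  moreover have "AE x in lborel. \<not> (x \<in> {a..b} \<and> x \<in> {b..c})"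
    using AE_lborel_singleton[of b] by eventually_elim auto
  ultimately show ?thesis
    using set_integral_Un_AE[OF _ _ _ ab bc] by simp
qed

lemma set_integral_Icc_partition:
  fixes h :: "real \<Rightarrow> 'a::{banach, second_countable_topology}" and a :: "nat \<Rightarrow> real"
  assumes "mono a" "set_integrable lborel {a 0..a n} h"
  shows "(LINT x:{a 0..a n}|lborel. h x) = (\<Sum>i<n. LINT x:{a i..a (Suc i)}|lborel. h x)"
  using assms(2)
proof (induction n)
  case 0
  have "(LINT x:{a 0..a 0}|lborel. h x) = 0"
    using interval_integral_Icc[of "a 0" "a 0" h] by simp
  then show ?case by simp
next
  case (Suc n)
  have le: "a 0 \<le> a n" "a n \<le> a (Suc n)" using assms(1) by (auto intro: monoD)
  then have "(LINT x:{a 0..a (Suc n)}|lborel. h x)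
      = (LINT x:{a 0..a n}|lborel. h x) + (LINT x:{a n..a (Suc n)}|lborel. h x)"
    using Suc.prems by (rule set_integral_Icc_split)
  moreover have "set_integrable lborel {a 0..a n} h"
    using le by (intro set_integrable_subset[OF Suc.prems]) auto
  ultimately show ?case using Suc.IH by simp
qed

lemma set_integral_cells:
  fixes h :: "real \<Rightarrow> 'a::{banach, second_countable_topology}"
  assumes "set_integrable lborel {of_int a..of_int b} h" "a \<le> b"
  shows "(LINT x:{of_int a..of_int b}|lborel. h x) = (\<Sum>k\<in>{a..<b}. cell_integral h k)"
proof -
  have "(LINT x:{of_int a..of_int b}|lborel. h x)
      = (\<Sum>i<nat (b - a). LINT x:{of_int a + real i..of_int a + real (Suc i)}|lborel. h x)"
    using set_integral_Icc_partition[of "\<lambda>i. of_int a + real i" "nat (b - a)" h] assms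
    by (simp add: mono_def)
  also have "\<dots> = (\<Sum>k\<in>{a..<b}. cell_integral h k)"
    by (rule sum.reindex_bij_witness[of _ "\<lambda>k. nat (k - a)" "\<lambda>i. a + int i"])
       (auto simp: cell_integral_def add_ac)
  finally show ?thesis .
qed

lemma indicator_affine_cell:
  fixes q :: real
  assumes "q > 0"
  shows "indicator {a..a + q} (a + q * (y - of_int k)) = (indicator {of_int k..of_int k + 1} y :: real)"
proof -
  have "a \<le> a + q * (y - of_int k) \<longleftrightarrow> of_int k \<le> y"
    using assms by (simp add: zero_le_mult_iff)
  moreover have "a + q * (y - of_int k) \<le> a + q \<longleftrightarrow> y \<le> of_int k + 1"
    using assms mult_le_cancel_left_pos[of q "y - of_int k" 1] by auto
  ultimately show ?thesis by (auto simp: indicator_def)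
qed

lemma set_integral_affine:
  fixes h :: "real \<Rightarrow> 'a::{banach, second_countable_topology}"
  assumes "q > 0"
  shows "(LINT x:{a..a + q}|lborel. h x)
    = q *\<^sub>R (LINT y:{of_int k..of_int k + 1}|lborel. h (a + q * (y - of_int k)))"
proof -
  have "a - q * of_int k + q * y = a + q * (y - of_int k)" for y by (simp add: algebra_simps)
  then have "(LINT x|lborel. indicator {a..a + q} x *\<^sub>R h x) = \<bar>q\<bar> *\<^sub>R
      (LINT y|lborel. indicator {a..a + q} (a + q * (y - of_int k)) *\<^sub>R h (a + q * (y - of_int k)))"
    using lborel_integral_real_affine[of q "\<lambda>x. indicator {a..a + q} x *\<^sub>R h x" "a - q * of_int k"] assms
    by (simp only:)
  then show ?thesis
    using assms by (simp only: set_lebesgue_integral_def indicator_affine_cell abs_of_pos)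
qed

lemma set_integrable_mult_bounded:
  fixes F g :: "real \<Rightarrow> complex"
  assumes F: "F \<in> borel_measurable borel" "\<And>x. norm (F x) \<le> C" and g: "set_integrable lborel A g"
  shows "set_integrable lborel A (\<lambda>x. F x * g x)"
proof (rule set_integrable_bound)
  show "set_integrable lborel A (\<lambda>x. C * g x)" using g by simp
  have "(\<lambda>x. F x * (indicator A x *\<^sub>R g x)) \<in> borel_measurable lborel"
    using F(1) borel_measurable_integrable[OF g[unfolded set_integrable_def]]
    by (intro borel_measurable_times) (auto simp: measurable_lborel1)
  then show "set_borel_measurable lborel A (\<lambda>x. F x * g x)"
    by (simp add: set_borel_measurable_def mult_scaleR_right)
  have "0 \<le> C" using order_trans[OF norm_ge_zero F(2)] .
  then show "AE x in lborel. x \<in> A \<longrightarrow> norm (F x * g x) \<le> norm (C * g x)"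
    by (auto simp: norm_mult intro!: AE_I2 mult_right_mono F(2))
qed

lemma set_integrable_bounded:
  fixes F :: "real \<Rightarrow> complex"
  assumes "F \<in> borel_measurable borel" "\<And>x. norm (F x) \<le> C"
  shows "set_integrable lborel {a..b} F"
  using set_integrable_mult_bounded[OF assms borel_integrable_atLeastAtMost'[of a b "\<lambda>_. 1"]]
  by simp

section \<open>Inverse branches and the transfer of densities\<close>

definition branch_start :: "int \<Rightarrow> int \<Rightarrow> real" where
  "branch_start j k = of_int j + (\<Sum>i\<in>{j-2..k-1}. walkQ j i)"

text \<open>For a zero entry this is a constant map rather than an inverse; such a branch always
  enters with weight 0.\<close>

definition inv_branch :: "int \<Rightarrow> int \<Rightarrow> real \<Rightarrow> real" where
  "inv_branch j k y = branch_start j k + walkQ j k * (y - of_int k)"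

lemma branch_start_first: "branch_start j (j - 2) = of_int j"
  by (simp add: branch_start_def)

lemma branch_start_last: "branch_start j (j + 3) = of_int j + 1"
proof -
  have "j + 3 - 1 = j + 2" by simp
  then show ?thesis by (simp only: branch_start_def walkQ_row_sum)
qed

lemma branch_start_Suc: "k \<ge> j - 2 \<Longrightarrow> branch_start j (k + 1) = branch_start j k + walkQ j k"
proof -
  assume "k \<ge> j - 2"
  then have "{j-2..k} = insert k {j-2..k-1}" by auto
  then show ?thesis by (simp add: branch_start_def)
qed

lemma branch_interval_start: "k \<ge> j - 2 \<Longrightarrow> branch_interval walkQ j k = {branch_start j k..branch_start j k + walkQ j k}"
  using branch_start_Suc[of j k] by (simp add: branch_interval_def branch_start_def)

lemma branch_start_mono: "k \<le> l \<Longrightarrow> branch_start j k \<le> branch_start j l"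
  unfolding branch_start_def by (intro add_left_mono sum_mono2) (auto simp: walkQ_nonneg)

lemma inv_branch_measurable [measurable]: "inv_branch j k \<in> borel_measurable borel"
  unfolding inv_branch_def[abs_def] by measurable

text \<open>The five pieces of row j tile the cell, degenerate ones included, and the affine change
  of variables on each has Jacobian \<open>walkQ j k\<close>. The map itself does not occur, so this
  applies equally to a density and to its absolute value.\<close>

lemma cell_integral_branches:
  fixes h :: "real \<Rightarrow> 'a::{banach, second_countable_topology}"
  assumes "set_integrable lborel {of_int j..of_int j + 1} h"
  shows "cell_integral h j
    = (\<Sum>k\<in>{j-2..j+2}. walkQ j k *\<^sub>R cell_integral (\<lambda>y. h (inv_branch j k y)) k)"
proof -
  define a where "a i = branch_start j (j - 2 + int i)" for i
  have "cell_integral h j = (\<Sum>i<5. LINT x:{a i..a (Suc i)}|lborel. h x)"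
  proof -
    have "a 0 = of_int j" by (simp add: a_def branch_start_first)
    moreover have "a 5 = of_int j + 1"
      using branch_start_last[of j] by (simp add: a_def add.commute)
    moreover have "mono a" by (auto simp: a_def mono_def intro!: branch_start_mono)
    ultimately show ?thesis
      using set_integral_Icc_partition[of a 5 h] assms by (simp only: cell_integral_def)
  qed
  also have "\<dots> = (\<Sum>i<5. walkQ j (j - 2 + int i) *\<^sub>R
      cell_integral (\<lambda>y. h (inv_branch j (j - 2 + int i) y)) (j - 2 + int i))"
  proof (rule sum.cong[OF refl])
    fix i
    define k where "k = j - 2 + int i"
    have "a (Suc i) = branch_start j k + walkQ j k" "a i = branch_start j k"
      using branch_start_Suc[of j k] by (simp_all add: a_def k_def add_ac)
    moreover have "(LINT x:{branch_start j k..branch_start j k + walkQ j k}|lborel. h x)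
        = walkQ j k *\<^sub>R cell_integral (\<lambda>y. h (inv_branch j k y)) k"
    proof (cases "walkQ j k = 0")
      case True
      then show ?thesis using interval_integral_Icc[of "branch_start j k" "branch_start j k" h] by simp
    next
      case False
      then have "walkQ j k > 0" using walkQ_nonneg[of j k] by simp
      then show ?thesis unfolding cell_integral_def inv_branch_def by (rule set_integral_affine)
    qed
    ultimately show "(LINT x:{a i..a (Suc i)}|lborel. h x) = walkQ j (j - 2 + int i) *\<^sub>R
      cell_integral (\<lambda>y. h (inv_branch j (j - 2 + int i) y)) (j - 2 + int i)"
      by (simp add: k_def)
  qed
  also have "\<dots> = (\<Sum>k\<in>{j-2..j+2}. walkQ j k *\<^sub>R cell_integral (\<lambda>y. h (inv_branch j k y)) k)"
    by (rule sum.reindex_bij_witness[of _ "\<lambda>k. nat (k - (j - 2))" "\<lambda>i. j - 2 + int i"]) auto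
  finally show ?thesis .
qed

locale walk_map =
  fixes T :: "real \<Rightarrow> real"
  assumes assoc: "associated_map walkQ T"
begin

lemma T_inv_branch:
  assumes "j - 2 \<le> k" "k \<le> j + 2" "walkQ j k > 0" "of_int k < y" "y < of_int k + 1"
  shows "T (inv_branch j k y) = y"
proof -
  have "walkQ j k * (y - of_int k) < walkQ j k * 1"
    using assms by (intro mult_strict_left_mono) auto
  then have "inv_branch j k y \<in> interior (branch_interval walkQ j k)"
    using assms by (simp add: branch_interval_start inv_branch_def)
  then have "T (inv_branch j k y) = 1 / walkQ j k * (inv_branch j k y - branch_start j k) + of_int k"
    using assoc assms unfolding associated_map_def branch_start_def by (simp add: diff_diff_eq)
  also have "\<dots> = y" using assms by (simp add: inv_branch_def)
  finally show ?thesis .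
qed

lemma T_affine:
  assumes "j - 2 \<le> k" "k \<le> j + 2" "walkQ j k > 0" "branch_start j k < x" "x < branch_start j (k + 1)"
  shows "T x = 1 / walkQ j k * (x - branch_start j k) + of_int k"
proof -
  have "x \<in> interior (branch_interval walkQ j k)"
    using assms by (simp add: branch_interval_start branch_start_Suc)
  then show ?thesis
    using assoc assms unfolding associated_map_def branch_start_def by (simp add: diff_diff_eq)
qed

text \<open>Only the endpoints of the branch intervals are uncontrolled; they are countably many,
  and on a singleton every function is measurable.\<close>

lemma T_measurable [measurable]: "T \<in> borel_measurable borel"
proof -
  define C where "C = {{branch_start j k<..<branch_start j (k + 1)} | j k. j - 2 \<le> k \<and> k \<le> j + 2}
    \<union> range (\<lambda>(j, k). {branch_start j k})"
  have "C \<subseteq> range (\<lambda>(j, k). {branch_start j k<..<branch_start j (k + 1)})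
      \<union> range (\<lambda>(j, k). {branch_start j k})"
    unfolding C_def by auto
  then have "countable C"
    by (rule countable_subset) (intro countable_Un countable_image, auto)
  then show ?thesis
  proof (rule measurable_piecewise_restrict)
    show "\<Omega> \<inter> space borel \<in> sets borel" if "\<Omega> \<in> C" for \<Omega>
      using that unfolding C_def by auto
    show "space borel \<subseteq> \<Union>C"
    proof
      fix x :: real
      define j where "j = \<lfloor>x\<rfloor>"
      have bounds: "branch_start j (j - 2) \<le> x" "x < branch_start j (j + 3)"
        by (auto simp: branch_start_first branch_start_last j_def)
      \<comment> \<open>Otherwise each endpoint that is at most \<open>x\<close> forces the next one
        to be so too, up to the right end of the cell.\<close>
      have "\<exists>k. j - 2 \<le> k \<and> k \<le> j + 2 \<and> branch_start j k \<le> x \<and> x < branch_start j (k + 1)"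
      proof (rule ccontr)
        assume "\<not> ?thesis"
        then have step: "branch_start j (k + 1) \<le> x" if "j - 2 \<le> k" "k \<le> j + 2" "branch_start j k \<le> x" for k
          using that by force
        have "k \<le> j + 3 \<longrightarrow> branch_start j k \<le> x" if "j - 2 \<le> k" for k
          using that
        proof (induction k rule: int_ge_induct)
          case (step k)
          then show ?case using \<open>\<And>k. j - 2 \<le> k \<Longrightarrow> k \<le> j + 2 \<Longrightarrow> branch_start j k \<le> x \<Longrightarrow> branch_start j (k + 1) \<le> x\<close>[of k]
            by simp
        qed (use bounds in simp)
        from this[of "j + 3"] bounds show False by simp
      qed
      then obtain k where k: "j - 2 \<le> k" "k \<le> j + 2" "branch_start j k \<le> x" "x < branch_start j (k + 1)" by blast
      show "x \<in> \<Union>C"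
      proof (cases "x = branch_start j k")
        case True
        then show ?thesis unfolding C_def by blast
      next
        case False
        then have "x \<in> {branch_start j k<..<branch_start j (k + 1)}" using k by simp
        then show ?thesis using k(1,2) unfolding C_def by blast
      qed
    qed
    show "T \<in> measurable (restrict_space borel \<Omega>) borel" if "\<Omega> \<in> C" for \<Omega>
    proof -
      from that consider j k where "\<Omega> = {branch_start j k<..<branch_start j (k + 1)}" "j - 2 \<le> k" "k \<le> j + 2"
        | c where "\<Omega> \<subseteq> {c}"
        unfolding C_def by auto
      then show ?thesis
      proof cases
        case 1
        show ?thesis
        proof (cases "walkQ j k > 0")
          case True
          have "(\<lambda>x. 1 / walkQ j k * (x - branch_start j k) + of_int k) \<in> measurable (restrict_space borel \<Omega>) borel"
            by (intro measurable_restrict_space1) measurable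
          then show ?thesis
            by (rule measurable_cong[THEN iffD1, rotated])
               (use 1 True in \<open>auto simp: space_restrict_space T_affine\<close>)
        next
          case False
          then have "\<Omega> = {}" using 1 branch_start_Suc[of j k] by auto
          then show ?thesis by (simp add: measurable_def space_restrict_space)
        qed
      next
        case 2
        have "(\<lambda>_. T c) \<in> measurable (restrict_space borel \<Omega>) borel" by simp
        then show ?thesis
          by (rule measurable_cong[THEN iffD1, rotated]) (use 2 in \<open>auto simp: space_restrict_space\<close>)
      qed
    qed
  qed
qed

lemma T_funpow_measurable [measurable]: "T ^^ n \<in> borel_measurable borel"
proof (induction n)
  case 0
  have "(\<lambda>x::real. x) \<in> borel_measurable borel" by measurable
  then show ?case by (simp add: id_def)
next
  case (Suc n)
  have "(\<lambda>x. T ((T ^^ n) x)) \<in> borel_measurable borel"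
    by (rule measurable_compose[OF Suc]) measurable
  then show ?case by (simp add: o_def)
qed

text \<open>One step of transfer duality on a cell: T undoes each inverse branch except at the two
  ends of the image cell, which are null. The weight \<open>g\<close> is merely pulled back, so the
  identity can be iterated.\<close>

lemma cell_integral_T_mult:
  fixes H g :: "real \<Rightarrow> complex"
  assumes [measurable]: "H \<in> borel_measurable borel" and H: "\<And>x. norm (H x) \<le> C"
    and g: "set_integrable lborel {of_int j..of_int j + 1} g" "g \<in> borel_measurable borel"
  shows "cell_integral (\<lambda>x. H (T x) * g x) j
    = (\<Sum>k\<in>{j-2..j+2}. walkQ j k *\<^sub>R cell_integral (\<lambda>y. H y * g (inv_branch j k y)) k)"
proof -
  note g(2)[measurable]
  have "(\<lambda>x. H (T x)) \<in> borel_measurable borel" by measurable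
  then have "set_integrable lborel {of_int j..of_int j + 1} (\<lambda>x. H (T x) * g x)"
    by (rule set_integrable_mult_bounded) (auto intro: H g)
  then have "cell_integral (\<lambda>x. H (T x) * g x) j = (\<Sum>k\<in>{j-2..j+2}.
      walkQ j k *\<^sub>R cell_integral (\<lambda>y. H (T (inv_branch j k y)) * g (inv_branch j k y)) k)"
    by (rule cell_integral_branches)
  also have "\<dots> = (\<Sum>k\<in>{j-2..j+2}. walkQ j k *\<^sub>R cell_integral (\<lambda>y. H y * g (inv_branch j k y)) k)"
  proof (rule sum.cong[OF refl])
    fix k assume k: "k \<in> {j-2..j+2}"
    show "walkQ j k *\<^sub>R cell_integral (\<lambda>y. H (T (inv_branch j k y)) * g (inv_branch j k y)) k
        = walkQ j k *\<^sub>R cell_integral (\<lambda>y. H y * g (inv_branch j k y)) k"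
    proof (cases "walkQ j k > 0")
      case True
      have "AE y in lborel. y \<in> {of_int k..of_int k + 1} \<longrightarrow>
          H (T (inv_branch j k y)) * g (inv_branch j k y) = H y * g (inv_branch j k y)"
        using AE_lborel_singleton[of "of_int k :: real"] AE_lborel_singleton[of "of_int k + 1 :: real"]
        by eventually_elim (use k True in \<open>auto simp: T_inv_branch\<close>)
      then show ?thesis
        unfolding cell_integral_def
        by (intro arg_cong[where f = "scaleR _"] set_lebesgue_integral_cong_AE) auto
    next
      case False
      then have "walkQ j k = 0" using walkQ_nonneg[of j k] by simp
      then show ?thesis by simp
    qed
  qed
  finally show ?thesis .
qed

text \<open>With the constant density 1 the pulled-back weight is again 1, so the transfer closes up
  on cell integrals without any error.\<close>

lemma cell_integral_T_funpow:
  fixes F :: "real \<Rightarrow> complex"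
  assumes [measurable]: "F \<in> borel_measurable borel" and F: "\<And>x. norm (F x) \<le> C"
  shows "cell_integral (\<lambda>x. F ((T ^^ n) x)) j = (avg ^^ n) (cell_integral F) j"
proof (induction n arbitrary: j)
  case (Suc n)
  have "(\<lambda>x. F ((T ^^ n) x)) \<in> borel_measurable borel" by measurable
  then have "cell_integral (\<lambda>x. F ((T ^^ n) (T x)) * 1) j
      = (\<Sum>k\<in>{j-2..j+2}. walkQ j k *\<^sub>R cell_integral (\<lambda>y. F ((T ^^ n) y) * 1) k)"
    by (rule cell_integral_T_mult) (auto intro: F borel_integrable_atLeastAtMost')
  then show ?case by (simp add: Suc avg_def funpow_swap1)
qed simp

end

section \<open>Smoothing of Lipschitz densities\<close>

lemma norm_cell_integral_le:
  fixes F :: "real \<Rightarrow> complex"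
  assumes "\<And>x. x \<in> {of_int k..of_int k + 1} \<Longrightarrow> norm (F x) \<le> C"
  shows "norm (cell_integral F k) \<le> C"
proof (cases "set_integrable lborel {of_int k..of_int k + 1} F")
  case True
  have "norm (cell_integral F k) \<le> (LINT x:{of_int k..of_int k + 1}|lborel. norm (F x))"
    unfolding cell_integral_def by (rule set_integral_norm_bound[OF True])
  also have "\<dots> \<le> (LINT x:{of_int k..of_int k + (1::real)}|lborel. C)"
    using assms by (intro set_integral_mono set_integrable_norm True borel_integrable_atLeastAtMost') auto
  also have "\<dots> = C" by (simp add: set_integral_const)
  finally show ?thesis .
next
  \<comment> \<open>By convention the integral of a nonintegrable function is 0, and the bound at
    any point of the cell shows 0 \<le> C.\<close>
  case False
  then have "cell_integral F k = 0"
    by (simp add: cell_integral_def set_lebesgue_integral_def set_integrable_def not_integrable_integral_eq)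
  then show ?thesis using order_trans[OF norm_ge_zero assms[of "of_int k"]] by simp
qed

lemma set_integrable_lipschitz:
  fixes g :: "real \<Rightarrow> complex"
  assumes "L-lipschitz_on UNIV g"
  shows "set_integrable lborel {a..b} g" "g \<in> borel_measurable borel"
proof -
  have "continuous_on UNIV g" by (rule lipschitz_on_continuous_on[OF assms])
  then show "set_integrable lborel {a..b} g" "g \<in> borel_measurable borel"
    by (auto intro: borel_integrable_atLeastAtMost' continuous_on_subset borel_measurable_continuous_onI)
qed

text \<open>Both terms split over the branches with the same weights, so errors on the branches
  average to an error on the cell.\<close>

lemma cell_integral_branches_avg:
  fixes g :: "real \<Rightarrow> complex"
  assumes "set_integrable lborel {of_int j..of_int j + 1} g"
  shows "norm ((\<Sum>k\<in>{j-2..j+2}. walkQ j k *\<^sub>R X k) - z * cell_integral g j)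
    \<le> (\<Sum>k\<in>{j-2..j+2}. walkQ j k * norm (X k - z * cell_integral (\<lambda>y. g (inv_branch j k y)) k))"
proof -
  have "(\<Sum>k\<in>{j-2..j+2}. walkQ j k *\<^sub>R X k) - z * cell_integral g j
      = (\<Sum>k\<in>{j-2..j+2}. walkQ j k *\<^sub>R (X k - z * cell_integral (\<lambda>y. g (inv_branch j k y)) k))"
    by (simp add: cell_integral_branches[OF assms] scaleR_diff_right sum_subtractf sum_distrib_left)
  also have "norm \<dots> \<le> (\<Sum>k\<in>{j-2..j+2}. walkQ j k *
      norm (X k - z * cell_integral (\<lambda>y. g (inv_branch j k y)) k))"
    by (rule sum_norm_le) (simp add: walkQ_nonneg)
  finally show ?thesis .
qed

lemma lipschitz_inv_branch:
  fixes g :: "real \<Rightarrow> complex"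
  assumes "L-lipschitz_on UNIV g"
  shows "(5/9 * L)-lipschitz_on UNIV (\<lambda>y. g (inv_branch j k y))"
proof (rule lipschitz_onI)
  have L: "L \<ge> 0" by (rule lipschitz_on_nonneg[OF assms])
  then show "0 \<le> 5/9 * L" by simp
  fix x y
  have "dist (g (inv_branch j k x)) (g (inv_branch j k y)) \<le> L * dist (inv_branch j k x) (inv_branch j k y)"
    by (rule lipschitz_onD[OF assms]) auto
  also have "dist (inv_branch j k x) (inv_branch j k y) = walkQ j k * dist x y"
  proof -
    have "inv_branch j k x - inv_branch j k y = walkQ j k * (x - y)"
      by (simp add: inv_branch_def algebra_simps)
    then show ?thesis by (simp add: dist_real_def abs_mult walkQ_nonneg)
  qed
  also have "L * (walkQ j k * dist x y) \<le> L * (5/9 * dist x y)"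
    using L by (intro mult_left_mono mult_right_mono walkQ_le) auto
  finally show "dist (g (inv_branch j k x)) (g (inv_branch j k y)) \<le> 5/9 * L * dist x y" by simp
qed

context walk_map
begin

text \<open>Each application of the transfer operator contracts Lipschitz constants by the largest entry
  of the matrix, so after \<open>a\<close> steps the density is constant on the cells up to \<open>(5/9)^a * L\<close>.\<close>

lemma cell_mixing:
  fixes H g :: "real \<Rightarrow> complex"
  assumes H_meas: "H \<in> borel_measurable borel" and H: "\<And>x. norm (H x) \<le> C"
  shows "L-lipschitz_on UNIV g \<Longrightarrow>
    (\<And>k. \<bar>k - j\<bar> \<le> 2 * int a \<Longrightarrow> norm (cell_integral H k - z) \<le> \<eta>) \<Longrightarrow>
    norm (cell_integral (\<lambda>x. H ((T ^^ a) x) * g x) j - z * cell_integral g j)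
      \<le> \<eta> * cell_integral (\<lambda>x. norm (g x)) j + (5/9) ^ a * L * C"
proof (induction a arbitrary: L g j)
  case 0
  define m where "m = cell_integral g j"
  have g: "set_integrable lborel {of_int j..of_int j + 1} g" "g \<in> borel_measurable borel"
    by (rule set_integrable_lipschitz[OF 0(1)])+
  have C: "C \<ge> 0" using order_trans[OF norm_ge_zero H] .
  \<comment> \<open>A cell has length 1, so a Lipschitz function stays within \<open>L\<close> of
    its mean there.\<close>
  have dev: "norm (g x - m) \<le> L" if x: "x \<in> {of_int j..of_int j + 1}" for x
  proof -
    have "g x - m = cell_integral (\<lambda>y. g x - g y) j"
      unfolding m_def cell_integral_def
      by (subst set_integral_diff) (auto intro: g borel_integrable_atLeastAtMost' simp: set_integral_const)
    also have "norm \<dots> \<le> L"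
    proof (rule norm_cell_integral_le)
      fix y :: real assume y: "y \<in> {of_int j..of_int j + 1}"
      have "dist (g x) (g y) \<le> L * dist x y" by (rule lipschitz_onD[OF 0(1)]) auto
      also have "\<dots> \<le> L * 1"
        using x y lipschitz_on_nonneg[OF 0(1)] by (intro mult_left_mono) (auto simp: dist_real_def)
      finally show "norm (g x - g y) \<le> L" by (simp add: dist_norm)
    qed
    finally show ?thesis .
  qed
  have H_int: "set_integrable lborel {of_int j..of_int j + 1} H"
    by (rule set_integrable_bounded[OF H_meas H])
  have Hg: "set_integrable lborel {of_int j..of_int j + 1} (\<lambda>x. H x * g x)"
    by (rule set_integrable_mult_bounded[OF H_meas H g(1)])
  have "cell_integral (\<lambda>x. H x * (g x - m)) j = cell_integral (\<lambda>x. H x * g x - H x * m) j"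
    by (simp add: right_diff_distrib)
  also have "\<dots> = cell_integral (\<lambda>x. H x * g x) j - cell_integral H j * m"
    unfolding cell_integral_def using H_int Hg by (subst set_integral_diff) auto
  finally have "cell_integral (\<lambda>x. H x * g x) j - z * m
      = (cell_integral H j - z) * m + cell_integral (\<lambda>x. H x * (g x - m)) j"
    by (simp add: algebra_simps)
  also have "norm \<dots> \<le> \<eta> * cell_integral (\<lambda>x. norm (g x)) j + C * L"
  proof (rule norm_triangle_mono)
    have "norm m \<le> cell_integral (\<lambda>x. norm (g x)) j"
      unfolding m_def cell_integral_def by (rule set_integral_norm_bound[OF g(1)])
    moreover have "norm (cell_integral H j - z) \<le> \<eta>" using 0(2)[of j] by simp
    ultimately show "norm ((cell_integral H j - z) * m) \<le> \<eta> * cell_integral (\<lambda>x. norm (g x)) j"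
      unfolding norm_mult by (intro mult_mono) (auto intro: order_trans[OF norm_ge_zero])
    show "norm (cell_integral (\<lambda>x. H x * (g x - m)) j) \<le> C * L"
      by (rule norm_cell_integral_le) (auto simp: norm_mult intro!: mult_mono H dev C)
  qed
  finally show ?case by (simp add: m_def mult.commute)
next
  case (Suc a)
  have g: "set_integrable lborel {of_int j..of_int j + 1} g" "g \<in> borel_measurable borel"
    by (rule set_integrable_lipschitz[OF Suc.prems(1)])+
  define G where "G k y = g (inv_branch j k y)" for k y
  have "(\<lambda>x. H ((T ^^ a) x)) \<in> borel_measurable borel"
    by (rule measurable_compose[OF T_funpow_measurable H_meas])
  then have "cell_integral (\<lambda>x. H ((T ^^ a) (T x)) * g x) j
      = (\<Sum>k\<in>{j-2..j+2}. walkQ j k *\<^sub>R cell_integral (\<lambda>y. H ((T ^^ a) y) * G k y) k)"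
    unfolding G_def by (rule cell_integral_T_mult) (auto intro: H g)
  then have "norm (cell_integral (\<lambda>x. H ((T ^^ Suc a) x) * g x) j - z * cell_integral g j)
      \<le> (\<Sum>k\<in>{j-2..j+2}. walkQ j k *
          norm (cell_integral (\<lambda>y. H ((T ^^ a) y) * G k y) k - z * cell_integral (G k) k))"
    using cell_integral_branches_avg[OF g(1), of "\<lambda>k. cell_integral (\<lambda>y. H ((T ^^ a) y) * G k y) k" z]
    by (simp add: funpow_swap1 G_def[abs_def])
  also have "\<dots> \<le> (\<Sum>k\<in>{j-2..j+2}. walkQ j k *
      (\<eta> * cell_integral (\<lambda>y. norm (G k y)) k + (5/9) ^ a * (5/9 * L) * C))"
  proof (intro sum_mono mult_left_mono walkQ_nonneg)
    \<comment> \<open>A branch moves the cell by at most 2, so the window of radius 2a about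
      \<open>k\<close> lies in the one of radius 2(a + 1) about \<open>j\<close>; the pulled-back
      density has Lipschitz constant 5/9 \<open>L\<close>.\<close>
    fix k assume k: "k \<in> {j-2..j+2}"
    show "norm (cell_integral (\<lambda>y. H ((T ^^ a) y) * G k y) k - z * cell_integral (G k) k)
        \<le> \<eta> * cell_integral (\<lambda>y. norm (G k y)) k + (5/9) ^ a * (5/9 * L) * C"
      unfolding G_def[abs_def]
      using k by (intro Suc.IH lipschitz_inv_branch Suc.prems) auto
  qed
  also have "\<dots> = \<eta> * (\<Sum>k\<in>{j-2..j+2}. walkQ j k * cell_integral (\<lambda>y. norm (G k y)) k)
      + (\<Sum>k\<in>{j-2..j+2}. walkQ j k) * ((5/9) ^ a * (5/9 * L) * C)"
    by (simp add: sum.distrib distrib_left sum_distrib_left sum_distrib_right mult_ac)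
  also have "(\<Sum>k\<in>{j-2..j+2}. walkQ j k * cell_integral (\<lambda>y. norm (G k y)) k)
      = cell_integral (\<lambda>x. norm (g x)) j"
    using cell_integral_branches[OF set_integrable_norm[OF g(1)]] by (simp add: G_def)
  finally show ?case by (simp add: walkQ_row_sum)
qed

end

section \<open>Density of compactly supported Lipschitz functions in L^1\<close>

lemma integrable_compact_support:
  fixes h :: "real \<Rightarrow> complex"
  assumes "L-lipschitz_on UNIV h" "\<And>x. \<bar>x\<bar> > real M \<Longrightarrow> h x = 0"
  shows "integrable lborel h"
proof -
  have "integrable lborel (\<lambda>x. indicator {- real M..real M} x *\<^sub>R h x)"
    using set_integrable_lipschitz(1)[OF assms(1)] by (simp add: set_integrable_def)
  moreover have "indicator {- real M..real M} x *\<^sub>R h x = h x" for x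
    using assms(2)[of x] by (cases "x \<in> {- real M..real M}") auto
  ultimately show ?thesis by simp
qed

lemma lipschitz_on_min:
  fixes f g :: "real \<Rightarrow> real"
  assumes "L-lipschitz_on X f" "L-lipschitz_on X g"
  shows "L-lipschitz_on X (\<lambda>x. min (f x) (g x))"
proof (rule lipschitz_onI)
  show "0 \<le> L" by (rule lipschitz_on_nonneg[OF assms(1)])
  fix x y assume "x \<in> X" "y \<in> X"
  then show "dist (min (f x) (g x)) (min (f y) (g y)) \<le> L * dist x y"
    using lipschitz_onD[OF assms(1), of x y] lipschitz_onD[OF assms(2), of x y]
    by (auto simp: dist_real_def min_def abs_if split: if_splits)
qed

text \<open>Membership in the L^1 closure of the compactly supported Lipschitz functions, phrased as
  a predicate for induction over integrable functions. The integer radius lets the support be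
  covered by whole cells.\<close>

definition lipschitz_dense :: "(real \<Rightarrow> complex) \<Rightarrow> bool" where
  "lipschitz_dense g \<longleftrightarrow> (\<forall>e>0. \<exists>L M h. L-lipschitz_on UNIV h \<and> (\<forall>x. \<bar>x\<bar> > real M \<longrightarrow> h x = 0) \<and>
     (LINT x|lborel. norm (g x - h x)) < e)"

lemma lipschitz_dense_limit:
  assumes "\<And>e. e > 0 \<Longrightarrow> \<exists>g'. integrable lborel g' \<and> lipschitz_dense g' \<and> (LINT x|lborel. norm (g x - g' x)) < e"
    and g: "integrable lborel g"
  shows "lipschitz_dense g"
  unfolding lipschitz_dense_def
proof (intro allI impI)
  fix e :: real assume "e > 0"
  then obtain g' where g': "integrable lborel g'" "lipschitz_dense g'" "(LINT x|lborel. norm (g x - g' x)) < e/2"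
    using assms(1)[of "e/2"] by auto
  obtain L M h where h: "L-lipschitz_on UNIV h" "\<And>x. \<bar>x\<bar> > real M \<Longrightarrow> h x = 0"
    "(LINT x|lborel. norm (g' x - h x)) < e/2"
    using g'(2) \<open>e > 0\<close> unfolding lipschitz_dense_def by (meson half_gt_zero)
  note h_int = integrable_compact_support[OF h(1,2)]
  have "(LINT x|lborel. norm (g x - h x)) \<le> (LINT x|lborel. norm (g x - g' x) + norm (g' x - h x))"
    using g g' h_int by (intro integral_mono) (auto intro: order_trans[OF _ norm_triangle_ineq])
  also have "\<dots> < e" using g g' h_int h(3) by simp
  finally show "\<exists>L M h. L-lipschitz_on UNIV h \<and> (\<forall>x. \<bar>x\<bar> > real M \<longrightarrow> h x = 0) \<and>
     (LINT x|lborel. norm (g x - h x)) < e"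
    using h by blast
qed

lemma lipschitz_dense_open:
  fixes U :: "real set"
  assumes "open U" and fin: "emeasure lborel U < \<infinity>"
  shows "lipschitz_dense (\<lambda>x. indicator U x *\<^sub>R c)"
  unfolding lipschitz_dense_def
proof (intro allI impI)
  fix e :: real assume "e > 0"
  \<comment> \<open>The truncated distance to the complement rises to 1 on \<open>U\<close>; the
    second function cuts off outside radius n + 1. Taking minima rather than products keeps the
    Lipschitz constant at n + 1.\<close>
  define f where "f n x = min (min 1 (real n * infdist x (- U))) (min 1 (max 0 (real n + 1 - \<bar>x\<bar>)))" for n x
  \<comment> \<open>\<open>infdist\<close> to the empty set is 0 by convention, which would make all
    approximants vanish; finite measure excludes this.\<close>
  have "U \<noteq> UNIV" using fin by auto
  have f01: "0 \<le> f n x" "f n x \<le> 1" for n x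
    by (auto simp: f_def infdist_nonneg)
  have outside: "f n x = 0" if "x \<notin> U" for n x
    using that by (simp add: f_def)
  have lip: "(real n + 1)-lipschitz_on UNIV (f n)" for n
    unfolding f_def
  proof (intro lipschitz_on_min)
    show "(real n + 1)-lipschitz_on UNIV (\<lambda>x. 1::real)"
      by (rule lipschitz_onI) auto
    show "(real n + 1)-lipschitz_on UNIV (\<lambda>x::real. real n * infdist x (- U))"
    proof (rule lipschitz_onI)
      fix x y :: real
      have "\<bar>infdist x (- U) - infdist y (- U)\<bar> \<le> dist x y" by (rule infdist_triangle_abs)
      then have "real n * \<bar>infdist x (- U) - infdist y (- U)\<bar> \<le> real n * dist x y"
        by (intro mult_left_mono) auto
      also have "\<dots> \<le> (real n + 1) * dist x y" by (intro mult_right_mono) auto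
      finally show "dist (real n * infdist x (- U)) (real n * infdist y (- U)) \<le> (real n + 1) * dist x y"
        by (simp add: dist_real_def right_diff_distrib[symmetric] abs_mult)
    qed simp
    show "(real n + 1)-lipschitz_on UNIV (\<lambda>x. max 0 (real n + 1 - \<bar>x\<bar>))"
      by (rule lipschitz_on_mono[of 1], rule lipschitz_onI) (auto simp: dist_real_def)
  qed (rule lipschitz_onI, auto)
  have f_meas: "f n \<in> borel_measurable borel" for n
    using lipschitz_on_continuous_on[OF lip] by (rule borel_measurable_continuous_onI)
  have U_int: "integrable lborel (indicator U :: real \<Rightarrow> real)"
    using assms by (simp add: integrable_indicator_iff)
  have "(\<lambda>n. LINT x|lborel. norm (indicator U x - f n x)) \<longlonglongrightarrow> (LINT (x::real)|lborel. (0::real))"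
  proof (rule integral_dominated_convergence[where w = "indicator U"])
    show "AE x in lborel. (\<lambda>n. norm (indicator U x - f n x)) \<longlonglongrightarrow> 0"
    proof (rule AE_I2)
      fix x :: real
      show "(\<lambda>n. norm (indicator U x - f n x)) \<longlonglongrightarrow> 0"
      proof (cases "x \<in> U")
        case True
        have "closed (- U)" "- U \<noteq> {}" using assms \<open>U \<noteq> UNIV\<close> by auto
        then have pos: "infdist x (- U) > 0"
          using True in_closed_iff_infdist_zero[of "- U" x] infdist_nonneg[of x "- U"] by force
        obtain n0 where "1 / infdist x (- U) + \<bar>x\<bar> \<le> real n0" using real_arch_simple by blast
        then have n0: "1 / infdist x (- U) \<le> real n0" "\<bar>x\<bar> \<le> real n0"
          using pos zero_less_divide_1_iff[of "infdist x (- U)"] by linarith+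
        have "f n x = 1" if "n \<ge> n0" for n
        proof -
          have "1 / infdist x (- U) \<le> real n" "\<bar>x\<bar> \<le> real n" using n0 that by linarith+
          then have "1 \<le> real n * infdist x (- U)" using pos by (simp add: field_simps)
          with \<open>\<bar>x\<bar> \<le> real n\<close> show ?thesis by (simp add: f_def)
        qed
        then have "\<forall>\<^sub>F n in sequentially. norm (indicator U x - f n x) = 0"
          using True by (auto simp: eventually_sequentially)
        then show ?thesis by (rule tendsto_eventually)
      qed (simp add: outside)
    qed
    show "AE x in lborel. norm (norm (indicator U x - f n x)) \<le> indicator U x" for n
      using f01[of n] outside[of _ n] by (intro AE_I2) (auto simp: indicator_def)
    show "(\<lambda>x. norm (indicator U x - f n x)) \<in> borel_measurable lborel" for n
    proof -
      have [measurable]: "U \<in> sets borel" "f n \<in> borel_measurable borel"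
        using f_meas assms by auto
      show ?thesis by measurable
    qed
  qed (use U_int in auto)
  then have "(\<lambda>n. norm c * (LINT x|lborel. norm (indicator U x - f n x))) \<longlonglongrightarrow> norm c * 0"
    by (intro tendsto_mult_left) simp
  then obtain n where n: "norm c * (LINT x|lborel. norm (indicator U x - f n x)) < e"
    using order_tendstoD(2)[of _ "norm c * 0" sequentially e] \<open>e > 0\<close>
    by (auto simp: eventually_sequentially)
  have "((real n + 1) * norm c)-lipschitz_on UNIV (\<lambda>x. f n x *\<^sub>R c)"
  proof (rule lipschitz_onI)
    fix x y
    have "dist (f n x) (f n y) \<le> (real n + 1) * dist x y" by (rule lipschitz_onD[OF lip]) auto
    then have "dist (f n x) (f n y) * norm c \<le> (real n + 1) * dist x y * norm c"
      by (rule mult_right_mono) simp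
    then show "dist (f n x *\<^sub>R c) (f n y *\<^sub>R c) \<le> (real n + 1) * norm c * dist x y"
      by (simp add: dist_norm scaleR_diff_left[symmetric] mult_ac del: scaleR_conv_of_real)
  qed simp
  moreover have "f n x = 0" if "\<bar>x\<bar> > real (n + 1)" for x
    using f01(1)[of n x] that by (auto simp: f_def min_le_iff_disj intro!: antisym)
  then have "\<forall>x. \<bar>x\<bar> > real (n + 1) \<longrightarrow> f n x *\<^sub>R c = 0" by simp
  moreover have "(LINT x|lborel. norm (indicator U x *\<^sub>R c - f n x *\<^sub>R c)) < e"
    using n by (simp add: scaleR_diff_left[symmetric] mult.commute)
  ultimately show "\<exists>L M h. L-lipschitz_on UNIV h \<and> (\<forall>x. \<bar>x\<bar> > real M \<longrightarrow> h x = 0) \<and>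
      (LINT x|lborel. norm (indicator U x *\<^sub>R c - h x)) < e"
    by blast
qed

text \<open>Outer regularity replaces \<open>A\<close> by an open set of slightly larger, still
  finite, measure.\<close>

lemma lipschitz_dense_indicator:
  fixes A :: "real set"
  assumes A: "A \<in> sets borel" "emeasure lborel A < \<infinity>"
  shows "lipschitz_dense (\<lambda>x. indicator A x *\<^sub>R c)"
proof (rule lipschitz_dense_limit)
  show int_A: "integrable lborel (\<lambda>x. indicator A x *\<^sub>R c)"
    using A by (intro integrable_scaleR_left) (simp add: integrable_indicator_iff)
  fix e :: real assume "e > 0"
  \<comment> \<open>Adding 1 covers \<open>c\<close> = 0 without a case distinction.\<close>
  define d where "d = e / (norm c + 1)"
  have d: "d > 0" using \<open>e > 0\<close> by (simp add: d_def add_nonneg_pos)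
  obtain U where U: "open U" "A \<subseteq> U" "emeasure lebesgue (U - A) < ennreal d"
    using sets_lebesgue_outer_open[of A d] A d by (auto simp: sets_completionI_sets)
  have diff: "emeasure lborel (U - A) < ennreal d"
    using U A by simp
  have "emeasure lborel U = emeasure lborel A + emeasure lborel (U - A)"
    using U A by (subst plus_emeasure) (auto simp: Un_absorb1)
  then have U_fin: "emeasure lborel U < \<infinity>"
    using A(2) diff by (auto simp: less_top[symmetric])
  have int_U: "integrable lborel (\<lambda>x. indicator U x *\<^sub>R c)"
    using U U_fin by (intro integrable_scaleR_left) (simp add: integrable_indicator_iff)
  have "norm (indicator A x *\<^sub>R c - indicator U x *\<^sub>R c) = norm c * indicator (U - A) x" for x
    using U(2) by (auto simp: indicator_def)
  then have "(LINT x|lborel. norm (indicator A x *\<^sub>R c - indicator U x *\<^sub>R c))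
      = (LINT x|lborel. norm c * indicator (U - A) x)"
    by (simp only:)
  also have "\<dots> = norm c * measure lborel (U - A)" by simp
  also have "measure lborel (U - A) \<le> d"
    unfolding measure_def using diff d by (intro enn2real_leI) auto
  then have "norm c * measure lborel (U - A) \<le> norm c * d"
    by (rule mult_left_mono) simp
  also have "\<dots> < e" using \<open>e > 0\<close> by (simp add: d_def field_simps add_pos_nonneg)
  finally show "\<exists>g'. integrable lborel g' \<and> lipschitz_dense g' \<and>
      (LINT x|lborel. norm (indicator A x *\<^sub>R c - g' x)) < e"
    using int_U lipschitz_dense_open[OF U(1) U_fin, of c] by blast
qed

lemma lipschitz_dense_add:
  assumes "lipschitz_dense f" "lipschitz_dense g" "integrable lborel f" "integrable lborel g"
  shows "lipschitz_dense (\<lambda>x. f x + g x)"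
  unfolding lipschitz_dense_def
proof (intro allI impI)
  fix e :: real assume "e > 0"
  obtain L M h where h: "L-lipschitz_on UNIV h" "\<And>x. \<bar>x\<bar> > real M \<Longrightarrow> h x = 0"
    "(LINT x|lborel. norm (f x - h x)) < e/2"
    using assms(1) \<open>e > 0\<close> unfolding lipschitz_dense_def by (meson half_gt_zero)
  obtain L' M' h' where h': "L'-lipschitz_on UNIV h'" "\<And>x. \<bar>x\<bar> > real M' \<Longrightarrow> h' x = 0"
    "(LINT x|lborel. norm (g x - h' x)) < e/2"
    using assms(2) \<open>e > 0\<close> unfolding lipschitz_dense_def by (meson half_gt_zero)
  note int = integrable_compact_support[OF h(1,2)] integrable_compact_support[OF h'(1,2)]
  have "(LINT x|lborel. norm (f x + g x - (h x + h' x)))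
      \<le> (LINT x|lborel. norm (f x - h x) + norm (g x - h' x))"
    using assms int by (intro integral_mono) (auto simp: add_diff_add norm_triangle_ineq)
  also have "\<dots> < e" using assms int h(3) h'(3) by simp
  finally have "(LINT x|lborel. norm (f x + g x - (h x + h' x))) < e" .
  moreover have "(L + L')-lipschitz_on UNIV (\<lambda>x. h x + h' x)"
    using h h' by (intro lipschitz_on_add)
  moreover have "\<forall>x. \<bar>x\<bar> > real (max M M') \<longrightarrow> h x + h' x = 0"
    using h(2) h'(2) by auto
  ultimately show "\<exists>L M h. L-lipschitz_on UNIV h \<and> (\<forall>x. \<bar>x\<bar> > real M \<longrightarrow> h x = 0) \<and>
      (LINT x|lborel. norm (f x + g x - h x)) < e" by blast
qed

lemma integrable_imp_lipschitz_dense: "integrable lborel g \<Longrightarrow> lipschitz_dense g"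
proof (induct rule: integrable_induct)
  case (base A c)
  then show ?case by (intro lipschitz_dense_indicator) auto
next
  case (add f g)
  then show ?case by (intro lipschitz_dense_add)
next
  case (lim f s)
  have "(\<lambda>i. LINT x|lborel. norm (f x - s i x)) \<longlonglongrightarrow> (LINT (x::real)|lborel. (0::real))"
  proof (rule integral_dominated_convergence[where w = "\<lambda>x. 3 * norm (f x)"])
    show "AE x in lborel. (\<lambda>i. norm (f x - s i x)) \<longlonglongrightarrow> 0"
    proof (rule AE_I2)
      fix x :: real
      have "(\<lambda>i. norm (f x - s i x)) \<longlonglongrightarrow> norm (f x - f x)"
        using lim(3)[of x] by (intro tendsto_norm tendsto_diff tendsto_const) simp
      then show "(\<lambda>i. norm (f x - s i x)) \<longlonglongrightarrow> 0" by simp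
    qed
    \<comment> \<open>The approximants are bounded by 2 \<open>norm (f x)\<close>, whence the factor
      3 for the differences.\<close>
    show "AE x in lborel. norm (norm (f x - s i x)) \<le> 3 * norm (f x)" for i
    proof (rule AE_I2)
      fix x :: real
      show "norm (norm (f x - s i x)) \<le> 3 * norm (f x)"
        using lim(4)[of x i] norm_triangle_ineq4[of "f x" "s i x"] by simp
    qed
  qed (use lim(1,5) in auto)
  then have lim0: "(\<lambda>i. LINT x|lborel. norm (f x - s i x)) \<longlonglongrightarrow> 0" by simp
  show ?case
  proof (rule lipschitz_dense_limit[OF _ lim(5)])
    fix e :: real assume "e > 0"
    then obtain i where "(LINT x|lborel. norm (f x - s i x)) < e"
      using order_tendstoD(2)[OF lim0] by (auto simp: eventually_sequentially)
    then show "\<exists>g'. integrable lborel g' \<and> lipschitz_dense g' \<and> (LINT x|lborel. norm (f x - g' x)) < e"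
      using lim(1,2) by blast
  qed
qed

section \<open>Asymptotics of local observables\<close>

text \<open>Since the peak decreases, each of the \<open>a\<close> extra steps costs at most what
  the estimate allows for the first. For fixed \<open>a\<close> and large \<open>b\<close> the value
  at 0 is thus insensitive to a delay.\<close>

lemma avg_funpow_drift:
  fixes f :: "int \<Rightarrow> 'a::real_normed_vector"
  assumes "\<And>k. norm (f k) \<le> C"
  shows "norm ((avg ^^ (b + a)) f 0 - (avg ^^ b) f 0) \<le> 12 * C * real a * walk_dist b 0"
proof (induction a)
  case (Suc a)
  have C: "C \<ge> 0" using order_trans[OF norm_ge_zero assms] .
  have "norm ((avg ^^ Suc (b + a)) f 0 - (avg ^^ (b + a)) f 0) \<le> 12 * C * walk_dist (b + a) 0"
    by (rule norm_avg_increment_le[OF assms])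
  also have "\<dots> \<le> 12 * C * walk_dist b 0"
    using C walk_dist_0_decseq by (intro mult_left_mono) (auto simp: decseq_def)
  finally have "norm ((avg ^^ Suc (b + a)) f 0 - (avg ^^ (b + a)) f 0) \<le> 12 * C * walk_dist b 0" .
  then have "norm (((avg ^^ Suc (b + a)) f 0 - (avg ^^ (b + a)) f 0) + ((avg ^^ (b + a)) f 0 - (avg ^^ b) f 0))
      \<le> 12 * C * walk_dist b 0 + 12 * C * real a * walk_dist b 0"
    using Suc by (intro norm_triangle_mono)
  then show ?case by (simp add: algebra_simps)
qed simp

lemma integral_mult_bounded:
  fixes F g :: "real \<Rightarrow> complex"
  assumes F: "F \<in> borel_measurable borel" "\<And>x. norm (F x) \<le> C" and g: "integrable lborel g"
  shows "integrable lborel (\<lambda>x. F x * g x)"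
    and "norm (LINT x|lborel. F x * g x) \<le> C * (LINT x|lborel. norm (g x))"
proof -
  show int: "integrable lborel (\<lambda>x. F x * g x)"
    using set_integrable_mult_bounded[OF F, of UNIV g] g by (simp add: set_integrable_def)
  have "norm (LINT x|lborel. F x * g x) \<le> (LINT x|lborel. norm (F x * g x))"
    by (rule integral_norm_bound)
  also have "\<dots> \<le> (LINT x|lborel. C * norm (g x))"
  proof (rule integral_mono)
    show "norm (F x * g x) \<le> C * norm (g x)" for x
      unfolding norm_mult by (intro mult_right_mono F(2)) simp
  qed (use integrable_norm[OF int] g in auto)
  finally show "norm (LINT x|lborel. F x * g x) \<le> C * (LINT x|lborel. norm (g x))" by simp
qed

lemma integral_cells_compact_support:
  fixes h :: "real \<Rightarrow> 'a::{banach, second_countable_topology}"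
  assumes "\<And>x. \<bar>x\<bar> > real M \<Longrightarrow> h x = 0" "integrable lborel h"
  shows "(LINT x|lborel. h x) = (\<Sum>j\<in>{-int M..<int M}. cell_integral h j)"
proof -
  have eq: "indicator {of_int (- int M)..of_int (int M)} x *\<^sub>R h x = h x" for x :: real
    using assms(1)[of x] by (cases "x \<in> {- real M..real M}") auto
  have "set_integrable lborel {of_int (- int M)..of_int (int M)} h"
    unfolding set_integrable_def eq by (rule assms(2))
  then have "(LINT x:{of_int (- int M)..of_int (int M)}|lborel. h x) = (\<Sum>j\<in>{-int M..<int M}. cell_integral h j)"
    by (rule set_integral_cells) simp
  then show ?thesis unfolding set_lebesgue_integral_def eq .
qed

context walk_map
begin

text \<open>The functions \<open>F n\<close> may vary with \<open>n\<close>; this uniformity is what yields exactness.\<close>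

lemma integral_asymptotics:
  fixes F :: "nat \<Rightarrow> real \<Rightarrow> complex"
  assumes F_meas: "\<And>n. F n \<in> borel_measurable borel" and F: "\<And>n x. norm (F n x) \<le> C"
    and g: "integrable lborel g"
  shows "(\<lambda>n. (LINT x|lborel. F n ((T ^^ n) x) * g x)
    - (avg ^^ n) (cell_integral (F n)) 0 * (LINT x|lborel. g x)) \<longlonglongrightarrow> 0"
proof (rule LIMSEQ_I)
  fix e :: real assume "e > 0"
  have C: "C \<ge> 0" using order_trans[OF norm_ge_zero F] .
  \<comment> \<open>Replacing \<open>g\<close> by a Lipschitz \<open>h\<close> costs
    \<open>C * e'\<close> in the integral and again in the comparison term; \<open>\<rho>\<close>
    below is what remains. The 1 in the denominator handles \<open>C\<close> = 0.\<close>
  define e' where "e' = e / (2 * (C + 1))"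
  have e': "e' > 0" "2 * C * e' < e"
    using \<open>e > 0\<close> C by (simp_all add: e'_def field_simps)
  obtain L M h where h: "L-lipschitz_on UNIV h" "\<And>x. \<bar>x\<bar> > real M \<Longrightarrow> h x = 0"
    "(LINT x|lborel. norm (g x - h x)) < e'"
    using integrable_imp_lipschitz_dense[OF g] e'(1) unfolding lipschitz_dense_def by blast
  have h_int: "integrable lborel h" by (rule integrable_compact_support[OF h(1,2)])
  define \<rho> where "\<rho> = e - 2 * C * e'"
  have \<rho>: "\<rho> > 0" using e' by (simp add: \<rho>_def)
  \<comment> \<open>\<open>L\<close> and \<open>M\<close> depend on \<open>h\<close> only, so the
    smoothing time \<open>a\<close> can be fixed before \<open>b\<close> grows; 2M is the number of
    cells covering the support.\<close>
  have "(\<lambda>a. (5/9) ^ a * (L * C * (2 * real M))) \<longlonglongrightarrow> 0 * (L * C * (2 * real M))"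
    by (intro tendsto_mult_right LIMSEQ_realpow_zero) auto
  then have "\<forall>\<^sub>F a in sequentially. (5/9) ^ a * (L * C * (2 * real M)) < \<rho> / 2"
    using \<rho> by (intro order_tendstoD(2)) auto
  then obtain a where a: "(5/9) ^ a * (L * C * (2 * real M)) < \<rho> / 2"
    using eventually_happens'[OF sequentially_bot] by blast
  \<comment> \<open>From the cells -M, ..., M - 1 the states reached in \<open>a\<close> steps have
    modulus at most M + 2a. There the iterate is compared with its value at 0 by the gap, and the
    value at time b with that at time b + a by the drift.\<close>
  define \<eta> where "\<eta> b = (\<Sum>k\<in>{-(int M + 2 * int a)..int M + 2 * int a}. C * walk_gap b k)
      + 12 * C * real a * walk_dist b 0" for b
  have "(\<lambda>b. \<eta> b * (LINT x|lborel. norm (h x))) \<longlonglongrightarrow>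
      ((\<Sum>k\<in>{-(int M + 2 * int a)..int M + 2 * int a}. C * 0) + 12 * C * real a * 0) * (LINT x|lborel. norm (h x))"
    unfolding \<eta>_def
    by (intro tendsto_mult_right tendsto_add tendsto_sum tendsto_mult_left walk_gap_tendsto walk_dist_0_tendsto)
  then have "(\<lambda>b. \<eta> b * (LINT x|lborel. norm (h x))) \<longlonglongrightarrow> 0" by simp
  then obtain b0 where b0: "\<And>b. b \<ge> b0 \<Longrightarrow> \<eta> b * (LINT x|lborel. norm (h x)) < \<rho> / 2"
    using order_tendstoD(2)[of _ 0 sequentially "\<rho> / 2"] \<rho> by (auto simp: eventually_sequentially)
  have main: "norm ((LINT x|lborel. F n ((T ^^ n) x) * g x)
      - (avg ^^ n) (cell_integral (F n)) 0 * (LINT x|lborel. g x)) < e" if "n \<ge> a + b0" for n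
  proof -
    \<comment> \<open>The first \<open>a\<close> iterates act on the density; the remaining
      \<open>b\<close> are absorbed into the observable \<open>H\<close>.\<close>
    define b where "b = n - a"
    have b: "n = b + a" "b \<ge> b0" using that by (auto simp: b_def)
    define H where "H x = F n ((T ^^ b) x)" for x
    define f where "f = cell_integral (F n)"
    define z where "z = (avg ^^ n) f 0"
    have f: "norm (f k) \<le> C" for k unfolding f_def by (rule norm_cell_integral_le) (rule F)
    have z: "norm z \<le> C" unfolding z_def by (rule norm_avg_funpow_le[OF f])
    have H_meas: "H \<in> borel_measurable borel"
      unfolding H_def[abs_def] by (rule measurable_compose[OF T_funpow_measurable F_meas])
    have H: "norm (H x) \<le> C" for x by (simp add: H_def F)
    have HT: "F n ((T ^^ n) x) = H ((T ^^ a) x)" for x by (simp add: H_def b funpow_add)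
    have Fn_meas: "(\<lambda>x. F n ((T ^^ n) x)) \<in> borel_measurable borel"
      by (rule measurable_compose[OF T_funpow_measurable F_meas])
    have H_cell: "cell_integral H k = (avg ^^ b) f k" for k
      unfolding H_def[abs_def] f_def by (rule cell_integral_T_funpow[OF F_meas F])
    have near: "norm (cell_integral H k - z) \<le> \<eta> b" if "\<bar>k\<bar> \<le> int M + 2 * int a" for k
    proof -
      have "norm ((avg ^^ b) f k - (avg ^^ b) f 0) \<le> C * walk_gap b k" by (rule avg_funpow_gap[OF f])
      also have "\<dots> \<le> (\<Sum>k\<in>{-(int M + 2 * int a)..int M + 2 * int a}. C * walk_gap b k)"
        using that by (intro member_le_sum mult_nonneg_nonneg C walk_gap_nonneg) auto
      finally have "norm (((avg ^^ b) f k - (avg ^^ b) f 0) + ((avg ^^ b) f 0 - z)) \<le> \<eta> b"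
        unfolding \<eta>_def using avg_funpow_drift[OF f, of b a]
        by (intro norm_triangle_mono) (simp_all add: z_def b norm_minus_commute)
      then show ?thesis by (simp add: H_cell)
    qed
    have cells: "norm (cell_integral (\<lambda>x. H ((T ^^ a) x) * h x) j - z * cell_integral h j)
        \<le> \<eta> b * cell_integral (\<lambda>x. norm (h x)) j + (5/9) ^ a * L * C" if "j \<in> {-int M..<int M}" for j
      using that by (intro cell_mixing[OF H_meas H h(1)] near) auto
    have "(LINT x|lborel. F n ((T ^^ n) x) * h x) - z * (LINT x|lborel. h x)
        = (\<Sum>j\<in>{-int M..<int M}. cell_integral (\<lambda>x. H ((T ^^ a) x) * h x) j - z * cell_integral h j)"
      using integral_cells_compact_support[of M h, OF h(2) h_int]
        integral_cells_compact_support[of M "\<lambda>x. F n ((T ^^ n) x) * h x", OF _ integral_mult_bounded(1)[OF Fn_meas F h_int]]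
      by (simp add: h(2) HT sum_subtractf sum_distrib_left)
    also have "norm \<dots> \<le> (\<Sum>j\<in>{-int M..<int M}. \<eta> b * cell_integral (\<lambda>x. norm (h x)) j + (5/9) ^ a * L * C)"
      by (rule sum_norm_le) (rule cells)
    also have "\<dots> = \<eta> b * (LINT x|lborel. norm (h x)) + (5/9) ^ a * (L * C * (2 * real M))"
      using integral_cells_compact_support[of M "\<lambda>x. norm (h x)"] h(2) h_int
      by (simp add: sum.distrib sum_distrib_left mult_ac)
    also have "\<dots> < \<rho>" using a b0[OF b(2)] by simp
    finally have on_h: "norm ((LINT x|lborel. F n ((T ^^ n) x) * h x) - z * (LINT x|lborel. h x)) < \<rho>" .
    have gh: "integrable lborel (\<lambda>x. g x - h x)" using g h_int by simp
    have "norm (LINT x|lborel. F n ((T ^^ n) x) * (g x - h x)) \<le> C * (LINT x|lborel. norm (g x - h x))"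
      by (rule integral_mult_bounded(2)[OF Fn_meas F gh])
    also have "\<dots> \<le> C * e'" using h(3) C by (intro mult_left_mono) auto
    finally have rest1: "norm (LINT x|lborel. F n ((T ^^ n) x) * (g x - h x)) \<le> C * e'" .
    have "norm (z * (LINT x|lborel. g x - h x)) \<le> C * (LINT x|lborel. norm (g x - h x))"
      unfolding norm_mult by (intro mult_mono z C integral_norm_bound) auto
    also have "\<dots> \<le> C * e'" using h(3) C by (intro mult_left_mono) auto
    finally have rest2: "norm (z * (LINT x|lborel. g x - h x)) \<le> C * e'" .
    have "(LINT x|lborel. F n ((T ^^ n) x) * (g x - h x))
        = (LINT x|lborel. F n ((T ^^ n) x) * g x) - (LINT x|lborel. F n ((T ^^ n) x) * h x)"
      unfolding right_diff_distrib
      by (intro Bochner_Integration.integral_diff integral_mult_bounded(1)[OF Fn_meas F] g h_int)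
    then have "(LINT x|lborel. F n ((T ^^ n) x) * g x) - z * (LINT x|lborel. g x)
        = ((LINT x|lborel. F n ((T ^^ n) x) * h x) - z * (LINT x|lborel. h x))
          + ((LINT x|lborel. F n ((T ^^ n) x) * (g x - h x)) - z * (LINT x|lborel. g x - h x))"
      using g h_int by (simp add: algebra_simps)
    moreover have "norm ((LINT x|lborel. F n ((T ^^ n) x) * (g x - h x)) - z * (LINT x|lborel. g x - h x))
        \<le> C * e' + C * e'"
      using norm_triangle_ineq4 rest1 rest2 by (rule order_trans[OF _ add_mono])
    ultimately have "norm ((LINT x|lborel. F n ((T ^^ n) x) * g x) - z * (LINT x|lborel. g x)) < \<rho> + (C * e' + C * e')"
      using on_h by (auto intro: norm_add_less order_le_less_trans[OF norm_triangle_ineq add_less_le_mono])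
    then show ?thesis by (simp add: \<rho>_def z_def f_def)
  qed
  then show "\<exists>n0. \<forall>n\<ge>n0. norm ((LINT x|lborel. F n ((T ^^ n) x) * g x)
    - (avg ^^ n) (cell_integral (F n)) 0 * (LINT x|lborel. g x) - 0) < e" by auto
qed

end

section \<open>Conservativity, exactness and irreducibility\<close>

lemma cell_integral_indicator:
  assumes "A \<in> sets borel"
  shows "cell_integral (indicator A :: real \<Rightarrow> complex) k = of_real (measure lborel (A \<inter> {of_int k..of_int k + 1}))"
proof -
  have "cell_integral (indicator A :: real \<Rightarrow> complex) k
      = (LINT x|lborel. of_real (indicator (A \<inter> {of_int k..of_int k + 1}) x))"
    unfolding cell_integral_def set_lebesgue_integral_def
    by (rule Bochner_Integration.integral_cong) (auto simp: indicator_def)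
  then show ?thesis by simp
qed

text \<open>\<open>measure\<close> returns 0 on sets of infinite measure, so its vanishing
  identifies null sets only after cutting into cells.\<close>

lemma emeasure_cell_finite:
  fixes A :: "real set"
  shows "emeasure lborel (A \<inter> {of_int k..of_int k + (1::real)}) \<noteq> \<infinity>"
proof -
  have "emeasure lborel (A \<inter> {of_int k..of_int k + (1::real)}) \<le> emeasure lborel {of_int k..of_int k + (1::real)}"
    by (rule emeasure_mono) auto
  also have "\<dots> < \<infinity>" by simp
  finally show ?thesis by simp
qed

lemma null_set_cellwise:
  fixes A :: "real set"
  assumes "A \<in> sets borel" "\<And>k. measure lborel (A \<inter> {of_int k..of_int k + 1}) = 0"
  shows "A \<in> null_sets lborel"
proof -
  have "A \<inter> {of_int k..of_int k + 1} \<in> null_sets lborel" for k :: int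
    using assms emeasure_cell_finite[of A k] by (intro null_setsI) (auto simp: emeasure_eq_ennreal_measure)
  then have "(\<Union>k::int. A \<inter> {of_int k..of_int k + 1}) \<in> null_sets lborel" by (intro null_sets_UN) auto
  also have "(\<Union>k::int. A \<inter> {of_int k..of_int k + 1}) = A"
  proof
    show "A \<subseteq> (\<Union>k::int. A \<inter> {of_int k..of_int k + 1})"
    proof
      fix x assume "x \<in> A"
      then have "x \<in> A \<inter> {of_int \<lfloor>x\<rfloor>..of_int \<lfloor>x\<rfloor> + 1}" by (auto intro: less_imp_le)
      then show "x \<in> (\<Union>k::int. A \<inter> {of_int k..of_int k + 1})" by blast
    qed
  qed auto
  finally show ?thesis .
qed

context walk_map
begin

lemma T_funpow_vimage: "A \<in> sets borel \<Longrightarrow> (T ^^ n) -` A \<in> sets borel"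
  using measurable_sets[OF T_funpow_measurable, of A n] by simp

lemma measure_T_funpow_vimage:
  assumes "A \<in> sets borel"
  shows "measure lborel ((T ^^ n) -` A \<inter> {of_int j..of_int j + 1})
    = (avg ^^ n) (\<lambda>k. measure lborel (A \<inter> {of_int k..of_int k + 1})) j"
proof -
  define w where "w k = measure lborel (A \<inter> {of_int k..of_int k + 1})" for k :: int
  have "complex_of_real (measure lborel ((T ^^ n) -` A \<inter> {of_int j..of_int j + 1}))
      = cell_integral (indicator ((T ^^ n) -` A)) j"
    using assms by (simp add: cell_integral_indicator T_funpow_vimage)
  also have "indicator ((T ^^ n) -` A) = (\<lambda>x. indicator A ((T ^^ n) x) :: complex)"
    by (auto simp: indicator_def)
  also have "cell_integral \<dots> j = (avg ^^ n) (cell_integral (indicator A)) j"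
    using assms by (intro cell_integral_T_funpow[where C = 1]) (auto simp: indicator_def)
  also have "cell_integral (indicator A) = (\<lambda>k. complex_of_real (w k))"
    using assms by (simp add: cell_integral_indicator w_def fun_eq_iff)
  also have "(avg ^^ n) (\<lambda>k. complex_of_real (w k)) = (\<lambda>k. complex_of_real ((avg ^^ n) w k))"
    by (induction n) (simp_all add: avg_def fun_eq_iff scaleR_conv_of_real)
  finally show ?thesis unfolding of_real_eq_iff w_def[abs_def] .
qed

text \<open>The map is nonsingular: a null set has cell weights 0, and \<open>avg\<close> fixes the
  zero sequence. This is what allows representatives to be changed under iteration.\<close>

lemma AE_T_funpow:
  assumes "AE x in lborel. P x"
  shows "AE x in lborel. P ((T ^^ n) x)"
proof -
  obtain N where N: "{x. \<not> P x} \<subseteq> N" "N \<in> null_sets lborel"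
    using assms by (auto simp: eventually_ae_filter)
  have "measure lborel (N \<inter> {of_int k..of_int k + 1}) = 0" for k :: int
  proof -
    have "N \<inter> {of_int k..of_int k + 1} \<in> null_sets lborel"
      using N(2) by (rule null_set_Int2) simp
    then show ?thesis by (simp add: measure_def null_sets_def)
  qed
  then have "(T ^^ n) -` N \<in> null_sets lborel"
    using N(2) by (intro null_set_cellwise T_funpow_vimage)
      (simp_all add: measure_T_funpow_vimage avg_funpow_const null_sets_def)
  then show ?thesis
    by (rule AE_I') (use N(1) in auto)
qed

text \<open>Traces on [0, 1] of the preimages of a wandering set are disjoint up to null sets, so
  their measures have sum at most 1. The n-th one is at least a positive constant times
  \<open>walk_dist n k\<close> for a cell \<open>k\<close> charged by \<open>W\<close>, which
  contradicts recurrence.\<close>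

lemma conservative: "conservative_map T"
  unfolding conservative_map_def
proof
  assume "\<exists>W\<in>sets borel. emeasure lborel W > 0 \<and>
          (\<forall>m n. m \<noteq> n \<longrightarrow> ((T ^^ m) -` W) \<inter> ((T ^^ n) -` W) \<in> null_sets lborel)"
  then obtain W where W: "W \<in> sets borel" "emeasure lborel W > 0"
    and disj: "\<And>m n. m \<noteq> n \<Longrightarrow> (T ^^ m) -` W \<inter> (T ^^ n) -` W \<in> null_sets lborel" by blast
  define w where "w k = measure lborel (W \<inter> {of_int k..of_int k + 1})" for k :: int
  have "W \<notin> null_sets lborel" using W(2) by auto
  then obtain k where "w k \<noteq> 0" using null_set_cellwise[OF W(1)] by (auto simp: w_def)
  then have k: "w k > 0" by (simp add: w_def less_le)
  define A where "A n = (T ^^ n) -` W \<inter> {0..1::real}" for n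
  have A_meas: "A n \<in> sets borel" for n unfolding A_def using W(1) by (intro sets.Int T_funpow_vimage) auto
  have A_fin: "emeasure lborel (A n) \<noteq> \<infinity>" for n
    using emeasure_cell_finite[of "(T ^^ n) -` W" 0] by (simp add: A_def)
  have sum_le: "(\<Sum>n<N. measure lborel (A n)) \<le> 1" for N
  proof -
    have null: "AE x in lborel. m \<noteq> n \<longrightarrow> \<not> (x \<in> A m \<and> x \<in> A n)" for m n
    proof (cases "m = n")
      case False
      show ?thesis using disj[OF False] by (rule AE_I') (auto simp: A_def)
    qed simp
    have "AE x in lborel. \<forall>m n. m \<noteq> n \<longrightarrow> \<not> (x \<in> A m \<and> x \<in> A n)"
      unfolding AE_all_countable by (intro allI null)
    then have "AE x in lborel. (\<Sum>n<N. indicator (A n) x) \<le> (indicator {0..1} x :: real)"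
    proof eventually_elim
      case (elim x)
      show ?case
      proof (cases "\<exists>m<N. x \<in> A m")
        case True
        then obtain m where m: "m < N" "x \<in> A m" by blast
        then have "(\<Sum>n<N. indicator (A n) x) = (\<Sum>n<N. if n = m then 1 else (0::real))"
          using elim by (intro sum.cong) (auto simp: indicator_def)
        also have "\<dots> = 1" using m(1) by simp
        finally show ?thesis using m(2) by (simp add: A_def)
      qed (simp add: indicator_def)
    qed
    then have "(LINT x|lborel. (\<Sum>n<N. indicator (A n) x)) \<le> (LINT x|lborel. indicator {0..1::real} x :: real)"
      using A_meas A_fin by (intro integral_mono_AE Bochner_Integration.integrable_sum)
        (auto simp: integrable_indicator_iff less_top[symmetric])
    also have "(LINT x|lborel. (\<Sum>n<N. indicator (A n) x :: real)) = (\<Sum>n<N. measure lborel (A n))"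
      using A_meas A_fin by (subst Bochner_Integration.integral_sum)
        (auto simp: integrable_indicator_iff less_top[symmetric])
    finally show ?thesis by simp
  qed
  have lower: "w k * walk_dist n k \<le> measure lborel (A n)" for n
  proof -
    define M where "M = max (2 * int n) \<bar>k\<bar>"
    have "walk_dist n k * w k \<le> (\<Sum>k\<in>{-M..M}. walk_dist n k * w k)"
      by (rule member_le_sum) (auto simp: M_def w_def walk_dist_nonneg)
    also have "\<dots> = (avg ^^ n) w 0"
      using avg_funpow_at_0[of n M w] by (simp add: M_def)
    also have "\<dots> = measure lborel (A n)"
      using measure_T_funpow_vimage[OF W(1), of n 0] by (simp add: w_def[abs_def] A_def)
    finally show ?thesis by (simp add: mult.commute)
  qed
  have "summable (\<lambda>n. w k * walk_dist n k)"
  proof (rule bounded_imp_summable)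
    show "0 \<le> w k * walk_dist n k" for n using k by (simp add: walk_dist_nonneg)
    show "(\<Sum>n\<le>N. w k * walk_dist n k) \<le> 1" for N
      using order_trans[OF sum_mono[OF lower] sum_le, of "Suc N"] by (simp only: lessThan_Suc_atMost)
  qed
  then have "summable (\<lambda>n. walk_dist n k)" using k by (simp add: summable_cmult_iff)
  then show False using walk_dist_not_summable by blast
qed

text \<open>A tail set A is the n-th preimage of some \<open>B n\<close> for every n, so the
  asymptotics with a varying observable give numbers \<open>z n\<close>, independent of the test set
  E, such that m(A \<inter> E) - \<open>z n\<close> m(E) tends to 0. Test sets inside A force
  \<open>z n\<close> to tend to 1, those in the complement force 0.\<close>

lemma exact: "exact_map T"
  unfolding exact_map_def
proof
  fix A assume "A \<in> (\<Inter>n. {(T ^^ n) -` B | B. B \<in> sets borel})"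
  then have "\<forall>n. \<exists>B\<in>sets borel. A = (T ^^ n) -` B" by blast
  then obtain B where B: "\<And>n. B n \<in> sets borel" "\<And>n. A = (T ^^ n) -` B n" by metis
  have A: "A \<in> sets borel" using B[of 0] by simp
  define z where "z n = (avg ^^ n) (cell_integral (indicator (B n) :: real \<Rightarrow> complex)) 0" for n
  have lim: "(\<lambda>n. of_real (measure lborel (A \<inter> E)) - z n * of_real (measure lborel E)) \<longlonglongrightarrow> 0"
    if E: "E \<in> sets borel" "emeasure lborel E \<noteq> \<infinity>" for E
  proof -
    have "integrable lborel (\<lambda>x. complex_of_real (indicator E x))"
      using E by (intro integrable_of_real) (simp add: integrable_indicator_iff less_top[symmetric])
    then have "(\<lambda>n. (LINT x|lborel. indicator (B n) ((T ^^ n) x) * complex_of_real (indicator E x))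
        - z n * (LINT x|lborel. complex_of_real (indicator E x))) \<longlonglongrightarrow> 0"
      unfolding z_def using B(1)
      by (intro integral_asymptotics[where C = 1]) (auto simp: indicator_def)
    moreover have "(LINT x|lborel. indicator (B n) ((T ^^ n) x) * complex_of_real (indicator E x))
        = (LINT x|lborel. complex_of_real (indicator (A \<inter> E) x))" for n
      by (rule Bochner_Integration.integral_cong) (auto simp: indicator_def B(2)[of n])
    ultimately show ?thesis by simp
  qed
  show "A \<in> null_sets lborel \<or> - A \<in> null_sets lborel"
  proof (rule ccontr)
    assume "\<not> ?thesis"
    then obtain j k where jk: "measure lborel (A \<inter> {of_int j..of_int j + 1}) \<noteq> 0"
      "measure lborel (- A \<inter> {of_int k..of_int k + 1}) \<noteq> 0"
      using null_set_cellwise[OF A] null_set_cellwise[of "- A"] A by auto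
    define a where "a = measure lborel (A \<inter> {of_int j..of_int j + 1})"
    define c where "c = measure lborel (- A \<inter> {of_int k..of_int k + 1})"
    have "(\<lambda>n. complex_of_real a - z n * of_real a) \<longlonglongrightarrow> 0"
      using lim[of "A \<inter> {of_int j..of_int j + 1}"] A emeasure_cell_finite[of A j]
      by (simp add: a_def Int_assoc[symmetric])
    then have "(\<lambda>n. of_real a - (complex_of_real a - z n * of_real a)) \<longlonglongrightarrow> of_real a - 0"
      by (intro tendsto_diff tendsto_const)
    then have "(\<lambda>n. z n * of_real a / of_real a) \<longlonglongrightarrow> of_real a / of_real a"
      using jk(1) by (intro tendsto_divide tendsto_const) (simp_all add: a_def)
    then have "z \<longlonglongrightarrow> 1" using jk(1) by (simp add: a_def)
    moreover have "(\<lambda>n. - (z n * of_real c)) \<longlonglongrightarrow> 0"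
      using lim[of "- A \<inter> {of_int k..of_int k + 1}"] A emeasure_cell_finite[of "- A" k]
      by (simp add: c_def Int_assoc[symmetric])
    then have "(\<lambda>n. z n * of_real c) \<longlonglongrightarrow> 0" by (simp add: tendsto_minus_cancel_left[symmetric])
    then have "(\<lambda>n. z n * of_real c / of_real c) \<longlonglongrightarrow> 0 / of_real c"
      using jk(2) by (intro tendsto_divide tendsto_const) (simp_all add: c_def)
    then have "z \<longlonglongrightarrow> 0" using jk(2) by (simp add: c_def)
    ultimately show False using LIMSEQ_unique zero_neq_one by metis
  qed
qed

lemma T_image_branch:
  assumes "j - 2 \<le> k" "k \<le> j + 2" "walkQ j k > 0"
  shows "{of_int k<..<of_int k + 1} \<subseteq> T ` interior (branch_interval walkQ j k)"
proof
  fix y :: real assume y: "y \<in> {of_int k<..<of_int k + 1}"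
  have "walkQ j k * (y - of_int k) < walkQ j k * 1"
    using assms y by (intro mult_strict_left_mono) auto
  then have "inv_branch j k y \<in> interior (branch_interval walkQ j k)"
    using assms y by (simp add: branch_interval_start inv_branch_def)
  then show "y \<in> T ` interior (branch_interval walkQ j k)"
    using T_inv_branch[OF assms, of y] y by force
qed

lemma interior_branch_interval:
  assumes "j - 2 \<le> k" "k \<le> j + 2"
  shows "interior (branch_interval walkQ j k) \<subseteq> {of_int j<..<of_int j + 1}"
    and "branch_interval walkQ j k \<subseteq> {of_int j..of_int j + 1}"
proof -
  have "branch_start j (j - 2) \<le> branch_start j k" "branch_start j (k + 1) \<le> branch_start j (j + 3)"
    using assms by (auto intro!: branch_start_mono)
  then show "interior (branch_interval walkQ j k) \<subseteq> {of_int j<..<of_int j + 1}"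
    and "branch_interval walkQ j k \<subseteq> {of_int j..of_int j + 1}"
    using assms branch_start_Suc[of j k]
    by (auto simp: branch_interval_start branch_start_first branch_start_last)
qed

text \<open>Open cells are used because the values of T at endpoints are arbitrary. One more
  application covers a neighbouring cell, so \<open>l\<close> moves away from \<open>k\<close> in
  unit steps.\<close>

lemma T_funpow_image_cell:
  "\<exists>n. {of_int l<..<of_int l + 1} \<subseteq> (T ^^ n) ` {of_int k<..<of_int k + 1}"
proof -
  have step: "\<exists>n. {of_int l'<..<of_int l' + 1} \<subseteq> (T ^^ n) ` {of_int k<..<of_int k + 1}"
    if IH: "\<exists>n. {of_int l<..<of_int l + 1} \<subseteq> (T ^^ n) ` {of_int k<..<of_int k + 1}"
      and l': "walkQ l l' \<ge> 1/9" "l - 2 \<le> l'" "l' \<le> l + 2" for l l'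
  proof -
    obtain n where n: "{of_int l<..<of_int l + 1} \<subseteq> (T ^^ n) ` {of_int k<..<of_int k + 1}" using IH by blast
    have "{of_int l'<..<of_int l' + 1} \<subseteq> T ` interior (branch_interval walkQ l l')"
      using l' by (intro T_image_branch) auto
    also have "\<dots> \<subseteq> T ` {of_int l<..<of_int l + 1}"
      using l' by (intro image_mono interior_branch_interval)
    also have "\<dots> \<subseteq> T ` (T ^^ n) ` {of_int k<..<of_int k + 1}" by (intro image_mono n)
    also have "\<dots> = (T ^^ Suc n) ` {of_int k<..<of_int k + 1}" by (simp add: image_image)
    finally show ?thesis by blast
  qed
  show ?thesis
  proof (induction l rule: int_induct[where k = k])
    case base
    have "{of_int k<..<of_int k + 1} \<subseteq> (T ^^ 0) ` {of_int k<..<of_int k + 1}" by simp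
    then show ?case by blast
  next
    case (step1 i)
    show ?case by (rule step[OF step1(2) walkQ_succ]) auto
  next
    case (step2 i)
    show ?case by (rule step[OF step2(2) walkQ_pred]) auto
  qed
qed

lemma irreducible: "irreducible_map (markov_partition walkQ) T"
  unfolding irreducible_map_def
proof (intro ballI)
  fix I I' assume "I \<in> markov_partition walkQ" "I' \<in> markov_partition walkQ"
  then obtain j k j' k' where I: "I = branch_interval walkQ j k" "j - 2 \<le> k" "k \<le> j + 2" "walkQ j k > 0"
    and I': "I' = branch_interval walkQ j' k'" "j' - 2 \<le> k'" "k' \<le> j' + 2"
    unfolding markov_partition_def by blast
  obtain n where n: "{of_int j'<..<of_int j' + 1} \<subseteq> (T ^^ n) ` {of_int k<..<of_int k + 1}"
    using T_funpow_image_cell by blast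
  \<comment> \<open>One application stretches \<open>I\<close> over the whole cell \<open>k\<close>;
    this extra step also makes the exponent at least 1.\<close>
  also have "\<dots> \<subseteq> (T ^^ n) ` T ` interior I"
    using I by (intro image_mono) (simp add: T_image_branch)
  also have "\<dots> \<subseteq> (T ^^ n) ` T ` I" by (intro image_mono interior_subset)
  also have "\<dots> = (T ^^ Suc n) ` I" by (simp add: image_image funpow_swap1)
  finally have sub: "{of_int j'<..<of_int j' + 1} \<subseteq> (T ^^ Suc n) ` I" .
  have "AE x in lborel. x \<in> I' \<longrightarrow> x \<in> (T ^^ Suc n) ` I"
    using AE_lborel_singleton[of "of_int j' :: real"] AE_lborel_singleton[of "of_int j' + 1 :: real"]
  proof eventually_elim
    case (elim x)
    show ?case
    proof
      assume "x \<in> I'"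
      then have "x \<in> {of_int j'..of_int j' + 1}" using interior_branch_interval(2)[OF I'(2,3)] I'(1) by auto
      then have "x \<in> {of_int j'<..<of_int j' + 1}" using elim by simp
      then show "x \<in> (T ^^ Suc n) ` I" using sub by blast
    qed
  qed
  then show "\<exists>n\<ge>1. AE x in lborel. x \<in> I' \<longrightarrow> x \<in> (T ^^ n) ` I"
    by (intro exI[of _ "Suc n"] conjI) auto
qed

end

section \<open>Means of global observables\<close>

lemma L_infty_bounded_representative:
  assumes "F \<in> L_infty"
  obtains F' C where "F' \<in> borel_measurable borel" "\<And>x. norm (F' x) \<le> C"
    "AE x in lborel. F x = F' x"
proof -
  obtain C where C: "F \<in> borel_measurable borel" "AE x in lborel. norm (F x) \<le> C"
    using assms by (auto simp: L_infty_def)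
  \<comment> \<open>The maximum with 0 makes the bound valid where the function is cut to 0.\<close>
  define F' where "F' x = (if norm (F x) \<le> max C 0 then F x else 0)" for x
  show ?thesis
  proof (rule that)
    show "F' \<in> borel_measurable borel"
      using C(1) unfolding F'_def[abs_def] by measurable
    show "norm (F' x) \<le> max C 0" for x by (simp add: F'_def)
    show "AE x in lborel. F x = F' x" using C(2) by eventually_elim (simp add: F'_def)
  qed
qed

lemma L_infty_measurable: "F \<in> L_infty \<Longrightarrow> F \<in> borel_measurable borel"
  by (simp add: L_infty_def)

lemma L_infty_set_integrable:
  assumes "F \<in> L_infty"
  shows "set_integrable lborel {a..b} F"
proof -
  obtain F' C where F': "F' \<in> borel_measurable borel" "\<And>x. norm (F' x) \<le> C"
    "AE x in lborel. F x = F' x" using L_infty_bounded_representative[OF assms] by blast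
  have "set_integrable lborel {a..b} F \<longleftrightarrow> set_integrable lborel {a..b} F'"
    using F'(1) L_infty_measurable[OF assms] F'(3) by (intro set_integrable_cong_AE) auto
  then show ?thesis using set_integrable_bounded[OF F'(1,2)] by simp
qed

lemma bounded_in_L_infty:
  assumes "F \<in> borel_measurable borel" "\<And>x. norm (F x) \<le> C"
  shows "F \<in> L_infty"
  using assms by (auto simp: L_infty_def)

lemma L_infty_mult:
  assumes "F \<in> L_infty" "G \<in> L_infty"
  shows "(\<lambda>x. F x * G x) \<in> L_infty"
proof -
  obtain C D where C: "F \<in> borel_measurable borel" "AE x in lborel. norm (F x) \<le> C"
    and D: "G \<in> borel_measurable borel" "AE x in lborel. norm (G x) \<le> D"
    using assms by (auto simp: L_infty_def)
  have "AE x in lborel. norm (F x * G x) \<le> C * D"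
    using C(2) D(2)
    by eventually_elim (auto simp: norm_mult intro!: mult_mono order_trans[OF norm_ge_zero])
  moreover have "(\<lambda>x. F x * G x) \<in> borel_measurable borel" using C D by measurable
  ultimately show ?thesis by (auto simp: L_infty_def)
qed

lemma L_infty_add:
  assumes "F \<in> L_infty" "G \<in> L_infty"
  shows "(\<lambda>x. F x + G x) \<in> L_infty"
proof -
  obtain C D where C: "F \<in> borel_measurable borel" "AE x in lborel. norm (F x) \<le> C"
    and D: "G \<in> borel_measurable borel" "AE x in lborel. norm (G x) \<le> D"
    using assms by (auto simp: L_infty_def)
  have "AE x in lborel. norm (F x + G x) \<le> C + D"
    using C(2) D(2) by eventually_elim (rule norm_triangle_mono)
  moreover have "(\<lambda>x. F x + G x) \<in> borel_measurable borel" using C D by measurable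
  ultimately show ?thesis by (auto simp: L_infty_def)
qed

lemma L_infty_const: "(\<lambda>x. c) \<in> L_infty"
  by (auto simp: L_infty_def)

lemma L_infty_sum: "finite I \<Longrightarrow> (\<And>i. i \<in> I \<Longrightarrow> u i \<in> L_infty) \<Longrightarrow> (\<lambda>x. \<Sum>i\<in>I. u i x) \<in> L_infty"
  by (induction rule: finite_induct) (auto intro: L_infty_add L_infty_const)

context walk_map
begin

lemma L_infty_T_funpow:
  assumes "F \<in> L_infty"
  shows "(\<lambda>x. F ((T ^^ n) x)) \<in> L_infty"
proof -
  obtain C where C: "F \<in> borel_measurable borel" "AE x in lborel. norm (F x) \<le> C"
    using assms by (auto simp: L_infty_def)
  have "(\<lambda>x. F ((T ^^ n) x)) \<in> borel_measurable borel"
    by (rule measurable_compose[OF T_funpow_measurable C(1)])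
  then show ?thesis using AE_T_funpow[OF C(2)] by (auto simp: L_infty_def)
qed

lemma integral_T_funpow_cong_AE:
  assumes F: "F \<in> borel_measurable borel" "F' \<in> borel_measurable borel" "AE x in lborel. F x = F' x"
    and g: "g \<in> borel_measurable borel"
  shows "(LINT x|lborel. F ((T ^^ n) x) * g x) = (LINT x|lborel. F' ((T ^^ n) x) * (g x :: complex))"
proof (rule integral_cong_AE)
  note [measurable] = measurable_compose[OF T_funpow_measurable F(1)]
    measurable_compose[OF T_funpow_measurable F(2)] g
  show "(\<lambda>x. F ((T ^^ n) x) * g x) \<in> borel_measurable lborel" by measurable
  show "(\<lambda>x. F' ((T ^^ n) x) * g x) \<in> borel_measurable lborel" by measurable
  show "AE x in lborel. F ((T ^^ n) x) * g x = F' ((T ^^ n) x) * g x"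
    using AE_T_funpow[OF F(3), of n] by eventually_elim simp
qed

text \<open>The asymptotic formula with a constant sequence of observables: its comparison term
  carries the factor m(g) = 0.\<close>

lemma integral_T_funpow_tendsto_0:
  assumes F: "F \<in> L_infty" and g: "g \<in> L_one" "(LINT x|lborel. g x) = 0"
  shows "(\<lambda>n. LINT x|lborel. F ((T ^^ n) x) * g x) \<longlonglongrightarrow> 0"
proof -
  obtain F' C where F': "F' \<in> borel_measurable borel" "\<And>x. norm (F' x) \<le> C"
    "AE x in lborel. F x = F' x" using L_infty_bounded_representative[OF F] by blast
  have g': "integrable lborel g" using g by (simp add: L_one_def)
  have "(\<lambda>n. LINT x|lborel. F' ((T ^^ n) x) * g x) \<longlonglongrightarrow> 0"
    using integral_asymptotics[of "\<lambda>_. F'", OF F'(1,2) g'] g(2) by simp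
  then show ?thesis
    using integral_T_funpow_cong_AE[OF L_infty_measurable[OF F] F'(1,3)] g' by simp
qed

text \<open>The asymptotic formula leaves the value at 0 of the iterated cell integrals, and the
  mixture of uniform laws turns convergence of symmetric averages into convergence of these
  values.\<close>

lemma integral_T_funpow_sym_mean:
  assumes F: "F \<in> G_sym" and g: "g \<in> L_one"
  shows "(\<lambda>n. LINT x|lborel. F ((T ^^ n) x) * g x) \<longlonglongrightarrow> sym_mean F * (LINT x|lborel. g x)"
proof -
  have F_inf: "F \<in> L_infty" and conv: "sym_average F \<longlonglongrightarrow> sym_mean F"
    using F by (auto simp: G_sym_def sym_mean_def convergent_LIMSEQ_iff)
  obtain F' C where F': "F' \<in> borel_measurable borel" "\<And>x. norm (F' x) \<le> C"
    "AE x in lborel. F x = F' x" using L_infty_bounded_representative[OF F_inf] by blast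
  have g': "integrable lborel g" using g by (simp add: L_one_def)
  define f where "f = cell_integral F'"
  have f: "norm (f k) \<le> C" for k unfolding f_def by (rule norm_cell_integral_le) (rule F')
  \<comment> \<open>[-a, a] consists of the 2a cells -a, ..., a - 1, while the symmetric index block
    has 2a + 1; the surplus cell is negligible after division.\<close>
  have avg_eq: "(\<Sum>k\<in>{-int a..int a}. f k) /\<^sub>R (2 * real a + 1) = sym_average F a + f (int a) /\<^sub>R (2 * real a + 1)" for a
  proof -
    have "(LINT x:{- real a..real a}|lborel. F x) = (LINT x:{- real a..real a}|lborel. F' x)"
      using F' L_infty_measurable[OF F_inf] by (intro set_lebesgue_integral_cong_AE) auto
    also have "\<dots> = (\<Sum>k\<in>{-int a..<int a}. f k)"
      using set_integral_cells[of "- int a" "int a" F'] set_integrable_bounded[OF F'(1,2)]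
      by (simp add: f_def)
    finally have *: "(LINT x:{- real a..real a}|lborel. F x) = (\<Sum>k\<in>{-int a..<int a}. f k)" .
    have "{-int a..int a} = insert (int a) {-int a..<int a}" by auto
    then have "(\<Sum>k\<in>{-int a..int a}. f k) = (LINT x:{- real a..real a}|lborel. F x) + f (int a)"
      by (simp add: * add.commute)
    then show ?thesis
      by (simp add: sym_average_def scaleR_add_right scaleR_conv_of_real divide_inverse distrib_left)
  qed
  have "(\<lambda>a. f (int a) /\<^sub>R (2 * real a + 1)) \<longlonglongrightarrow> 0"
  proof (rule Lim_null_comparison)
    show "\<forall>\<^sub>F a in sequentially. norm (f (int a) /\<^sub>R (2 * real a + 1)) \<le> C * inverse (real (Suc a))"
    proof (intro always_eventually allI)
      fix a
      have "inverse (2 * real a + 1) \<le> inverse (real (Suc a))" by (intro le_imp_inverse_le) auto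
      then have "inverse (2 * real a + 1) * norm (f (int a)) \<le> inverse (real (Suc a)) * C"
        by (intro mult_mono f) auto
      then show "norm (f (int a) /\<^sub>R (2 * real a + 1)) \<le> C * inverse (real (Suc a))"
        by (simp add: mult.commute)
    qed
    show "(\<lambda>a. C * inverse (real (Suc a))) \<longlonglongrightarrow> 0"
      using tendsto_mult_left[OF LIMSEQ_inverse_real_of_nat, of C] by simp
  qed
  from tendsto_add[OF conv this]
  have "(\<lambda>a. (\<Sum>k\<in>{-int a..int a}. f k) /\<^sub>R (2 * real a + 1)) \<longlonglongrightarrow> sym_mean F"
    unfolding avg_eq by simp
  then have "(\<lambda>n. (avg ^^ n) f 0) \<longlonglongrightarrow> sym_mean F" by (rule avg_funpow_tendsto[OF f])
  then have "(\<lambda>n. ((LINT x|lborel. F' ((T ^^ n) x) * g x) - (avg ^^ n) f 0 * (LINT x|lborel. g x))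
      + (avg ^^ n) f 0 * (LINT x|lborel. g x)) \<longlonglongrightarrow> 0 + sym_mean F * (LINT x|lborel. g x)"
    using integral_asymptotics[of "\<lambda>_. F'", OF F'(1,2) g'] unfolding f_def
    by (intro tendsto_add tendsto_mult_right)
  then show ?thesis
    using integral_T_funpow_cong_AE[OF L_infty_measurable[OF F_inf] F'(1,3)] g' by simp
qed

end

section \<open>The mean, uniform in the centre of the window\<close>

definition window_mean :: "(real \<Rightarrow> complex) \<Rightarrow> real \<Rightarrow> real \<Rightarrow> complex" where
  "window_mean u r x0 = of_real (1 / (2 * r)) * (LINT x:{x0 - r..x0 + r}|lborel. u x)"

lemma has_mean_iff:
  "has_mean u l \<longleftrightarrow> (\<forall>e>0. \<forall>\<^sub>F r in at_top. \<forall>x0. dist (window_mean u r x0) l < e)"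
  unfolding has_mean_def uniform_limit_iff window_mean_def by simp

lemma has_meanD: "has_mean u l \<Longrightarrow> ((\<lambda>r. window_mean u r x0) \<longlongrightarrow> l) at_top"
  unfolding has_mean_iff tendsto_iff by (blast intro: eventually_mono)

lemma has_mean_unique: "has_mean u l \<Longrightarrow> has_mean u l' \<Longrightarrow> l = l'"
  using has_meanD[of u l 0] has_meanD[of u l' 0] tendsto_unique[OF trivial_limit_at_top_linorder]
  by blast

lemma mean_eq: "has_mean u l \<Longrightarrow> mean u = l"
  unfolding mean_def by (rule the_equality) (auto intro: has_mean_unique)

lemma has_mean_mean: "mean_exists u \<Longrightarrow> has_mean u (mean u)"
  unfolding mean_exists_def using mean_eq by auto

lemma window_mean_close:
  assumes uv: "u \<in> L_infty" "v \<in> L_infty" and d: "AE x in lborel. norm (u x - v x) \<le> d" and "r > 0"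
  shows "norm (window_mean u r x0 - window_mean v r x0) \<le> d"
proof -
  let ?I = "{x0 - r..x0 + r}"
  have int: "set_integrable lborel ?I u" "set_integrable lborel ?I v"
    using uv by (auto intro: L_infty_set_integrable)
  have int_diff: "set_integrable lborel ?I (\<lambda>x. u x - v x)" by (rule set_integral_diff(1)[OF int])
  have "(LINT x:?I|lborel. u x) - (LINT x:?I|lborel. v x) = (LINT x:?I|lborel. u x - v x)"
    using int by (simp add: set_integral_diff)
  also have "norm \<dots> \<le> (LINT x:?I|lborel. norm (u x - v x))"
    by (rule set_integral_norm_bound[OF int_diff])
  also have "\<dots> \<le> (LINT x:?I|lborel. d)"
    using d by (intro set_integral_mono_AE set_integrable_norm[OF int_diff]
        borel_integrable_atLeastAtMost') auto
  also have "\<dots> = 2 * r * d" using \<open>r > 0\<close> by (simp add: set_integral_const)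
  finally have "norm ((LINT x:?I|lborel. u x) - (LINT x:?I|lborel. v x)) \<le> 2 * r * d" .
  moreover have "norm (window_mean u r x0 - window_mean v r x0)
      = 1 / (2 * r) * norm ((LINT x:?I|lborel. u x) - (LINT x:?I|lborel. v x))"
    unfolding window_mean_def right_diff_distrib[symmetric] norm_mult
    using \<open>r > 0\<close> by (subst norm_of_real) simp
  ultimately have "norm (window_mean u r x0 - window_mean v r x0) \<le> 1 / (2 * r) * (2 * r * d)"
    using \<open>r > 0\<close> by (simp only:) (intro mult_left_mono, auto)
  then show ?thesis using \<open>r > 0\<close> by simp
qed

lemma mean_close:
  assumes uv: "u \<in> L_infty" "v \<in> L_infty" "AE x in lborel. norm (u x - v x) \<le> d"
    and l: "has_mean u l" "has_mean v l'"
  shows "norm (l - l') \<le> d"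
proof (rule tendsto_upperbound)
  show "((\<lambda>r. norm (window_mean u r 0 - window_mean v r 0)) \<longlongrightarrow> norm (l - l')) at_top"
    by (intro tendsto_norm tendsto_diff has_meanD l)
  show "\<forall>\<^sub>F r in at_top. norm (window_mean u r 0 - window_mean v r 0) \<le> d"
    using eventually_gt_at_top[of 0] by eventually_elim (rule window_mean_close[OF uv])
qed simp

lemma has_mean_const: "has_mean (\<lambda>x. c) c"
  unfolding has_mean_iff
proof (intro allI impI)
  fix e :: real assume "e > 0"
  show "\<forall>\<^sub>F r in at_top. \<forall>x0. dist (window_mean (\<lambda>x. c) r x0) c < e"
    using eventually_gt_at_top[of 0]
    by eventually_elim (use \<open>e > 0\<close> in \<open>auto simp: window_mean_def set_integral_const scaleR_conv_of_real\<close>)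
qed

lemma norm_mean_le:
  assumes "u \<in> L_infty" "AE x in lborel. norm (u x) \<le> d" "has_mean u l"
  shows "norm l \<le> d"
  using mean_close[OF assms(1) L_infty_const[of 0] _ assms(3) has_mean_const[of 0]] assms(2) by simp

lemma has_mean_cong_AE:
  assumes "has_mean v l" "u \<in> borel_measurable borel" "v \<in> borel_measurable borel" "AE x in lborel. u x = v x"
  shows "has_mean u l"
proof -
  have "window_mean u r x0 = window_mean v r x0" for r x0
    unfolding window_mean_def using assms
    by (intro arg_cong2[where f = "(*)"] set_lebesgue_integral_cong_AE refl) auto
  then show ?thesis using assms(1) by (simp add: has_mean_iff)
qed

lemma has_mean_add:
  assumes "u \<in> L_infty" "v \<in> L_infty" "has_mean u l" "has_mean v l'"
  shows "has_mean (\<lambda>x. u x + v x) (l + l')"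
proof -
  have "window_mean (\<lambda>x. u x + v x) r x0 = window_mean u r x0 + window_mean v r x0" for r x0
    unfolding window_mean_def
    using set_integral_add(2)[OF L_infty_set_integrable[OF assms(1)] L_infty_set_integrable[OF assms(2)]]
    by (simp add: distrib_left)
  moreover have "uniform_limit UNIV (\<lambda>r x0. window_mean u r x0 + window_mean v r x0) (\<lambda>_. l + l') at_top"
    using assms(3,4) unfolding has_mean_def window_mean_def by (rule uniform_limit_add)
  ultimately show ?thesis unfolding has_mean_def window_mean_def by simp
qed

lemma has_mean_cmult:
  assumes "has_mean u l"
  shows "has_mean (\<lambda>x. c * u x) (c * l)"
proof -
  have "window_mean (\<lambda>x. c * u x) r x0 = c * window_mean u r x0" for r x0
    by (simp add: window_mean_def)
  moreover have "uniform_limit UNIV (\<lambda>r x0. c * window_mean u r x0) (\<lambda>_. c * l) at_top"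
    using assms unfolding has_mean_def window_mean_def
    by (rule bounded_linear.uniform_limit[OF bounded_linear_mult_right])
  ultimately show ?thesis unfolding has_mean_def window_mean_def by simp
qed

lemma has_mean_sum:
  assumes "finite I" "\<And>i. i \<in> I \<Longrightarrow> u i \<in> L_infty" "\<And>i. i \<in> I \<Longrightarrow> has_mean (u i) (l i)"
  shows "has_mean (\<lambda>x. \<Sum>i\<in>I. c i * u i x) (\<Sum>i\<in>I. c i * l i)"
  using assms
proof (induction rule: finite_induct)
  case (insert i I)
  then show ?case
    by (simp, intro has_mean_add has_mean_cmult L_infty_mult L_infty_sum L_infty_const) auto
qed (simp add: has_mean_const)

text \<open>Since the mean is a contraction for the sup norm, the means of the approximants form a
  Cauchy sequence; uniformity in the centre survives because the approximation error is the same for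
  every window.\<close>

lemma mean_exists_approx:
  assumes u: "u \<in> L_infty"
    and approx: "\<And>e. e > 0 \<Longrightarrow> \<exists>v\<in>L_infty. mean_exists v \<and> (AE x in lborel. norm (u x - v x) \<le> e)"
  shows "mean_exists u"
proof -
  have "\<forall>m. \<exists>v\<in>L_infty. mean_exists v \<and> (AE x in lborel. norm (u x - v x) \<le> inverse (real (Suc m)))"
    by (intro allI approx) simp
  then obtain v where v: "\<And>m. v m \<in> L_infty" "\<And>m. mean_exists (v m)"
    "\<And>m. AE x in lborel. norm (u x - v m x) \<le> inverse (real (Suc m))" by metis
  define l where "l m = mean (v m)" for m
  have l: "has_mean (v m) (l m)" for m unfolding l_def by (rule has_mean_mean[OF v(2)])
  have close: "norm (l m - l p) \<le> inverse (real (Suc m)) + inverse (real (Suc p))" for m p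
  proof (rule mean_close[OF v(1) v(1) _ l l])
    show "AE x in lborel. norm (v m x - v p x) \<le> inverse (real (Suc m)) + inverse (real (Suc p))"
      using v(3)[of m] v(3)[of p]
    proof eventually_elim
      case (elim x)
      have "v m x - v p x = (u x - v p x) - (u x - v m x)" by simp
      also have "norm \<dots> \<le> norm (u x - v p x) + norm (u x - v m x)" by (rule norm_triangle_ineq4)
      finally show ?case using elim by linarith
    qed
  qed
  have small: "\<exists>m0. \<forall>m\<ge>m0. inverse (real (Suc m)) < e" if "e > 0" for e :: real
    using order_tendstoD(2)[OF LIMSEQ_inverse_real_of_nat that] by (simp add: eventually_sequentially)
  have "Cauchy l"
    unfolding Cauchy_iff
  proof (intro allI impI)
    fix e :: real assume "e > 0"
    then obtain m0 where m0: "\<forall>m\<ge>m0. inverse (real (Suc m)) < e / 2" using small[of "e/2"] by auto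
    have "norm (l m - l p) < e" if "m \<ge> m0" "p \<ge> m0" for m p
      using close[of m p] m0[rule_format, OF that(1)] m0[rule_format, OF that(2)] by linarith
    then show "\<exists>M. \<forall>m\<ge>M. \<forall>n\<ge>M. norm (l m - l n) < e" by blast
  qed
  then obtain l' where l': "l \<longlonglongrightarrow> l'" using Cauchy_convergent convergent_def by blast
  have "has_mean u l'"
    unfolding has_mean_iff
  proof (intro allI impI)
    fix e :: real assume "e > 0"
    obtain m0 where m0: "\<forall>m\<ge>m0. inverse (real (Suc m)) < e / 3" using small[of "e/3"] \<open>e > 0\<close> by auto
    obtain m1 where m1: "\<forall>m\<ge>m1. norm (l m - l') < e / 3" using LIMSEQ_D[OF l', of "e/3"] \<open>e > 0\<close> by auto
    define m where "m = max m0 m1"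
    have m: "inverse (real (Suc m)) < e / 3" "norm (l m - l') < e / 3"
      using m0 m1 by (auto simp: m_def simp del: of_nat_Suc)
    have "\<forall>\<^sub>F r in at_top. \<forall>x0. dist (window_mean (v m) r x0) (l m) < e / 3"
      using l[of m] \<open>e > 0\<close> unfolding has_mean_iff by (metis divide_pos_pos zero_less_numeral)
    then show "\<forall>\<^sub>F r in at_top. \<forall>x0. dist (window_mean u r x0) l' < e"
      using eventually_gt_at_top[of 0]
    proof eventually_elim
      case (elim r)
      show ?case
      proof
        fix x0
        have "norm (window_mean u r x0 - window_mean (v m) r x0) < e / 3"
          using window_mean_close[OF u v(1) v(3) elim(2)] m(1) by (rule order_le_less_trans)
        moreover have "norm (window_mean (v m) r x0 - l m) < e / 3" using elim(1) by (simp add: dist_norm)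
        ultimately have "norm ((window_mean u r x0 - window_mean (v m) r x0)
            + (window_mean (v m) r x0 - l m) + (l m - l')) < e / 3 + e / 3 + e / 3"
          using m(2) by (intro norm_add_less)
        then show "dist (window_mean u r x0) l' < e" by (simp add: dist_norm)
      qed
    qed
  qed
  then show ?thesis by (auto simp: mean_exists_def)
qed

lemma norm_set_integral_Icc_le:
  fixes u :: "real \<Rightarrow> complex"
  assumes "u \<in> borel_measurable borel" "\<And>x. norm (u x) \<le> C" "a \<le> b"
  shows "norm (LINT x:{a..b}|lborel. u x) \<le> C * (b - a)"
proof -
  have int: "set_integrable lborel {a..b} u" by (rule set_integrable_bounded[OF assms(1,2)])
  have "norm (LINT x:{a..b}|lborel. u x) \<le> (LINT x:{a..b}|lborel. norm (u x))"
    by (rule set_integral_norm_bound[OF int])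
  also have "\<dots> \<le> (LINT x:{a..b}|lborel. C)"
    using assms by (intro set_integral_mono set_integrable_norm int borel_integrable_atLeastAtMost') auto
  also have "\<dots> = C * (b - a)" using assms(3) by (simp add: set_integral_const)
  finally show ?thesis .
qed

text \<open>A window is a block of cells up to two end pieces of length at most 1, so a bounded
  deviation on blocks becomes a deviation O(1/r) of the average, uniformly in the centre.\<close>

lemma has_mean_cells:
  assumes u: "u \<in> borel_measurable borel" "\<And>x. norm (u x) \<le> C"
    and cells: "\<And>a b. a \<le> b \<Longrightarrow> norm ((\<Sum>k\<in>{a..<b}. cell_integral u k) - of_int (b - a) * l) \<le> K"
  shows "has_mean u l"
proof -
  have C: "C \<ge> 0" using order_trans[OF norm_ge_zero u(2)] .
  have dev: "norm ((LINT x:{a..b}|lborel. u x) - of_real (b - a) * l) \<le> K + 2 * C + norm l" if ab: "a \<le> b" for a b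
  proof -
    define m n where "m = \<lfloor>a\<rfloor>" and "n = \<lfloor>b\<rfloor>"
    have mn: "of_int m \<le> a" "a \<le> of_int m + 1" "of_int n \<le> b" "b \<le> of_int n + 1" "m \<le> n"
      using ab by (auto simp: m_def n_def floor_mono less_imp_le)
    have int: "set_integrable lborel {x..y} u" for x y by (rule set_integrable_bounded[OF u])
    have "(LINT x:{of_int m..b}|lborel. u x) = (LINT x:{of_int m..a}|lborel. u x) + (LINT x:{a..b}|lborel. u x)"
      using mn ab by (intro set_integral_Icc_split int)
    moreover have "(LINT x:{of_int m..b}|lborel. u x) = (LINT x:{of_int m..of_int n}|lborel. u x) + (LINT x:{of_int n..b}|lborel. u x)"
      using mn by (intro set_integral_Icc_split int) auto
    moreover have "(LINT x:{of_int m..of_int n}|lborel. u x) = (\<Sum>k\<in>{m..<n}. cell_integral u k)"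
      using mn by (intro set_integral_cells int)
    ultimately have "(LINT x:{a..b}|lborel. u x) - of_real (b - a) * l
        = ((\<Sum>k\<in>{m..<n}. cell_integral u k) - of_int (n - m) * l)
          + ((LINT x:{of_int n..b}|lborel. u x) - (LINT x:{of_int m..a}|lborel. u x))
          + of_real ((a - of_int m) - (b - of_int n)) * l"
      by (simp add: algebra_simps)
    also have "norm \<dots> \<le> K + (C + C) + norm l"
    proof (intro norm_triangle_mono)
      show "norm ((\<Sum>k\<in>{m..<n}. cell_integral u k) - of_int (n - m) * l) \<le> K" using mn by (intro cells)
      have "C * (b - of_int n) \<le> C * 1" "C * (a - of_int m) \<le> C * 1"
        using mn C by (intro mult_left_mono; simp)+
      then have "norm (LINT x:{of_int n..b}|lborel. u x) \<le> C" "norm (LINT x:{of_int m..a}|lborel. u x) \<le> C"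
        using norm_set_integral_Icc_le[OF u mn(3)] norm_set_integral_Icc_le[OF u mn(1)] by linarith+
      then show "norm ((LINT x:{of_int n..b}|lborel. u x) - (LINT x:{of_int m..a}|lborel. u x)) \<le> C + C"
        by (intro order_trans[OF norm_triangle_ineq4] add_mono)
      have "\<bar>(a - of_int m) - (b - of_int n)\<bar> \<le> 1" using mn by linarith
      then have "\<bar>(a - of_int m) - (b - of_int n)\<bar> * norm l \<le> 1 * norm l" by (rule mult_right_mono) simp
      then show "norm (of_real ((a - of_int m) - (b - of_int n)) * l) \<le> norm l"
        by (simp only: norm_mult norm_of_real mult_1)
    qed
    finally show ?thesis by simp
  qed
  define K' where "K' = K + 2 * C + norm l"
  show ?thesis
    unfolding has_mean_iff
  proof (intro allI impI)
    fix e :: real assume "e > 0"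
    show "\<forall>\<^sub>F r in at_top. \<forall>x0. dist (window_mean u r x0) l < e"
      using eventually_gt_at_top[of 0] eventually_gt_at_top[of "K' / (2 * e)"]
    proof eventually_elim
      case (elim r)
      show ?case
      proof
        fix x0
        have "window_mean u r x0 - l = of_real (1 / (2 * r)) *
            ((LINT x:{x0 - r..x0 + r}|lborel. u x) - of_real (x0 + r - (x0 - r)) * l)"
          using elim(1) by (simp add: window_mean_def right_diff_distrib)
        also have "norm \<dots> = 1 / (2 * r) *
            norm ((LINT x:{x0 - r..x0 + r}|lborel. u x) - of_real (x0 + r - (x0 - r)) * l)"
          unfolding norm_mult using elim(1) by (subst norm_of_real) simp
        also have "\<dots> \<le> 1 / (2 * r) * K'"
          unfolding K'_def using elim(1) by (intro mult_left_mono dev) auto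
        also have "\<dots> < e" using elim \<open>e > 0\<close> by (simp add: field_simps)
        finally show "dist (window_mean u r x0) l < e" by (simp add: dist_norm)
      qed
    qed
  qed
qed

section \<open>Characters of the integers\<close>

text \<open>The condition \<open>twist \<theta> 1 = 1\<close> stands for \<theta> being a multiple
  of 2 pi throughout.\<close>

definition twist :: "real \<Rightarrow> int \<Rightarrow> complex" where
  "twist \<theta> k = exp (\<i> * of_real \<theta> * of_int k)"

lemma twist_add: "twist \<theta> (k + l) = twist \<theta> k * twist \<theta> l"
  by (simp add: twist_def exp_add distrib_left)

lemma twist_0 [simp]: "twist \<theta> 0 = 1"
  by (simp add: twist_def)

lemma norm_twist [simp]: "norm (twist \<theta> k) = 1"
  by (simp add: twist_def)

lemma twist_theta_add: "twist (\<alpha> + \<beta>) k = twist \<alpha> k * twist \<beta> k"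
  by (simp add: twist_def exp_add algebra_simps)

lemma twist_1: "twist \<theta> 1 = exp (\<i> * of_real \<theta>)"
  by (simp add: twist_def)

lemma twist_trivial: "twist \<theta> 1 = 1 \<Longrightarrow> twist \<theta> k = 1"
proof (induction k rule: int_induct[where k = 0])
  case (step2 i)
  have "twist \<theta> i = twist \<theta> (i - 1) * twist \<theta> 1" using twist_add[of \<theta> "i - 1" 1] by simp
  with step2 show ?case by simp
qed (simp_all add: twist_add)

lemma twist_minus: "twist \<theta> (- k) * twist \<theta> k = 1"
  using twist_add[of \<theta> "- k" k] by simp

text \<open>Multiplication by \<open>twist \<theta> 1 - 1\<close> telescopes the geometric sum, so
  the bound does not depend on the block.\<close>

lemma twist_sum_bounded:
  assumes "twist \<theta> 1 \<noteq> 1" "a \<le> b"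
  shows "norm (\<Sum>k\<in>{a..<b}. twist \<theta> k) \<le> 2 / norm (twist \<theta> 1 - 1)"
proof -
  have "(twist \<theta> 1 - 1) * (\<Sum>k\<in>{a..<b}. twist \<theta> k) = twist \<theta> b - twist \<theta> a"
    using assms(2)
  proof (induction b rule: int_ge_induct)
    case (step i)
    have "{a..<i + 1} = insert i {a..<i}" using step.hyps by auto
    then show ?case using step.IH by (simp add: twist_add algebra_simps)
  qed simp
  then have "norm (twist \<theta> 1 - 1) * norm (\<Sum>k\<in>{a..<b}. twist \<theta> k) \<le> 2"
    using norm_triangle_ineq4[of "twist \<theta> b" "twist \<theta> a"] by (simp add: norm_mult[symmetric])
  then show ?thesis using assms(1) by (simp add: field_simps)
qed

text \<open>Finitely many cells near 0 are unconstrained and add a bounded error; beyond them the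
  block sums are either exactly linear or bounded geometric sums.\<close>

lemma has_mean_twisted_cells:
  assumes u: "u \<in> borel_measurable borel" "\<And>x. norm (u x) \<le> C"
    and cells: "\<And>k. \<bar>k\<bar> \<ge> R \<Longrightarrow> cell_integral u k = twist \<theta> k * \<kappa>"
  shows "has_mean u (if twist \<theta> 1 = 1 then \<kappa> else 0)"
proof (rule has_mean_cells[OF u])
  fix a b :: int assume ab: "a \<le> b"
  define l where "l = (if twist \<theta> 1 = 1 then \<kappa> else 0)"
  define d where "d k = cell_integral u k - twist \<theta> k * \<kappa>" for k
  have "norm (\<Sum>k\<in>{a..<b}. d k) \<le> (\<Sum>k\<in>{a..<b}. norm (d k))" by (rule norm_sum)
  also have "\<dots> = (\<Sum>k\<in>{a..<b} \<inter> {-R..R}. norm (d k))"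
  proof (rule sum.mono_neutral_right)
    show "\<forall>i\<in>{a..<b} - {a..<b} \<inter> {- R..R}. norm (d i) = 0"
    proof
      fix i assume "i \<in> {a..<b} - {a..<b} \<inter> {- R..R}"
      then have "\<not> (- R \<le> i \<and> i \<le> R)" by simp
      then have "\<bar>i\<bar> \<ge> R" by linarith
      then show "norm (d i) = 0" using cells by (simp add: d_def)
    qed
  qed auto
  also have "\<dots> \<le> (\<Sum>k\<in>{-R..R}. norm (d k))" by (rule sum_mono2) auto
  finally have d: "norm (\<Sum>k\<in>{a..<b}. d k) \<le> (\<Sum>k\<in>{-R..R}. norm (d k))" .
  \<comment> \<open>For a trivial character the left-hand side is 0, and so is the bound, since
    division by 0 gives 0.\<close>
  have geo: "norm ((\<Sum>k\<in>{a..<b}. twist \<theta> k * \<kappa>) - of_int (b - a) * l) \<le> 2 / norm (twist \<theta> 1 - 1) * norm \<kappa>"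
  proof (cases "twist \<theta> 1 = 1")
    case True
    then show ?thesis using ab by (simp add: l_def twist_trivial)
  next
    case False
    then show ?thesis
      using mult_right_mono[OF twist_sum_bounded[OF False ab] norm_ge_zero[of \<kappa>]]
      by (simp add: l_def sum_distrib_right[symmetric] norm_mult)
  qed
  have "(\<Sum>k\<in>{a..<b}. cell_integral u k) - of_int (b - a) * l
      = (\<Sum>k\<in>{a..<b}. d k) + ((\<Sum>k\<in>{a..<b}. twist \<theta> k * \<kappa>) - of_int (b - a) * l)"
    by (simp add: d_def sum_subtractf)
  also have "norm \<dots> \<le> (\<Sum>k\<in>{-R..R}. norm (d k)) + 2 / norm (twist \<theta> 1 - 1) * norm \<kappa>"
    by (rule norm_triangle_mono[OF d geo])
  finally show "norm ((\<Sum>k\<in>{a..<b}. cell_integral u k) - of_int (b - a) * (if twist \<theta> 1 = 1 then \<kappa> else 0))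
      \<le> (\<Sum>k\<in>{-R..R}. norm (cell_integral u k - twist \<theta> k * \<kappa>)) + 2 / norm (twist \<theta> 1 - 1) * norm \<kappa>"
    by (simp add: l_def d_def)
qed

section \<open>Quasi-periodic observables\<close>

lemma AE_lborel_shift:
  assumes "AE x in lborel. P x"
  shows "AE x in lborel. P (x + t :: real)"
proof -
  have "AE x in distr lborel borel ((+) t). P x" using assms by (subst lborel_distr_plus)
  then have "AE x in lborel. P (t + x)" by (rule AE_distrD[rotated]) simp
  then show ?thesis by (simp add: add.commute)
qed

text \<open>The a.e. relation becomes exact by extending a bounded representative from [0, 1) by the
  character. Countability of the integers makes all shifted relations hold simultaneously almost
  everywhere.\<close>

lemma quasi_periodic_representative:
  assumes "F \<in> quasi_periodic"
  obtains F' C \<beta> where "F' \<in> borel_measurable borel" "\<And>x. norm (F' x) \<le> C"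
    "AE x in lborel. F x = F' x" "\<And>x k. F' (x + of_int k) = twist \<beta> k * F' x"
proof -
  obtain \<beta> where F: "F \<in> L_infty" and per: "AE x in lborel. F (x + 1) = twist \<beta> 1 * F x"
    using assms by (auto simp: quasi_periodic_def twist_1)
  obtain F1 C where F1: "F1 \<in> borel_measurable borel" "\<And>x. norm (F1 x) \<le> C" "AE x in lborel. F x = F1 x"
    using L_infty_bounded_representative[OF F] by blast
  define F' where "F' x = twist \<beta> \<lfloor>x\<rfloor> * F1 (x - of_int \<lfloor>x\<rfloor>)" for x
  note F1(1)[measurable]
  show ?thesis
  proof (rule that)
    have "(\<lambda>x::real. twist \<beta> \<lfloor>x\<rfloor>) \<in> borel_measurable borel"
      by (rule measurable_compose[OF measurable_real_floor]) simp
    then show "F' \<in> borel_measurable borel"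
      unfolding F'_def[abs_def]
      by (intro borel_measurable_times measurable_compose[OF borel_measurable_diff F1(1)]
          borel_measurable_real_floor) auto
    show "norm (F' x) \<le> C" for x by (simp add: F'_def norm_mult F1)
    show "F' (x + of_int k) = twist \<beta> k * F' x" for x k
      by (simp add: F'_def twist_add mult_ac)
    have "AE x in lborel. \<forall>k::int. F (x + of_int k + 1) = twist \<beta> 1 * F (x + of_int k)"
      unfolding AE_all_countable by (intro allI AE_lborel_shift[OF per])
    moreover have "AE x in lborel. \<forall>k::int. F (x + of_int k) = F1 (x + of_int k)"
      unfolding AE_all_countable by (intro allI AE_lborel_shift[OF F1(3)])
    ultimately show "AE x in lborel. F x = F' x"
    proof eventually_elim
      case (elim x)
      have "F (x + of_int k) = twist \<beta> k * F x" for k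
      proof (induction k rule: int_induct[where k = 0])
        case (step1 i)
        then show ?case using elim(1)[rule_format, of i] by (simp add: twist_add add.assoc)
      next
        case (step2 i)
        have "twist \<beta> 1 * F (x + of_int (i - 1)) = twist \<beta> i * F x"
          using elim(1)[rule_format, of "i - 1"] step2 by simp
        also have "twist \<beta> i = twist \<beta> 1 * twist \<beta> (i - 1)" using twist_add[of \<beta> 1 "i - 1"] by simp
        finally have "twist \<beta> 1 * F (x + of_int (i - 1)) = twist \<beta> 1 * (twist \<beta> (i - 1) * F x)"
          by (simp add: mult.assoc)
        moreover have "twist \<beta> 1 \<noteq> 0" by (simp add: twist_def)
        ultimately show ?case by (simp only: mult_cancel_left simp_thms)
      qed simp
      from this[of "- \<lfloor>x\<rfloor>"] have "F1 (x - of_int \<lfloor>x\<rfloor>) = twist \<beta> (- \<lfloor>x\<rfloor>) * F x"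
        using elim(2)[rule_format, of "- \<lfloor>x\<rfloor>"] by simp
      then have "F' x = (twist \<beta> (- \<lfloor>x\<rfloor>) * twist \<beta> \<lfloor>x\<rfloor>) * F x"
        by (simp only: F'_def mult_ac)
      then show ?case by (simp only: twist_minus mult_1_left)
    qed
  qed
qed

lemma cell_integral_shift:
  fixes u :: "real \<Rightarrow> 'a::{banach, second_countable_topology}"
  shows "cell_integral u (j + d) = cell_integral (\<lambda>x. u (x + of_int d)) j"
proof -
  have "indicator {of_int (j + d)..of_int (j + d) + 1} (of_int d + x) = (indicator {of_int j..of_int j + 1} x :: real)" for x :: real
    by (auto simp: indicator_def)
  then show ?thesis
    using lborel_integral_real_affine[of 1 "\<lambda>x. indicator {of_int (j + d)..of_int (j + d) + 1} x *\<^sub>R u x" "of_int d"]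
    by (simp add: cell_integral_def set_lebesgue_integral_def add.commute)
qed

text \<open>Far rows have the same partial sums, so the branches commute with integer translations;
  \<open>j\<close> and \<open>j + d\<close> may lie on opposite sides of 0.\<close>

lemma inv_branch_shift:
  assumes "\<bar>j\<bar> \<ge> 2" "\<bar>j + d\<bar> \<ge> 2"
  shows "inv_branch (j + d) (k + d) (y + of_int d) = inv_branch j k y + of_int d"
proof -
  have "(\<Sum>i\<in>{j + d - 2..k + d - 1}. walkQ (j + d) i) = (\<Sum>i\<in>{j - 2..k - 1}. walkQ j i)"
    by (rule sum.reindex_bij_witness[of _ "\<lambda>i. i + d" "\<lambda>i. i - d"])
       (auto simp: walkQ_shift[OF assms, of "_ - d", simplified])
  then show ?thesis
    by (simp add: inv_branch_def branch_start_def walkQ_shift[OF assms])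
qed

text \<open>The far rows being a convolution square, the eigenvalue is a square: with w =
  \<open>twist \<beta> 1\<close>, the sum 1 + w + 1/w is 1 + 2 cos \<beta>. Only values within
  distance 2 of \<open>k\<close> enter, so this remains usable for sequences that have the exact
  form only far from 0.\<close>

lemma avg_twist:
  fixes f :: "int \<Rightarrow> complex"
  assumes "\<bar>k\<bar> \<ge> 2" "\<And>l. \<bar>l - k\<bar> \<le> 2 \<Longrightarrow> f l = twist \<beta> l * c"
  shows "avg f k = ((1 + 2 * cos \<beta>) / 3)\<^sup>2 *\<^sub>R (twist \<beta> k * c)"
proof -
  define w w' where "w = twist \<beta> 1" and "w' = twist \<beta> (- 1)"
  have ww': "w' * w = 1" unfolding w_def w'_def by (rule twist_minus)
  have sum: "w + w' = 2 * complex_of_real (cos \<beta>)"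
    by (simp add: w_def w'_def twist_def complex_eq_iff Re_exp Im_exp)
  have tw: "twist \<beta> (k + 1) = twist \<beta> k * w" "twist \<beta> (k + 2) = twist \<beta> k * w\<^sup>2"
    "twist \<beta> (k - 1) = twist \<beta> k * w'" "twist \<beta> (k - 2) = twist \<beta> k * w'\<^sup>2"
    using twist_add[of \<beta> k 1] twist_add[of \<beta> k "1 + 1"] twist_add[of \<beta> k "- 1"]
      twist_add[of \<beta> k "- 1 + - 1"] twist_add[of \<beta> 1 1] twist_add[of \<beta> "- 1" "- 1"]
    by (simp_all add: w_def w'_def power2_eq_square)
  have "complex_of_real (((1 + 2 * cos \<beta>) / 3)\<^sup>2) = ((1 + (w + w')) / 3)\<^sup>2"
    by (simp add: sum)
  also have "\<dots> = (1 + 2 * (w' * w) + w\<^sup>2 + w'\<^sup>2 + 2 * w + 2 * w') / 9"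
    by (simp add: power2_eq_square field_simps)
  also have "\<dots> = w'\<^sup>2 / 9 + 2 * w' / 9 + 3 / 9 + 2 * w / 9 + w\<^sup>2 / 9"
    by (simp add: ww' field_simps)
  finally have eigen: "complex_of_real (((1 + 2 * cos \<beta>) / 3)\<^sup>2)
      = w'\<^sup>2 / 9 + 2 * w' / 9 + 3 / 9 + 2 * w / 9 + w\<^sup>2 / 9" .
  have "avg f k = (1/9) *\<^sub>R (twist \<beta> (k - 2) * c) + (2/9) *\<^sub>R (twist \<beta> (k - 1) * c) + (3/9) *\<^sub>R (twist \<beta> k * c)
      + (2/9) *\<^sub>R (twist \<beta> (k + 1) * c) + (1/9) *\<^sub>R (twist \<beta> (k + 2) * c)"
    using assms(2) by (simp add: avg_ge_2[OF assms(1)])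
  also have "\<dots> = (w'\<^sup>2 / 9 + 2 * w' / 9 + 3 / 9 + 2 * w / 9 + w\<^sup>2 / 9) * (twist \<beta> k * c)"
    by (simp only: tw) (simp add: scaleR_conv_of_real field_simps)
  also have "\<dots> = ((1 + 2 * cos \<beta>) / 3)\<^sup>2 *\<^sub>R (twist \<beta> k * c)"
    unfolding eigen[symmetric] by (simp add: scaleR_conv_of_real)
  finally show ?thesis .
qed

text \<open>The distance 2b + 2 keeps every state within b steps of \<open>k\<close> at distance at
  least 2 from 0.\<close>

lemma avg_funpow_twist:
  fixes f :: "int \<Rightarrow> complex"
  assumes "\<And>l. f l = twist \<beta> l * c" "\<bar>k\<bar> \<ge> 2 * int b + 2"
  shows "(avg ^^ b) f k = (((1 + 2 * cos \<beta>) / 3)\<^sup>2) ^ b *\<^sub>R (twist \<beta> k * c)"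
  using assms(2)
proof (induction b arbitrary: k)
  case (Suc b)
  have "avg ((avg ^^ b) f) k = ((1 + 2 * cos \<beta>) / 3)\<^sup>2 *\<^sub>R
      (twist \<beta> k * ((((1 + 2 * cos \<beta>) / 3)\<^sup>2) ^ b *\<^sub>R c))"
    using Suc.prems by (intro avg_twist) (auto simp: Suc.IH)
  then show ?case by simp
qed (simp add: assms(1))

text \<open>As 1 + 2 cos \<beta> \<ge> -1, the quotient cannot approach -1; modulus 1 occurs only
  for cos \<beta> = 1.\<close>

lemma walk_symbol_less_1:
  assumes "twist \<beta> 1 \<noteq> 1"
  shows "((1 + 2 * cos \<beta>) / 3)\<^sup>2 < 1"
proof -
  have "cos \<beta> \<noteq> 1"
  proof
    assume "cos \<beta> = 1"
    moreover from this have "sin \<beta> = 0" using sin_cos_squared_add[of \<beta>] by simp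
    ultimately have "twist \<beta> 1 = 1" by (simp add: twist_def complex_eq_iff Re_exp Im_exp)
    with assms show False by simp
  qed
  then have "cos \<beta> < 1" by (simp add: less_le)
  moreover have "\<bar>(1 + 2 * c) / 3\<bar> < 1" if "c < 1" "- 1 \<le> c" for c :: real
    using that by (simp add: abs_less_iff)
  ultimately have "\<bar>(1 + 2 * cos \<beta>) / 3\<bar> < 1" by simp
  then show ?thesis by (simp add: abs_square_less_1)
qed

context walk_map
begin

text \<open>Within n steps from distance 2n + 2 only translation-invariant rows are met. Each step
  of the induction pulls \<open>g\<close> back through a branch, so the claim is made for an
  arbitrary density and its translate.\<close>

lemma cell_integral_twisted_shift:
  fixes F g :: "real \<Rightarrow> complex"
  assumes F: "F \<in> borel_measurable borel" "\<And>x. norm (F x) \<le> C"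
    and per: "\<And>x k. F (x + of_int k) = twist \<beta> k * F x"
    and g: "g \<in> borel_measurable borel" "\<And>x. norm (g x) \<le> D"
    and j: "\<bar>j\<bar> \<ge> 2 * int n + 2" "\<bar>j + d\<bar> \<ge> 2 * int n + 2"
  shows "cell_integral (\<lambda>x. F ((T ^^ n) x) * g (x - of_int d)) (j + d)
    = twist \<beta> d * cell_integral (\<lambda>x. F ((T ^^ n) x) * g x) j"
  using g j
proof (induction n arbitrary: g j)
  case 0
  show ?case
    by (simp add: cell_integral_shift per mult.assoc) (simp add: cell_integral_def)
next
  case (Suc n)
  note [measurable] = Suc.prems(1)
  have H_meas: "(\<lambda>x. F ((T ^^ n) x)) \<in> borel_measurable borel"
    by (rule measurable_compose[OF T_funpow_measurable F(1)])
  have far: "\<bar>j\<bar> \<ge> 2" "\<bar>j + d\<bar> \<ge> 2" using Suc.prems by auto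
  define G where "G k y = g (inv_branch j k y)" for k y
  have G_meas: "G k \<in> borel_measurable borel" for k unfolding G_def[abs_def] by measurable
  have g_shift: "(\<lambda>x. g (x - of_int d)) \<in> borel_measurable borel" by measurable
  have "cell_integral (\<lambda>x. F ((T ^^ n) (T x)) * g (x - of_int d)) (j + d)
      = (\<Sum>k\<in>{j + d - 2..j + d + 2}. walkQ (j + d) k *\<^sub>R
          cell_integral (\<lambda>y. F ((T ^^ n) y) * g (inv_branch (j + d) k y - of_int d)) k)"
    by (rule cell_integral_T_mult[OF H_meas F(2) set_integrable_bounded[OF g_shift Suc.prems(2)] g_shift])
  also have "\<dots> = (\<Sum>k\<in>{j - 2..j + 2}. walkQ (j + d) (k + d) *\<^sub>R
          cell_integral (\<lambda>y. F ((T ^^ n) y) * g (inv_branch (j + d) (k + d) y - of_int d)) (k + d))"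
    by (rule sum.reindex_bij_witness[of _ "\<lambda>k. k + d" "\<lambda>k. k - d"]) auto
  also have "\<dots> = (\<Sum>k\<in>{j - 2..j + 2}. walkQ j k *\<^sub>R
          (twist \<beta> d * cell_integral (\<lambda>y. F ((T ^^ n) y) * G k y) k))"
  proof (rule sum.cong[OF refl])
    fix k assume k: "k \<in> {j - 2..j + 2}"
    have "inv_branch (j + d) (k + d) y - of_int d = inv_branch j k (y - of_int d)" for y
      using inv_branch_shift[OF far, of k "y - of_int d"] by simp
    then have "cell_integral (\<lambda>y. F ((T ^^ n) y) * g (inv_branch (j + d) (k + d) y - of_int d)) (k + d)
        = cell_integral (\<lambda>y. F ((T ^^ n) y) * G k (y - of_int d)) (k + d)"
      by (simp add: G_def)
    also have "\<dots> = twist \<beta> d * cell_integral (\<lambda>y. F ((T ^^ n) y) * G k y) k"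
      using k Suc.prems by (intro Suc.IH G_meas) (auto simp: G_def)
    finally show "walkQ (j + d) (k + d) *\<^sub>R
          cell_integral (\<lambda>y. F ((T ^^ n) y) * g (inv_branch (j + d) (k + d) y - of_int d)) (k + d)
        = walkQ j k *\<^sub>R (twist \<beta> d * cell_integral (\<lambda>y. F ((T ^^ n) y) * G k y) k)"
      by (simp add: walkQ_shift[OF far])
  qed
  also have "\<dots> = twist \<beta> d * (\<Sum>k\<in>{j - 2..j + 2}. walkQ j k *\<^sub>R
      cell_integral (\<lambda>y. F ((T ^^ n) y) * G k y) k)"
    by (simp add: sum_distrib_left)
  also have "(\<Sum>k\<in>{j - 2..j + 2}. walkQ j k *\<^sub>R cell_integral (\<lambda>y. F ((T ^^ n) y) * G k y) k)
      = cell_integral (\<lambda>x. F ((T ^^ n) (T x)) * g x) j"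
    unfolding G_def
    by (rule cell_integral_T_mult[OF H_meas F(2) set_integrable_bounded[OF Suc.prems(1,2)] Suc.prems(1), symmetric])
  finally show ?case by (simp add: funpow_swap1)
qed

end

section \<open>Mixing of pairs of global observables\<close>

context walk_map
begin

text \<open>Existence of the means is bundled with the convergence because both must pass through
  bilinear combinations and uniform limits.\<close>

definition pair_mixing :: "(real \<Rightarrow> complex) \<Rightarrow> (real \<Rightarrow> complex) \<Rightarrow> bool" where
  "pair_mixing F G \<longleftrightarrow> mean_exists F \<and> mean_exists G \<and>
     (\<forall>n. mean_exists (\<lambda>x. F ((T ^^ n) x) * G x)) \<and>
     (\<lambda>n. mean (\<lambda>x. F ((T ^^ n) x) * G x)) \<longlonglongrightarrow> mean F * mean G"

lemma pair_mixingI: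
  assumes "has_mean F l" "has_mean G l'" "\<And>n. has_mean (\<lambda>x. F ((T ^^ n) x) * G x) (b n)"
    "b \<longlonglongrightarrow> l * l'"
  shows "pair_mixing F G"
  unfolding pair_mixing_def mean_exists_def mean_eq[OF assms(1)] mean_eq[OF assms(2)] mean_eq[OF assms(3)]
  using assms by blast

lemma pair_mixing_cong_AE:
  assumes "pair_mixing F' G'" and F: "F \<in> L_infty" "F' \<in> L_infty" "AE x in lborel. F x = F' x"
    and G: "G \<in> L_infty" "G' \<in> L_infty" "AE x in lborel. G x = G' x"
  shows "pair_mixing F G"
proof (rule pair_mixingI)
  show "has_mean F (mean F')" "has_mean G (mean G')"
    using assms L_infty_measurable unfolding pair_mixing_def
    by (auto intro!: has_mean_cong_AE[OF has_mean_mean])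
  show "has_mean (\<lambda>x. F ((T ^^ n) x) * G x) (mean (\<lambda>x. F' ((T ^^ n) x) * G' x))" for n
  proof (rule has_mean_cong_AE)
    show "has_mean (\<lambda>x. F' ((T ^^ n) x) * G' x) (mean (\<lambda>x. F' ((T ^^ n) x) * G' x))"
      using assms(1) by (intro has_mean_mean) (simp add: pair_mixing_def)
    show "AE x in lborel. F ((T ^^ n) x) * G x = F' ((T ^^ n) x) * G' x"
      using AE_T_funpow[OF F(3), of n] G(3) by eventually_elim simp
  qed (use F G in \<open>auto intro!: L_infty_measurable L_infty_mult L_infty_T_funpow\<close>)
  show "(\<lambda>n. mean (\<lambda>x. F' ((T ^^ n) x) * G' x)) \<longlonglongrightarrow> mean F' * mean G'"
    using assms(1) by (simp add: pair_mixing_def)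
qed

text \<open>Cell integrals of the product are exactly twisted by \<beta> + \<gamma> from distance 2n
  + 2 on, so its mean is read off from the single cell \<open>R n\<close>. There b steps bring the
  cell integrals of F to \<open>lF\<close>, at once if \<beta> is trivial and geometrically
  otherwise, and smoothing of G finishes the estimate. Since the cell moves with n, the
  approximation of G must be uniform over all cells.\<close>

lemma pair_mixing_exact_quasi_periodic:
  fixes F G :: "real \<Rightarrow> complex"
  assumes F: "F \<in> borel_measurable borel" "\<And>x. norm (F x) \<le> C" "\<And>x k. F (x + of_int k) = twist \<beta> k * F x"
    and G: "G \<in> borel_measurable borel" "\<And>x. norm (G x) \<le> D" "\<And>x k. G (x + of_int k) = twist \<gamma> k * G x"
  shows "pair_mixing F G"
proof -
  have C: "C \<ge> 0" using order_trans[OF norm_ge_zero F(2)] .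
  define f where "f = cell_integral F"
  define g where "g = cell_integral G"
  have f: "f k = twist \<beta> k * f 0" for k
    using cell_integral_shift[of F 0 k] by (simp add: f_def F(3)) (simp add: cell_integral_def)
  have g: "g k = twist \<gamma> k * g 0" for k
    using cell_integral_shift[of G 0 k] by (simp add: g_def G(3)) (simp add: cell_integral_def)
  define lF where "lF = (if twist \<beta> 1 = 1 then f 0 else 0)"
  define lG where "lG = (if twist \<gamma> 1 = 1 then g 0 else 0)"
  have mean_F: "has_mean F lF" unfolding lF_def f_def
    by (rule has_mean_twisted_cells[OF F(1,2)]) (rule f[unfolded f_def])
  have mean_G: "has_mean G lG" unfolding lG_def g_def
    by (rule has_mean_twisted_cells[OF G(1,2)]) (rule g[unfolded g_def])
  define u where "u n x = F ((T ^^ n) x) * G x" for n x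
  have F_T: "(\<lambda>x. F ((T ^^ n) x)) \<in> borel_measurable borel" for n
    by (rule measurable_compose[OF T_funpow_measurable F(1)])
  have u_meas: "u n \<in> borel_measurable borel" for n
    unfolding u_def[abs_def] using F_T G(1) by measurable
  have u_bound: "norm (u n x) \<le> C * D" for n x
    unfolding u_def norm_mult by (intro mult_mono F G C) auto
  define R where "R n = 2 * int n + 2" for n
  define \<theta> where "\<theta> = \<beta> + \<gamma>"
  \<comment> \<open>The factor untwists the reference cell, so that \<kappa> is the common amplitude
    of all far cells.\<close>
  define \<kappa> where "\<kappa> n = twist \<theta> (- R n) * cell_integral (u n) (R n)" for n
  have cells: "cell_integral (u n) k = twist \<theta> k * \<kappa> n" if k: "\<bar>k\<bar> \<ge> R n" for n k
  proof -
    define d where "d = k - R n"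
    have k_eq: "R n + d = k" by (simp add: d_def)
    have "G (x - of_int d) = twist \<gamma> (- d) * G x" for x
      using G(3)[of x "- d"] by simp
    then have "(\<lambda>x. F ((T ^^ n) x) * G (x - of_int d)) = (\<lambda>x. twist \<gamma> (- d) * u n x)"
      by (simp add: u_def fun_eq_iff mult.left_commute)
    moreover have "cell_integral (\<lambda>x. F ((T ^^ n) x) * G (x - of_int d)) (R n + d) = twist \<beta> d * cell_integral (u n) (R n)"
      unfolding u_def
      using k by (intro cell_integral_twisted_shift[OF F G(1,2)]) (auto simp: R_def d_def)
    ultimately have shift: "twist \<gamma> (- d) * cell_integral (u n) k = twist \<beta> d * cell_integral (u n) (R n)"
      by (simp add: k_eq) (simp add: cell_integral_def)
    have "(twist \<gamma> (- d) * twist \<gamma> d) * cell_integral (u n) k = twist \<gamma> d * (twist \<gamma> (- d) * cell_integral (u n) k)"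
      by (simp only: mult_ac)
    also have "\<dots> = twist \<gamma> d * (twist \<beta> d * cell_integral (u n) (R n))"
      by (simp only: shift)
    also have "\<dots> = twist \<theta> d * cell_integral (u n) (R n)"
      by (simp only: \<theta>_def twist_theta_add mult_ac)
    finally have "cell_integral (u n) k = twist \<theta> d * cell_integral (u n) (R n)"
      by (simp only: twist_minus mult_1_left)
    also have "twist \<theta> d = twist \<theta> k * twist \<theta> (- R n)"
      using twist_add[of \<theta> k "- R n"] by (simp add: d_def)
    finally show ?thesis by (simp only: \<kappa>_def mult.assoc)
  qed
  have mean_u: "has_mean (u n) (if twist \<theta> 1 = 1 then \<kappa> n else 0)" for n
    by (rule has_mean_twisted_cells[OF u_meas u_bound cells])
  have limit: "(\<lambda>n. cell_integral (u n) (R n) - lF * g (R n)) \<longlonglongrightarrow> 0"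
  proof (rule LIMSEQ_I)
    fix e :: real assume "e > 0"
    \<comment> \<open>One decay rate for both cases: for a trivial character the values equal
      \<open>lF\<close> exactly and 0 serves as rate.\<close>
    obtain \<mu> where \<mu>: "0 \<le> \<mu>" "\<mu> < 1"
      "\<And>b k. \<bar>k\<bar> \<ge> 2 * int b + 2 \<Longrightarrow> norm ((avg ^^ b) f k - lF) \<le> \<mu> ^ b * C"
    proof (cases "twist \<beta> 1 = 1")
      case True
      have "f k = f 0" for k using f[of k] twist_trivial[OF True, of k] by simp
      then have f_const: "f = (\<lambda>_. f 0)" by (rule ext)
      have "(avg ^^ b) f = (\<lambda>_. f 0)" for b
        using arg_cong[OF f_const, of "avg ^^ b"] by (simp only: avg_funpow_const)
      then have "(avg ^^ b) f k = lF" for b k using True by (simp add: lF_def)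
      then show thesis using C by (intro that[of 0]) auto
    next
      case False
      have f_bound: "norm (f 0) \<le> C" unfolding f_def by (rule norm_cell_integral_le) (rule F)
      show thesis
      proof (rule that[OF _ walk_symbol_less_1[OF False]])
        fix b k assume "\<bar>k\<bar> \<ge> 2 * int b + 2"
        then have "(avg ^^ b) f k - lF = (((1 + 2 * cos \<beta>) / 3)\<^sup>2) ^ b *\<^sub>R (twist \<beta> k * f 0)"
          using False avg_funpow_twist[OF f] by (simp add: lF_def)
        then have "norm ((avg ^^ b) f k - lF) = (((1 + 2 * cos \<beta>) / 3)\<^sup>2) ^ b * norm (f 0)"
          by (simp add: norm_mult)
        also have "\<dots> \<le> (((1 + 2 * cos \<beta>) / 3)\<^sup>2) ^ b * C"
          by (intro mult_left_mono f_bound) auto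
        finally show "norm ((avg ^^ b) f k - lF) \<le> (((1 + 2 * cos \<beta>) / 3)\<^sup>2) ^ b * C" .
      qed simp
    qed
    define e' where "e' = e / (2 * (C + norm lF + 1))"
    have e': "e' > 0" "(C + norm lF) * e' < e / 2"
    proof -
      define S where "S = C + norm lF + 1"
      have "S > 0" using C norm_ge_zero[of lF] by (simp add: S_def add_nonneg_pos)
      then show pos: "e' > 0" using \<open>e > 0\<close> by (simp add: e'_def S_def[symmetric])
      have "(C + norm lF) * e' < S * e'" using pos by (intro mult_strict_right_mono) (simp_all add: S_def)
      also have "S * e' = e / 2" using \<open>S > 0\<close> by (simp add: e'_def S_def[symmetric])
      finally show "(C + norm lF) * e' < e / 2" .
    qed
    have G_cell: "integrable lborel (\<lambda>x. indicator {0..1} x *\<^sub>R G x)"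
      using set_integrable_bounded[OF G(1,2), of 0 1] by (simp add: set_integrable_def)
    obtain L M h where h: "L-lipschitz_on UNIV h" "(LINT x|lborel. norm (indicator {0..1} x *\<^sub>R G x - h x)) < e'"
        and supp: "\<forall>x. \<bar>x\<bar> > real M \<longrightarrow> h x = 0"
      using integrable_imp_lipschitz_dense[OF G_cell] e'(1) unfolding lipschitz_dense_def by blast
    have h_int: "integrable lborel h"
      by (rule integrable_compact_support[OF h(1)]) (use supp in blast)
    \<comment> \<open>The approximation made on [0, 1] is carried to the cell \<open>k\<close> by
      the character; quasi-periodicity of G makes its error and its Lipschitz constant the same for
      every cell.\<close>
    define h' where "h' k x = twist \<gamma> k * h (x - of_int k)" for k x
    have L: "L \<ge> 0" by (rule lipschitz_on_nonneg[OF h(1)])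
    have h'_lip: "L-lipschitz_on UNIV (h' k)" for k
    proof (rule lipschitz_onI[OF _ L])
      fix x y
      have "dist (h (x - of_int k)) (h (y - of_int k)) \<le> L * dist (x - of_int k) (y - of_int k)"
        by (rule lipschitz_onD[OF h(1)]) auto
      then show "dist (h' k x) (h' k y) \<le> L * dist x y"
        by (simp add: h'_def dist_norm right_diff_distrib[symmetric] norm_mult)
    qed
    have h'_int: "set_integrable lborel {a..b} (h' k)" "h' k \<in> borel_measurable borel" for a b k
      by (rule set_integrable_lipschitz[OF h'_lip])+
    have close: "cell_integral (\<lambda>x. norm (G x - h' k x)) k \<le> e'" for k
    proof -
      have "cell_integral (\<lambda>x. norm (G x - h' k x)) (0 + k) = cell_integral (\<lambda>x. norm (G x - h x)) 0"
        unfolding cell_integral_shift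
        by (simp add: h'_def G(3) right_diff_distrib[symmetric] norm_mult)
      also have "\<dots> = (LINT x|lborel. indicator {0..1} x * norm (indicator {0..1} x *\<^sub>R G x - h x))"
        unfolding cell_integral_def set_lebesgue_integral_def
        by (rule Bochner_Integration.integral_cong) (auto simp: indicator_def)
      also have "\<dots> \<le> (LINT x|lborel. norm (indicator {0..1} x *\<^sub>R G x - h x))"
      proof (rule integral_mono)
        have int: "integrable lborel (\<lambda>x. norm (indicator {0..1} x *\<^sub>R G x - h x))"
          by (intro integrable_norm Bochner_Integration.integrable_diff G_cell h_int)
        then show "integrable lborel (\<lambda>x. norm (indicator {0..1} x *\<^sub>R G x - h x))" .
        show "integrable lborel (\<lambda>x. indicator {0..1} x * norm (indicator {0..1} x *\<^sub>R G x - h x))"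
          using integrable_mult_indicator[OF _ int, of "{0..1}"] by simp
      qed (auto simp: indicator_def)
      finally show ?thesis using h(2) by simp
    qed
    define A where "A = cell_integral (\<lambda>x. norm (h x)) 0"
    have A: "cell_integral (\<lambda>x. norm (h' k x)) k = A" for k
      using cell_integral_shift[of "\<lambda>x. norm (h' k x)" 0 k] by (simp add: h'_def norm_mult A_def)
    have bound: "norm (cell_integral (u (a + b)) (R (a + b)) - lF * g (R (a + b)))
        \<le> (C + norm lF) * e' + (\<mu> ^ b * C * A + (5/9) ^ a * L * C)" for a b
    proof -
      define n k where "n = a + b" and "k = R n"
      define H where "H x = F ((T ^^ b) x)" for x
      have H: "H \<in> borel_measurable borel" "norm (H x) \<le> C" for x
        unfolding H_def[abs_def] using F_T F(2) by auto
      have HT: "F ((T ^^ n) x) = H ((T ^^ a) x)" for x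
        by (simp add: H_def n_def add.commute[of a b] funpow_add)
      have main: "norm (cell_integral (\<lambda>x. H ((T ^^ a) x) * h' k x) k - lF * cell_integral (h' k) k)
          \<le> \<mu> ^ b * C * cell_integral (\<lambda>x. norm (h' k x)) k + (5/9) ^ a * L * C"
      proof (rule cell_mixing[OF H h'_lip])
        \<comment> \<open>As \<open>k\<close> = 2(a + b) + 2, losing 2a leaves distance 2b + 2 from
          0.\<close>
        fix l assume "\<bar>l - k\<bar> \<le> 2 * int a"
        then have "\<bar>l\<bar> \<ge> 2 * int b + 2" by (auto simp: k_def R_def n_def)
        then show "norm (cell_integral H l - lF) \<le> \<mu> ^ b * C"
          unfolding H_def[abs_def] cell_integral_T_funpow[OF F(1,2)] f_def[symmetric] by (rule \<mu>(3))
      qed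
      have HT_meas: "(\<lambda>x. H ((T ^^ a) x)) \<in> borel_measurable borel"
        by (rule measurable_compose[OF T_funpow_measurable H(1)])
      have G_int: "set_integrable lborel {x..y} G" for x y by (rule set_integrable_bounded[OF G(1,2)])
      have diff_int: "set_integrable lborel {x..y} (\<lambda>x. G x - h' k x)" for x y
        by (intro set_integral_diff G_int h'_int)
      have e1: "cell_integral (\<lambda>x. H ((T ^^ a) x) * (G x - h' k x)) k
          = cell_integral (\<lambda>x. H ((T ^^ a) x) * G x) k - cell_integral (\<lambda>x. H ((T ^^ a) x) * h' k x) k"
        unfolding cell_integral_def right_diff_distrib
        by (intro set_integral_diff set_integrable_mult_bounded[OF HT_meas H(2)] G_int h'_int)
      have e2: "cell_integral (\<lambda>x. G x - h' k x) k = g k - cell_integral (h' k) k"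
        unfolding cell_integral_def g_def by (intro set_integral_diff G_int h'_int)
      have e3: "cell_integral (u n) k = cell_integral (\<lambda>x. H ((T ^^ a) x) * G x) k"
        by (simp add: u_def[abs_def] HT)
      have split: "cell_integral (u n) k - lF * g k
          = (cell_integral (\<lambda>x. H ((T ^^ a) x) * (G x - h' k x)) k - lF * cell_integral (\<lambda>x. G x - h' k x) k)
            + (cell_integral (\<lambda>x. H ((T ^^ a) x) * h' k x) k - lF * cell_integral (h' k) k)"
        by (simp only: e1 e2 e3) (simp add: right_diff_distrib)
      have "norm (cell_integral (\<lambda>x. H ((T ^^ a) x) * (G x - h' k x)) k)
          \<le> cell_integral (\<lambda>x. norm (H ((T ^^ a) x) * (G x - h' k x))) k"
        unfolding cell_integral_def
        by (intro set_integral_norm_bound set_integrable_mult_bounded[OF HT_meas H(2)] diff_int)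
      also have "\<dots> \<le> cell_integral (\<lambda>x. C * norm (G x - h' k x)) k"
        unfolding cell_integral_def
      proof (rule set_integral_mono)
        show "norm (H ((T ^^ a) x) * (G x - h' k x)) \<le> C * norm (G x - h' k x)" for x
          unfolding norm_mult by (intro mult_right_mono H) auto
        show "set_integrable lborel {real_of_int k..real_of_int k + 1} (\<lambda>x. norm (H ((T ^^ a) x) * (G x - h' k x)))"
          by (intro set_integrable_norm set_integrable_mult_bounded[OF HT_meas H(2)] diff_int)
        show "set_integrable lborel {real_of_int k..real_of_int k + 1} (\<lambda>x. C * norm (G x - h' k x))"
          by (intro set_integrable_mult_right set_integrable_norm diff_int)
      qed
      also have "\<dots> = C * cell_integral (\<lambda>x. norm (G x - h' k x)) k" by (simp add: cell_integral_def)
      also have "\<dots> \<le> C * e'" by (intro mult_left_mono close C)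
      finally have 1: "norm (cell_integral (\<lambda>x. H ((T ^^ a) x) * (G x - h' k x)) k) \<le> C * e'" .
      have "norm (cell_integral (\<lambda>x. G x - h' k x) k) \<le> e'"
        using set_integral_norm_bound[OF diff_int] close[of k]
        unfolding cell_integral_def by (rule order_trans)
      then have "norm (lF * cell_integral (\<lambda>x. G x - h' k x) k) \<le> norm lF * e'"
        unfolding norm_mult by (rule mult_left_mono) simp
      with 1 have "norm (cell_integral (\<lambda>x. H ((T ^^ a) x) * (G x - h' k x)) k - lF * cell_integral (\<lambda>x. G x - h' k x) k)
          \<le> C * e' + norm lF * e'"
        by (intro order_trans[OF norm_triangle_ineq4] add_mono)
      with main have "norm (cell_integral (u n) k - lF * g k) \<le> (C * e' + norm lF * e') + (\<mu> ^ b * C * A + (5/9) ^ a * L * C)"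
        unfolding split A by (intro norm_triangle_mono)
      then show ?thesis by (simp add: n_def k_def distrib_right)
    qed
    have "(\<lambda>a. (\<mu> ^ a * C * A + (5/9) ^ a * L * C)) \<longlonglongrightarrow> 0 * C * A + 0 * L * C"
      using \<mu> by (intro tendsto_add tendsto_mult_right LIMSEQ_realpow_zero) auto
    then have "\<forall>\<^sub>F a in sequentially. \<mu> ^ a * C * A + (5/9) ^ a * L * C < e / 2"
      using \<open>e > 0\<close> by (intro order_tendstoD(2)) auto
    then obtain a where a: "\<mu> ^ a * C * A + (5/9) ^ a * L * C < e / 2"
      using eventually_happens'[OF sequentially_bot] by blast
    have A_nonneg: "A \<ge> 0" unfolding A_def cell_integral_def set_lebesgue_integral_def
      by (intro Bochner_Integration.integral_nonneg) auto
    \<comment> \<open>From n \<ge> 2a on, the remaining n - a averaging steps number at least a, so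
      their error is below \<mu>^a.\<close>
    have "norm (cell_integral (u n) (R n) - lF * g (R n)) < e" if "n \<ge> 2 * a" for n
    proof -
      have "norm (cell_integral (u (a + (n - a))) (R (a + (n - a))) - lF * g (R (a + (n - a))))
        \<le> (C + norm lF) * e' + (\<mu> ^ (n - a) * C * A + (5/9) ^ a * L * C)" by (rule bound)
      moreover have "\<mu> ^ (n - a) * C * A \<le> \<mu> ^ a * C * A"
        using that \<mu> C A_nonneg by (intro mult_right_mono power_decreasing) auto
      ultimately show ?thesis using a e'(2) that by simp
    qed
    then show "\<exists>n0. \<forall>n\<ge>n0. norm (cell_integral (u n) (R n) - lF * g (R n) - 0) < e" by auto
  qed
  \<comment> \<open>If the product character is trivial, then \<beta> and \<gamma> are both trivial,
    or both nontrivial with \<open>lF\<close> = 0. Otherwise one of them is nontrivial and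
    \<open>lF * lG\<close> = 0.\<close>
  have "(\<lambda>n. if twist \<theta> 1 = 1 then \<kappa> n else 0) \<longlonglongrightarrow> lF * lG"
  proof (cases "twist \<theta> 1 = 1")
    case True
    have "lF * g k = lF * lG" for k
    proof (cases "twist \<beta> 1 = 1")
      case \<beta>: True
      then have \<gamma>: "twist \<gamma> 1 = 1" using True by (simp add: \<theta>_def twist_theta_add)
      then show ?thesis using g[of k] by (simp add: lG_def twist_trivial)
    qed (simp add: lF_def)
    with limit have "(\<lambda>n. cell_integral (u n) (R n) - lF * lG) \<longlonglongrightarrow> 0" by simp
    then show ?thesis using True by (simp add: \<kappa>_def twist_trivial LIM_zero_iff)
  next
    case False
    then have zero: "lF * lG = 0" by (auto simp: lF_def lG_def \<theta>_def twist_theta_add)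
    show ?thesis unfolding zero using False by simp
  qed
  then show ?thesis
    using mean_u unfolding u_def[abs_def] by (intro pair_mixingI[OF mean_F mean_G])
qed

lemma pair_mixing_quasi_periodic:
  assumes "F \<in> quasi_periodic" "G \<in> quasi_periodic"
  shows "pair_mixing F G"
proof -
  obtain F' C \<beta> where F': "F' \<in> borel_measurable borel" "\<And>x. norm (F' x) \<le> C"
    "AE x in lborel. F x = F' x" "\<And>x k. F' (x + of_int k) = twist \<beta> k * F' x"
    using quasi_periodic_representative[OF assms(1)] by metis
  obtain G' D \<gamma> where G': "G' \<in> borel_measurable borel" "\<And>x. norm (G' x) \<le> D"
    "AE x in lborel. G x = G' x" "\<And>x k. G' (x + of_int k) = twist \<gamma> k * G' x"
    using quasi_periodic_representative[OF assms(2)] by metis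
  have "pair_mixing F' G'"
    by (rule pair_mixing_exact_quasi_periodic[OF F'(1,2,4) G'(1,2,4)])
  then show ?thesis
  proof (rule pair_mixing_cong_AE)
    show "F \<in> L_infty" "G \<in> L_infty" using assms by (simp_all add: quasi_periodic_def)
  qed (fact F'(3) G'(3) bounded_in_L_infty[OF F'(1,2)] bounded_in_L_infty[OF G'(1,2)])+
qed

lemma pair_mixing_span:
  assumes "F \<in> quasi_periodic_span" "G \<in> quasi_periodic_span"
  shows "pair_mixing F G"
proof -
  obtain n :: nat and c H where F: "F = (\<lambda>x. \<Sum>i<n. c i * H i x)" "\<forall>i<n. H i \<in> quasi_periodic"
    using assms(1) unfolding quasi_periodic_span_def by (elim CollectE exE conjE) (rule that)
  obtain m :: nat and d K where G: "G = (\<lambda>x. \<Sum>i<m. d i * K i x)" "\<forall>i<m. K i \<in> quasi_periodic"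
    using assms(2) unfolding quasi_periodic_span_def by (elim CollectE exE conjE) (rule that)
  have H_inf: "H i \<in> L_infty" if "i < n" for i using F(2) that by (simp add: quasi_periodic_def)
  have K_inf: "K j \<in> L_infty" if "j < m" for j using G(2) that by (simp add: quasi_periodic_def)
  have mix: "pair_mixing (H i) (K j)" if "i < n" "j < m" for i j
    using F(2) G(2) that by (intro pair_mixing_quasi_periodic) auto
  \<comment> \<open>Pairing \<open>H i\<close> with itself yields its mean even if the other sum is
    empty.\<close>
  have H_mean: "mean_exists (H i)" if "i < n" for i
    using pair_mixing_quasi_periodic[of "H i" "H i"] F(2) that by (simp add: pair_mixing_def)
  have K_mean: "mean_exists (K j)" if "j < m" for j
    using pair_mixing_quasi_periodic[of "K j" "K j"] G(2) that by (simp add: pair_mixing_def)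
  show ?thesis
  proof (rule pair_mixingI)
    show "has_mean F (\<Sum>i<n. c i * mean (H i))"
      unfolding F(1) by (rule has_mean_sum) (auto intro: has_mean_mean H_mean H_inf)
    show "has_mean G (\<Sum>j<m. d j * mean (K j))"
      unfolding G(1) by (rule has_mean_sum) (auto intro: has_mean_mean K_mean K_inf)
    fix r
    have "(\<lambda>x. F ((T ^^ r) x) * G x)
        = (\<lambda>x. \<Sum>(i, j)\<in>{..<n} \<times> {..<m}. (c i * d j) * (H i ((T ^^ r) x) * K j x))"
      by (simp only: F(1) G(1) sum_product sum.cartesian_product) (simp add: mult_ac)
    moreover have "has_mean (\<lambda>x. \<Sum>p\<in>{..<n} \<times> {..<m}. (c (fst p) * d (snd p)) * (H (fst p) ((T ^^ r) x) * K (snd p) x))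
        (\<Sum>p\<in>{..<n} \<times> {..<m}. (c (fst p) * d (snd p)) * mean (\<lambda>x. H (fst p) ((T ^^ r) x) * K (snd p) x))"
    proof (rule has_mean_sum)
      fix p assume p: "p \<in> {..<n} \<times> {..<m}"
      then show "(\<lambda>x. H (fst p) ((T ^^ r) x) * K (snd p) x) \<in> L_infty"
        by (intro L_infty_mult L_infty_T_funpow H_inf K_inf) auto
      show "has_mean (\<lambda>x. H (fst p) ((T ^^ r) x) * K (snd p) x) (mean (\<lambda>x. H (fst p) ((T ^^ r) x) * K (snd p) x))"
        using mix[of "fst p" "snd p"] p by (intro has_mean_mean) (auto simp: pair_mixing_def)
    qed simp
    ultimately show "has_mean (\<lambda>x. F ((T ^^ r) x) * G x)
        (\<Sum>p\<in>{..<n} \<times> {..<m}. (c (fst p) * d (snd p)) * mean (\<lambda>x. H (fst p) ((T ^^ r) x) * K (snd p) x))"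
      by (simp add: case_prod_beta)
  next
    have "(\<Sum>i<n. c i * mean (H i)) * (\<Sum>j<m. d j * mean (K j))
        = (\<Sum>p\<in>{..<n} \<times> {..<m}. (c (fst p) * d (snd p)) * (mean (H (fst p)) * mean (K (snd p))))"
      by (simp only: sum_product sum.cartesian_product) (simp add: case_prod_beta mult_ac)
    moreover have "(\<lambda>r. \<Sum>p\<in>{..<n} \<times> {..<m}. (c (fst p) * d (snd p)) * mean (\<lambda>x. H (fst p) ((T ^^ r) x) * K (snd p) x))
        \<longlonglongrightarrow> (\<Sum>p\<in>{..<n} \<times> {..<m}. (c (fst p) * d (snd p)) * (mean (H (fst p)) * mean (K (snd p))))"
    proof (intro tendsto_sum tendsto_mult_left)
      fix p assume "p \<in> {..<n} \<times> {..<m}"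
      then show "(\<lambda>r. mean (\<lambda>x. H (fst p) ((T ^^ r) x) * K (snd p) x)) \<longlonglongrightarrow> mean (H (fst p)) * mean (K (snd p))"
        using mix[of "fst p" "snd p"] by (auto simp: pair_mixing_def)
    qed
    ultimately show "(\<lambda>r. \<Sum>p\<in>{..<n} \<times> {..<m}. (c (fst p) * d (snd p)) * mean (\<lambda>x. H (fst p) ((T ^^ r) x) * K (snd p) x))
        \<longlonglongrightarrow> (\<Sum>i<n. c i * mean (H i)) * (\<Sum>j<m. d j * mean (K j))" by simp
  qed
qed

lemma quasi_periodic_span_L_infty: "F \<in> quasi_periodic_span \<Longrightarrow> F \<in> L_infty"
  unfolding quasi_periodic_span_def quasi_periodic_def
  by (auto intro!: L_infty_sum L_infty_mult L_infty_const)

text \<open>Composition with the iterates keeps the sup-norm error, so approximating both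
  observables from the span is uniform in n and mixing passes to the closure.\<close>

lemma pair_mixing_G2:
  assumes "F \<in> G2" "G \<in> G2"
  shows "pair_mixing F G"
proof -
  obtain A where F: "F \<in> L_infty" "AE x in lborel. norm (F x) \<le> A" "A \<ge> 0"
  proof -
    obtain C where "F \<in> L_infty" "AE x in lborel. norm (F x) \<le> C"
      using assms(1) by (auto simp: G2_def L_infty_def)
    then show thesis by (intro that[of "max C 0"]) (auto elim: eventually_mono)
  qed
  obtain B where G: "G \<in> L_infty" "AE x in lborel. norm (G x) \<le> B" "B \<ge> 0"
  proof -
    obtain C where "G \<in> L_infty" "AE x in lborel. norm (G x) \<le> C"
      using assms(2) by (auto simp: G2_def L_infty_def)
    then show thesis by (intro that[of "max C 0"]) (auto elim: eventually_mono)
  qed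
  \<comment> \<open>The numerical product estimate is exported because it serves twice: pointwise
    for the functions and once more for their means.\<close>
  have approx: "\<exists>F'\<in>quasi_periodic_span. \<exists>G'\<in>quasi_periodic_span.
      (AE x in lborel. norm (F x - F' x) \<le> e) \<and> (AE x in lborel. norm (G x - G' x) \<le> e) \<and>
      (\<forall>n. AE x in lborel. norm (F ((T ^^ n) x) * G x - F' ((T ^^ n) x) * G' x) \<le> e) \<and>
      (\<forall>a b a' b' :: complex. norm a \<le> A \<longrightarrow> norm b \<le> B \<longrightarrow> norm (a - a') \<le> \<delta> \<longrightarrow> norm (b - b') \<le> \<delta> \<longrightarrow>
         norm (a * b - a' * b') \<le> e) \<and>
      (AE x in lborel. norm (F x - F' x) \<le> \<delta>) \<and> (AE x in lborel. norm (G x - G' x) \<le> \<delta>)"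
    if \<delta>: "\<delta> = min 1 (e / (A + B + 1))" and e: "e > 0" for e \<delta>
  proof -
    have \<delta>_pos: "\<delta> > 0" "\<delta> \<le> 1" using e F(3) G(3) by (auto simp: \<delta> intro!: divide_pos_pos)
    have "\<delta> \<le> e / (A + B + 1)" by (simp add: \<delta>)
    then have \<delta>_le: "\<delta> * (A + B + 1) \<le> e" using F(3) G(3) by (simp add: field_simps)
    have "\<delta> * 1 \<le> \<delta> * (A + B + 1)" using \<delta>_pos F(3) G(3) by (intro mult_left_mono) auto
    then have \<delta>_e: "\<delta> \<le> e" using \<delta>_le by simp
    \<comment> \<open>The product error is at most A\<delta> + \<delta>(B + 1), where \<delta> \<le>
      1 bounds the approximant of b by B + 1; this explains the denominator A + B + 1 and the
      minimum with 1.\<close>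
    have prod: "norm (a * b - a' * b') \<le> e"
      if "norm a \<le> A" "norm b \<le> B" "norm (a - a') \<le> \<delta>" "norm (b - b') \<le> \<delta>" for a b a' b' :: complex
    proof -
      have "norm b' \<le> norm b + norm (b - b')"
        using norm_triangle_ineq4[of b "b - b'"] by simp
      then have b': "norm b' \<le> B + 1" using that \<delta>_pos by linarith
      have "a * b - a' * b' = a * (b - b') + (a - a') * b'" by (simp add: algebra_simps)
      also have "norm \<dots> \<le> A * \<delta> + \<delta> * (B + 1)"
        using that b' F(3) \<delta>_pos
        by (intro norm_triangle_mono) (auto simp: norm_mult intro!: mult_mono)
      also have "\<dots> \<le> e" using \<delta>_le by (simp add: algebra_simps)
      finally show ?thesis .
    qed
    obtain F' where F': "F' \<in> quasi_periodic_span" "AE x in lborel. norm (F x - F' x) \<le> \<delta>"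
      using assms(1) \<delta>_pos by (auto simp: G2_def)
    obtain G' where G': "G' \<in> quasi_periodic_span" "AE x in lborel. norm (G x - G' x) \<le> \<delta>"
      using assms(2) \<delta>_pos by (auto simp: G2_def)
    have "AE x in lborel. norm (F ((T ^^ n) x) * G x - F' ((T ^^ n) x) * G' x) \<le> e" for n
      using AE_T_funpow[OF F(2), of n] G(2) AE_T_funpow[OF F'(2), of n] G'(2)
      by eventually_elim (rule prod)
    moreover have "AE x in lborel. norm (F x - F' x) \<le> e" "AE x in lborel. norm (G x - G' x) \<le> e"
      using F'(2) G'(2) \<delta>_e by (auto elim: eventually_mono)
    ultimately show ?thesis using F' G' prod by blast
  qed
  have FG_inf: "(\<lambda>x. F ((T ^^ n) x) * G x) \<in> L_infty" for n
    by (intro L_infty_mult L_infty_T_funpow F G)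
  have F_mean: "mean_exists F"
  proof (rule mean_exists_approx[OF F(1)])
    fix e :: real assume "e > 0"
    from approx[OF refl this] show "\<exists>v\<in>L_infty. mean_exists v \<and> (AE x in lborel. norm (F x - v x) \<le> e)"
      using pair_mixing_span quasi_periodic_span_L_infty unfolding pair_mixing_def by meson
  qed
  have G_mean: "mean_exists G"
  proof (rule mean_exists_approx[OF G(1)])
    fix e :: real assume "e > 0"
    from approx[OF refl this] show "\<exists>v\<in>L_infty. mean_exists v \<and> (AE x in lborel. norm (G x - v x) \<le> e)"
      using pair_mixing_span quasi_periodic_span_L_infty unfolding pair_mixing_def by meson
  qed
  have FG_mean: "mean_exists (\<lambda>x. F ((T ^^ n) x) * G x)" for n
  proof (rule mean_exists_approx[OF FG_inf])
    fix e :: real assume "e > 0"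
    from approx[OF refl this] obtain F' G' where F'G': "F' \<in> quasi_periodic_span" "G' \<in> quasi_periodic_span"
      "AE x in lborel. norm (F ((T ^^ n) x) * G x - F' ((T ^^ n) x) * G' x) \<le> e" by blast
    then have "mean_exists (\<lambda>x. F' ((T ^^ n) x) * G' x)"
      using pair_mixing_span by (auto simp: pair_mixing_def)
    moreover have "(\<lambda>x. F' ((T ^^ n) x) * G' x) \<in> L_infty"
      using F'G' by (intro L_infty_mult L_infty_T_funpow quasi_periodic_span_L_infty)
    ultimately show "\<exists>v\<in>L_infty. mean_exists v \<and> (AE x in lborel. norm (F ((T ^^ n) x) * G x - v x) \<le> e)"
      using F'G'(3) by blast
  qed
  show ?thesis
  proof (rule pair_mixingI[OF has_mean_mean[OF F_mean] has_mean_mean[OF G_mean] has_mean_mean[OF FG_mean]])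
    show "(\<lambda>n. mean (\<lambda>x. F ((T ^^ n) x) * G x)) \<longlonglongrightarrow> mean F * mean G"
    proof (rule LIMSEQ_I)
      fix e :: real assume "e > 0"
      then have e3: "e / 3 > 0" by simp
      define \<delta> where "\<delta> = min 1 (e / 3 / (A + B + 1))"
      obtain F' G' where F'G': "F' \<in> quasi_periodic_span" "G' \<in> quasi_periodic_span"
        and prod_close: "\<And>n. AE x in lborel. norm (F ((T ^^ n) x) * G x - F' ((T ^^ n) x) * G' x) \<le> e / 3"
        and prod: "\<And>a b a' b' :: complex. norm a \<le> A \<Longrightarrow> norm b \<le> B \<Longrightarrow> norm (a - a') \<le> \<delta> \<Longrightarrow> norm (b - b') \<le> \<delta> \<Longrightarrow>
           norm (a * b - a' * b') \<le> e / 3"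
        and close: "AE x in lborel. norm (F x - F' x) \<le> \<delta>" "AE x in lborel. norm (G x - G' x) \<le> \<delta>"
        using approx[OF \<delta>_def e3] by blast
      have mix: "pair_mixing F' G'" by (rule pair_mixing_span[OF F'G'])
      have inf: "F' \<in> L_infty" "G' \<in> L_infty" using F'G' by (auto intro: quasi_periodic_span_L_infty)
      obtain n0 where n0: "\<forall>n\<ge>n0. norm (mean (\<lambda>x. F' ((T ^^ n) x) * G' x) - mean F' * mean G') < e / 3"
      proof -
        have "(\<lambda>n. mean (\<lambda>x. F' ((T ^^ n) x) * G' x)) \<longlonglongrightarrow> mean F' * mean G'"
          using mix by (simp add: pair_mixing_def)
        from LIMSEQ_D[OF this e3] show thesis using that by blast
      qed
      have mF: "has_mean F' (mean F')" "has_mean G' (mean G')"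
        using mix by (auto simp: pair_mixing_def intro: has_mean_mean)
      have "norm (mean F * mean G - mean F' * mean G') \<le> e / 3"
      proof (rule prod)
        show "norm (mean F) \<le> A" by (rule norm_mean_le[OF F(1,2) has_mean_mean[OF F_mean]])
        show "norm (mean G) \<le> B" by (rule norm_mean_le[OF G(1,2) has_mean_mean[OF G_mean]])
        show "norm (mean F - mean F') \<le> \<delta>"
          by (rule mean_close[OF F(1) inf(1) close(1) has_mean_mean[OF F_mean] mF(1)])
        show "norm (mean G - mean G') \<le> \<delta>"
          by (rule mean_close[OF G(1) inf(2) close(2) has_mean_mean[OF G_mean] mF(2)])
      qed
      then have 3: "norm (mean F' * mean G' - mean F * mean G) \<le> e / 3" by (simp add: norm_minus_commute)
      have triangle: "norm (x - w) < e"
        if "norm (x - y) \<le> e / 3" "norm (y - z) < e / 3" "norm (z - w) \<le> e / 3" for x y z w :: complex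
      proof -
        have "norm (x - w) \<le> norm (x - y) + norm (y - z) + norm (z - w)"
          using norm_triangle_ineq[of "x - y" "y - z"] norm_triangle_ineq[of "x - z" "z - w"] by simp
        then show ?thesis using that by linarith
      qed
      have "norm (mean (\<lambda>x. F ((T ^^ n) x) * G x) - mean F * mean G) < e" if "n \<ge> n0" for n
      proof -
        have "has_mean (\<lambda>x. F' ((T ^^ n) x) * G' x) (mean (\<lambda>x. F' ((T ^^ n) x) * G' x))"
          using mix by (auto simp: pair_mixing_def intro: has_mean_mean)
        then have 1: "norm (mean (\<lambda>x. F ((T ^^ n) x) * G x) - mean (\<lambda>x. F' ((T ^^ n) x) * G' x)) \<le> e / 3"
          using inf by (intro mean_close[OF FG_inf _ prod_close has_mean_mean[OF FG_mean]])
            (auto intro: L_infty_mult L_infty_T_funpow)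
        have 2: "norm (mean (\<lambda>x. F' ((T ^^ n) x) * G' x) - mean F' * mean G') < e / 3"
          using n0 that by simp
        show ?thesis by (rule triangle[OF 1 2 3])
      qed
      then show "\<exists>n0. \<forall>n\<ge>n0. norm (mean (\<lambda>x. F ((T ^^ n) x) * G x) - mean F * mean G) < e" by blast
    qed
  qed
qed

end

theorem proposition4p8:
  fixes T :: "real \<Rightarrow> real"
  assumes "associated_map walkQ T"
  shows "irreducible_map (markov_partition walkQ) T \<and> conservative_map T \<and> exact_map T \<and>
    (\<forall>F\<in>L_infty. \<forall>g\<in>L_one. (LINT x|lborel. g x) = 0 \<longrightarrow>
       (\<lambda>n. LINT x|lborel. F ((T ^^ n) x) * g x) \<longlonglongrightarrow> 0) \<and>
    (\<forall>F\<in>G2. \<forall>G\<in>G2.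
       mean_exists F \<and> mean_exists G \<and>
       (\<forall>\<^sub>F n in sequentially. mean_exists (\<lambda>x. F ((T ^^ n) x) * G x)) \<and>
       (\<lambda>n. mean (\<lambda>x. F ((T ^^ n) x) * G x)) \<longlonglongrightarrow> mean F * mean G) \<and>
    (\<forall>F\<in>G_sym. \<forall>g\<in>L_one.
       (\<lambda>n. LINT x|lborel. F ((T ^^ n) x) * g x) \<longlonglongrightarrow> sym_mean F * (LINT x|lborel. g x))"
proof -
  interpret walk_map T by standard (rule assms)
  show ?thesis
    using irreducible conservative exact integral_T_funpow_tendsto_0 integral_T_funpow_sym_mean
      pair_mixing_G2
    by (simp add: pair_mixing_def)
qed

end
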